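(* Let $(\mathcal C,\otimes,I,C)$ be a (strict) braided tensor category. Let $H$ be a finite Hopf algebra in $\mathcal C$ with $C_{H,H}=C_{H,H}^{-1}$, and let $(R,\alpha)$ be a left $H$-module algebra in $\mathcal C$. Then $$(R\# H)\# H^{\hat *}\;\cong\; R\otimes (H\,\bar\otimes\, H^{\hat *})\quad\text{as algebras in }\mathcal C .$$
   Context: All categories are treated as strict; $I$ is the unit object and $C$ the braiding. Composition is written right to left. Algebras, coalgebras, bialgebras, Hopf algebras $(H,m,\eta,\Delta,\epsilon,S)$ and modules are understood in $\mathcal C$; tensor product algebras and coalgebras are formed using $C$. Duals. A left dual of $V$ is an object $V^*$ with morphisms $d:V^*\otimes V\to I$ (evaluation) and $b:I\to V\otimes V^*$ (coevaluation) such that $(d\otimes id_{V^*})(id_{V^*}\otimes b)=id_{V^*}$ and $(id_V\otimes d)(b\otimes id_V)=id_V$. $V$ is finite if it has a left dual. The transpose of $f:U\to V$ is $f^*=(d\otimes id_{U^*})(id_{V^*}\otimes f\otimes id_{U^*})(id_{V^*}\otimes b):V^*\to U^*$. The left dual of $U\otimes V$ is taken to be $V^*\otimes U^*$ with evaluation $d_V(id_{V^*}\otimes d_U\otimes id_V)$. For a finite Hopf algebra $H$ with $C_{H,H}=C_{H,H}^{-1}$, $H^*$ is the Hopf algebra with structure maps the transposes of those of $H$ (multiplication $\Delta^*$, comultiplication $m^*$, etc.), and $H^{\hat *}=((H^* )^{op})^{cop}$, where $op$ replaces the multiplication $m$ by $m\,C$ and $cop$ replaces the comultiplication $\Delta$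 by $C\,\Delta$. Equivalently, $H^{\hat *}$ has multiplication and comultiplication determined by $d(m_{H^{\hat *}}\otimes id_H)=(d\otimes d)(id\otimes C_{H^*,H}\otimes id)(id\otimes id\otimes\Delta_H)$ and $d(id\otimes m_H)=(d\otimes d)(id\otimes C_{H^*,H}\otimes id)(\Delta_{H^{\hat *}}\otimes id\otimes id)$. A left $H$-module algebra $(R,\alpha)$ is an algebra $R$ with a left $H$-module structure $\alpha:H\otimes R\to R$ such that $\alpha(id\otimes m_R)=m_R(\alpha\otimes\alpha)(id\otimes C_{H,R}\otimes id)(\Delta\otimes id\otimes id)$ and $\alpha(id\otimes\eta_R)=\eta_R\epsilon$. The smash product $R\#H$ is $R\otimes H$ with unit $\eta_R\otimes\eta_H$ and multiplication $(m_R\otimes m_H)(id_R\otimes\alpha\otimes id_H\otimes id_H)(id_R\otimes id_H\otimes C_{H,R}\otimes id_H)(id_R\otimes\Delta\otimes id_R\otimes id_H)$. $H$ is a left $H^{\hat *}$-module algebra under $\rightharpoonup\,=(id_H\otimes d)(C_{H^{\hat *},H}\otimes id_H)(id\otimes\Delta):H^{\hat *}\otimes H\to H$. $R\#H$ is a left $H^{\hat *}$-module algebra under $\rightharpoonup'\,=(id_R\otimes\rightharpoonup)(C_{H^{\hat *},R}\otimes id_H)$, and $(R\#H)\#H^{\hat *}$ is the smash product for this action. $H\,\bar\otimes\,H^{\hat *}$ is the object $H\otimes H^{\hat *}$ with multiplication $id_H\otimes d\otimes id_{H^{\hat *}}$ and unit $b$. $R\otimes(H\,\bar\otimes\,H^{\hat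 *})$ is the tensor product algebra in $\mathcal C$, with multiplication $(m_R\otimes m_{H\bar\otimes H^{\hat *}})(id_R\otimes C_{H\otimes H^{\hat *},R}\otimes id)$. *)

theory Defs
  imports Main
begin

section \<open>Strict braided tensor categories\<close>

text \<open>
  Objects and arrows are carved out of two types by carrier sets; every arrow carries its own
  domain and codomain, and composition \<open>g \<cdot> f\<close> is read from right to left. The operations
  on arrows are only constrained where the arrows are composable elements of the carrier.
\<close>

record ('o, 'm) braided_category =
  Obj :: "'o set"
  Arr :: "'m set"
  Dom :: "'m \<Rightarrow> 'o"
  Cod :: "'m \<Rightarrow> 'o"
  Ident :: "'o \<Rightarrow> 'm"  (\<open>\<one>\<index> _\<close> [1000] 999)
  Comp :: "'m \<Rightarrow> 'm \<Rightarrow> 'm"  (infixl \<open>\<cdot>\<index>\<close> 55)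
  Tensor_obj :: "'o \<Rightarrow> 'o \<Rightarrow> 'o"  (infixr \<open>\<odot>\<index>\<close> 70)
  Tensor_arr :: "'m \<Rightarrow> 'm \<Rightarrow> 'm"  (infixr \<open>\<otimes>\<index>\<close> 70)
  Unit_obj :: "'o"  (\<open>\<I>\<index>\<close>)
  Braid :: "'o \<Rightarrow> 'o \<Rightarrow> 'm"  (\<open>\<beta>\<index> _ _\<close> [1000, 1000] 999)

definition in_hom :: "('o, 'm) braided_category \<Rightarrow> 'm \<Rightarrow> 'o \<Rightarrow> 'o \<Rightarrow> bool"
    (\<open>\<guillemotleft>_ : _ \<rightarrow> _\<guillemotright>\<index>\<close>)
  where "\<guillemotleft>f : X \<rightarrow> Y\<guillemotright>\<^bsub>\<C>\<^esub> \<longleftrightarrow> f \<in> Arr \<C> \<and> Dom \<C> f = X \<and> Cod \<C> f = Y"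

locale category =
  fixes \<C> :: "('o, 'm) braided_category" (structure)
  assumes Dom_Obj: "f \<in> Arr \<C> \<Longrightarrow> Dom \<C> f \<in> Obj \<C>"
    and Cod_Obj: "f \<in> Arr \<C> \<Longrightarrow> Cod \<C> f \<in> Obj \<C>"
    and Ident_hom: "X \<in> Obj \<C> \<Longrightarrow> \<guillemotleft>\<one> X : X \<rightarrow> X\<guillemotright>"
    and Comp_hom: "\<lbrakk> \<guillemotleft>f : X \<rightarrow> Y\<guillemotright>; \<guillemotleft>g : Y \<rightarrow> Z\<guillemotright> \<rbrakk> \<Longrightarrow> \<guillemotleft>g \<cdot> f : X \<rightarrow> Z\<guillemotright>"
    and Comp_assoc: "\<lbrakk> \<guillemotleft>f : X \<rightarrow> Y\<guillemotright>; \<guillemotleft>g : Y \<rightarrow> Z\<guillemotright>; \<guillemotleft>h : Z \<rightarrow> W\<guillemotright> \<rbrakk> \<Longrightarrow> (h \<cdot> g) \<cdot> f = h \<cdot> (g \<cdot> f)"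
    and Comp_Ident_left: "\<guillemotleft>f : X \<rightarrow> Y\<guillemotright> \<Longrightarrow> \<one> Y \<cdot> f = f"
    and Comp_Ident_right: "\<guillemotleft>f : X \<rightarrow> Y\<guillemotright> \<Longrightarrow> f \<cdot> \<one> X = f"

locale strict_tensor_category = category +
  assumes Tensor_Obj: "\<lbrakk> X \<in> Obj \<C>; Y \<in> Obj \<C> \<rbrakk> \<Longrightarrow> X \<odot> Y \<in> Obj \<C>"
    and Unit_Obj: "\<I> \<in> Obj \<C>"
    and Tensor_hom:
      "\<lbrakk> \<guillemotleft>f : X \<rightarrow> Y\<guillemotright>; \<guillemotleft>g : X' \<rightarrow> Y'\<guillemotright> \<rbrakk> \<Longrightarrow> \<guillemotleft>f \<otimes> g : X \<odot> X' \<rightarrow> Y \<odot> Y'\<guillemotright>"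
    and Tensor_Ident: "\<lbrakk> X \<in> Obj \<C>; Y \<in> Obj \<C> \<rbrakk> \<Longrightarrow> \<one> X \<otimes> \<one> Y = \<one> (X \<odot> Y)"
    and Tensor_Comp:
      "\<lbrakk> \<guillemotleft>f : X \<rightarrow> Y\<guillemotright>; \<guillemotleft>g : Y \<rightarrow> Z\<guillemotright>; \<guillemotleft>f' : X' \<rightarrow> Y'\<guillemotright>; \<guillemotleft>g' : Y' \<rightarrow> Z'\<guillemotright> \<rbrakk>
        \<Longrightarrow> (g \<otimes> g') \<cdot> (f \<otimes> f') = (g \<cdot> f) \<otimes> (g' \<cdot> f')"
    and Tensor_obj_assoc:
      "\<lbrakk> X \<in> Obj \<C>; Y \<in> Obj \<C>; Z \<in> Obj \<C> \<rbrakk> \<Longrightarrow> (X \<odot> Y) \<odot> Z = X \<odot> (Y \<odot> Z)"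
    and Tensor_obj_unit_left: "X \<in> Obj \<C> \<Longrightarrow> \<I> \<odot> X = X"
    and Tensor_obj_unit_right: "X \<in> Obj \<C> \<Longrightarrow> X \<odot> \<I> = X"
    and Tensor_arr_assoc:
      "\<lbrakk> f \<in> Arr \<C>; g \<in> Arr \<C>; h \<in> Arr \<C> \<rbrakk> \<Longrightarrow> (f \<otimes> g) \<otimes> h = f \<otimes> (g \<otimes> h)"
    and Tensor_arr_unit_left: "f \<in> Arr \<C> \<Longrightarrow> \<one> \<I> \<otimes> f = f"
    and Tensor_arr_unit_right: "f \<in> Arr \<C> \<Longrightarrow> f \<otimes> \<one> \<I> = f"

text \<open>\<open>inverse_arrows \<C> f g\<close> says that \<open>f\<close> is invertible with inverse \<open>g\<close>.\<close>

definition inverse_arrows :: "('o, 'm) braided_category \<Rightarrow> 'm \<Rightarrow> 'm \<Rightarrow> bool"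
  where "inverse_arrows \<C> f g \<longleftrightarrow>
    f \<in> Arr \<C> \<and> \<guillemotleft>g : Cod \<C> f \<rightarrow> Dom \<C> f\<guillemotright>\<^bsub>\<C>\<^esub> \<and>
    g \<cdot>\<^bsub>\<C>\<^esub> f = \<one>\<^bsub>\<C>\<^esub> (Dom \<C> f) \<and> f \<cdot>\<^bsub>\<C>\<^esub> g = \<one>\<^bsub>\<C>\<^esub> (Cod \<C> f)"

locale strict_braided_tensor_category = strict_tensor_category +
  assumes Braid_hom: "\<lbrakk> X \<in> Obj \<C>; Y \<in> Obj \<C> \<rbrakk> \<Longrightarrow> \<guillemotleft>\<beta> X Y : X \<odot> Y \<rightarrow> Y \<odot> X\<guillemotright>"
    and Braid_iso: "\<lbrakk> X \<in> Obj \<C>; Y \<in> Obj \<C> \<rbrakk> \<Longrightarrow> \<exists>g. inverse_arrows \<C> (\<beta> X Y) g"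
    and Braid_natural:
      "\<lbrakk> \<guillemotleft>f : X \<rightarrow> Y\<guillemotright>; \<guillemotleft>g : X' \<rightarrow> Y'\<guillemotright> \<rbrakk> \<Longrightarrow> (g \<otimes> f) \<cdot> \<beta> X X' = \<beta> Y Y' \<cdot> (f \<otimes> g)"
    and Braid_tensor_left:
      "\<lbrakk> X \<in> Obj \<C>; Y \<in> Obj \<C>; Z \<in> Obj \<C> \<rbrakk>
        \<Longrightarrow> \<beta> (X \<odot> Y) Z = (\<beta> X Z \<otimes> \<one> Y) \<cdot> (\<one> X \<otimes> \<beta> Y Z)"
    and Braid_tensor_right:
      "\<lbrakk> X \<in> Obj \<C>; Y \<in> Obj \<C>; Z \<in> Obj \<C> \<rbrakk>
        \<Longrightarrow> \<beta> X (Y \<odot> Z) = (\<one> Y \<otimes> \<beta> X Z) \<cdot> (\<beta> X Y \<otimes> \<one> Z)"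


section \<open>Algebras and Hopf algebras in a braided category\<close>

record ('o, 'm) algebra_data =
  obj :: 'o
  mult :: 'm
  eta :: 'm

record ('o, 'm) hopf_data = "('o, 'm) algebra_data" +
  comult :: 'm
  counit :: 'm
  antipode :: 'm

text \<open>A left dual of an object: the dual object with its evaluation and coevaluation.\<close>

record ('o, 'm) dual_data =
  dual :: 'o
  ev :: 'm
  coev :: 'm

context
  fixes \<C> :: "('o, 'm) braided_category" (structure)
begin

definition algebra :: "('o, 'm, 'r) algebra_data_scheme \<Rightarrow> bool"
  where "algebra A \<longleftrightarrow>
    obj A \<in> Obj \<C> \<and>
    \<guillemotleft>mult A : obj A \<odot> obj A \<rightarrow> obj A\<guillemotright> \<and>
    \<guillemotleft>eta A : \<I> \<rightarrow> obj A\<guillemotright> \<and>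
    mult A \<cdot> (mult A \<otimes> \<one> (obj A)) = mult A \<cdot> (\<one> (obj A) \<otimes> mult A) \<and>
    mult A \<cdot> (eta A \<otimes> \<one> (obj A)) = \<one> (obj A) \<and>
    mult A \<cdot> (\<one> (obj A) \<otimes> eta A) = \<one> (obj A)"

definition coalgebra :: "('o, 'm, 'r) hopf_data_scheme \<Rightarrow> bool"
  where "coalgebra A \<longleftrightarrow>
    obj A \<in> Obj \<C> \<and>
    \<guillemotleft>comult A : obj A \<rightarrow> obj A \<odot> obj A\<guillemotright> \<and>
    \<guillemotleft>counit A : obj A \<rightarrow> \<I>\<guillemotright> \<and>
    (comult A \<otimes> \<one> (obj A)) \<cdot> comult A = (\<one> (obj A) \<otimes> comult A) \<cdot> comult A \<and>
    (counit A \<otimes> \<one> (obj A)) \<cdot> comult A = \<one> (obj A) \<and>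
    (\<one> (obj A) \<otimes> counit A) \<cdot> comult A = \<one> (obj A)"

definition algebra_hom ::
    "'m \<Rightarrow> ('o, 'm, 'r) algebra_data_scheme \<Rightarrow> ('o, 'm, 's) algebra_data_scheme \<Rightarrow> bool"
  where "algebra_hom f A B \<longleftrightarrow>
    \<guillemotleft>f : obj A \<rightarrow> obj B\<guillemotright> \<and>
    f \<cdot> mult A = mult B \<cdot> (f \<otimes> f) \<and>
    f \<cdot> eta A = eta B"

definition isomorphic_algebras ::
    "('o, 'm, 'r) algebra_data_scheme \<Rightarrow> ('o, 'm, 's) algebra_data_scheme \<Rightarrow> bool"
  where "isomorphic_algebras A B \<longleftrightarrow>
    algebra A \<and> algebra B \<and>
    (\<exists>f g. inverse_arrows \<C> f g \<and> algebra_hom f A B \<and> algebra_hom g B A)"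

definition unit_algebra :: "('o, 'm) algebra_data"
  where "unit_algebra = \<lparr>obj = \<I>, mult = \<one> \<I>, eta = \<one> \<I>\<rparr>"

definition tensor_algebra ::
    "('o, 'm, 'r) algebra_data_scheme \<Rightarrow> ('o, 'm, 's) algebra_data_scheme \<Rightarrow> ('o, 'm) algebra_data"
  where "tensor_algebra A B =
    \<lparr>obj = obj A \<odot> obj B,
     mult = (mult A \<otimes> mult B) \<cdot> (\<one> (obj A) \<otimes> \<beta> (obj B) (obj A) \<otimes> \<one> (obj B)),
     eta = eta A \<otimes> eta B\<rparr>"

definition bialgebra :: "('o, 'm, 'r) hopf_data_scheme \<Rightarrow> bool"
  where "bialgebra H \<longleftrightarrow>
    algebra H \<and> coalgebra H \<and>
    algebra_hom (comult H) H (tensor_algebra H H) \<and>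
    algebra_hom (counit H) H unit_algebra"

definition hopf_algebra :: "('o, 'm, 'r) hopf_data_scheme \<Rightarrow> bool"
  where "hopf_algebra H \<longleftrightarrow>
    bialgebra H \<and>
    \<guillemotleft>antipode H : obj H \<rightarrow> obj H\<guillemotright> \<and>
    mult H \<cdot> (antipode H \<otimes> \<one> (obj H)) \<cdot> comult H = eta H \<cdot> counit H \<and>
    mult H \<cdot> (\<one> (obj H) \<otimes> antipode H) \<cdot> comult H = eta H \<cdot> counit H"


section \<open>Duals\<close>

definition left_dual :: "'o \<Rightarrow> ('o, 'm) dual_data \<Rightarrow> bool"
  where "left_dual V D \<longleftrightarrow>
    V \<in> Obj \<C> \<and> dual D \<in> Obj \<C> \<and>
    \<guillemotleft>ev D : dual D \<odot> V \<rightarrow> \<I>\<guillemotright> \<and>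
    \<guillemotleft>coev D : \<I> \<rightarrow> V \<odot> dual D\<guillemotright> \<and>
    (ev D \<otimes> \<one> (dual D)) \<cdot> (\<one> (dual D) \<otimes> coev D) = \<one> (dual D) \<and>
    (\<one> V \<otimes> ev D) \<cdot> (coev D \<otimes> \<one> V) = \<one> V"

text \<open>The transpose of \<open>f : U \<rightarrow> V\<close> with respect to left duals \<open>DU\<close> of \<open>U\<close> and \<open>DV\<close> of \<open>V\<close>.\<close>

definition transpose :: "('o, 'm) dual_data \<Rightarrow> ('o, 'm) dual_data \<Rightarrow> 'm \<Rightarrow> 'm"
  where "transpose DU DV f =
    (ev DV \<otimes> \<one> (dual DU)) \<cdot> (\<one> (dual DV) \<otimes> f \<otimes> \<one> (dual DU)) \<cdot> (\<one> (dual DV) \<otimes> coev DU)"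

definition unit_dual :: "('o, 'm) dual_data"
  where "unit_dual = \<lparr>dual = \<I>, ev = \<one> \<I>, coev = \<one> \<I>\<rparr>"

text \<open>The left dual of \<open>U \<odot> V\<close> is \<open>V\<^sup>* \<odot> U\<^sup>*\<close>, so evaluation and coevaluation are nested.\<close>

definition tensor_dual ::
    "'o \<Rightarrow> ('o, 'm) dual_data \<Rightarrow> 'o \<Rightarrow> ('o, 'm) dual_data \<Rightarrow> ('o, 'm) dual_data"
  where "tensor_dual U DU V DV =
    \<lparr>dual = dual DV \<odot> dual DU,
     ev = ev DV \<cdot> (\<one> (dual DV) \<otimes> ev DU \<otimes> \<one> V),
     coev = (\<one> U \<otimes> coev DV \<otimes> \<one> (dual DU)) \<cdot> coev DU\<rparr>"

definition dual_hopf :: "('o, 'm) hopf_data \<Rightarrow> ('o, 'm) dual_data \<Rightarrow> ('o, 'm) hopf_data"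
  where "dual_hopf H D =
    (let D2 = tensor_dual (obj H) D (obj H) D in
    \<lparr>obj = dual D,
     mult = transpose D D2 (comult H),
     eta = transpose D unit_dual (counit H),
     comult = transpose D2 D (mult H),
     counit = transpose unit_dual D (eta H),
     antipode = transpose D D (antipode H)\<rparr>)"

text \<open>
  \<open>op_hopf\<close> and \<open>cop_hopf\<close> leave the antipode field alone. The antipode of \<open>H\<^sup>o\<^sup>p\<close> alone would
  be the inverse of the one of \<open>H\<close>; only the composite of both operations is used below, and
  there the antipode is the original one.
\<close>

definition op_hopf :: "('o, 'm) hopf_data \<Rightarrow> ('o, 'm) hopf_data"
  where "op_hopf H = H\<lparr>mult := mult H \<cdot> \<beta> (obj H) (obj H)\<rparr>"

definition cop_hopf :: "('o, 'm) hopf_data \<Rightarrow> ('o, 'm) hopf_data"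
  where "cop_hopf H = H\<lparr>comult := \<beta> (obj H) (obj H) \<cdot> comult H\<rparr>"

definition hat_dual :: "('o, 'm) hopf_data \<Rightarrow> ('o, 'm) dual_data \<Rightarrow> ('o, 'm) hopf_data"
  where "hat_dual H D = cop_hopf (op_hopf (dual_hopf H D))"


section \<open>Module algebras and smash products\<close>

definition left_module :: "('o, 'm, 'r) algebra_data_scheme \<Rightarrow> 'o \<Rightarrow> 'm \<Rightarrow> bool"
  where "left_module H M \<alpha> \<longleftrightarrow>
    M \<in> Obj \<C> \<and>
    \<guillemotleft>\<alpha> : obj H \<odot> M \<rightarrow> M\<guillemotright> \<and>
    \<alpha> \<cdot> (mult H \<otimes> \<one> M) = \<alpha> \<cdot> (\<one> (obj H) \<otimes> \<alpha>) \<and>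
    \<alpha> \<cdot> (eta H \<otimes> \<one> M) = \<one> M"

definition module_algebra ::
    "('o, 'm, 'r) hopf_data_scheme \<Rightarrow> ('o, 'm, 's) algebra_data_scheme \<Rightarrow> 'm \<Rightarrow> bool"
  where "module_algebra H R \<alpha> \<longleftrightarrow>
    algebra R \<and> left_module H (obj R) \<alpha> \<and>
    \<alpha> \<cdot> (\<one> (obj H) \<otimes> mult R) =
      mult R \<cdot> (\<alpha> \<otimes> \<alpha>) \<cdot> (\<one> (obj H) \<otimes> \<beta> (obj H) (obj R) \<otimes> \<one> (obj R))
        \<cdot> (comult H \<otimes> \<one> (obj R) \<otimes> \<one> (obj R)) \<and>
    \<alpha> \<cdot> (\<one> (obj H) \<otimes> eta R) = eta R \<cdot> counit H"

definition smash ::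
    "('o, 'm, 'r) algebra_data_scheme \<Rightarrow> ('o, 'm, 's) hopf_data_scheme \<Rightarrow> 'm \<Rightarrow> ('o, 'm) algebra_data"
  where "smash R H \<alpha> =
    \<lparr>obj = obj R \<odot> obj H,
     mult = (mult R \<otimes> mult H)
       \<cdot> (\<one> (obj R) \<otimes> \<alpha> \<otimes> \<one> (obj H) \<otimes> \<one> (obj H))
       \<cdot> (\<one> (obj R) \<otimes> \<one> (obj H) \<otimes> \<beta> (obj H) (obj R) \<otimes> \<one> (obj H))
       \<cdot> (\<one> (obj R) \<otimes> comult H \<otimes> \<one> (obj R) \<otimes> \<one> (obj H)),
     eta = eta R \<otimes> eta H\<rparr>"

text \<open>The actions of the dual on \<open>H\<close> and on the smash product of \<open>R\<close> with \<open>H\<close>.\<close>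

definition dual_action :: "('o, 'm) hopf_data \<Rightarrow> ('o, 'm) dual_data \<Rightarrow> 'm"
  where "dual_action H D =
    (\<one> (obj H) \<otimes> ev D) \<cdot> (\<beta> (dual D) (obj H) \<otimes> \<one> (obj H)) \<cdot> (\<one> (dual D) \<otimes> comult H)"

definition dual_action_smash ::
    "('o, 'm) algebra_data \<Rightarrow> ('o, 'm) hopf_data \<Rightarrow> ('o, 'm) dual_data \<Rightarrow> 'm"
  where "dual_action_smash R H D =
    (\<one> (obj R) \<otimes> dual_action H D) \<cdot> (\<beta> (dual D) (obj R) \<otimes> \<one> (obj H))"

text \<open>The algebra \<open>V \<otimes> V\<^sup>*\<close> whose multiplication contracts the two inner factors.\<close>

definition contraction_algebra :: "'o \<Rightarrow> ('o, 'm) dual_data \<Rightarrow> ('o, 'm) algebra_data"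
  where "contraction_algebra V D =
    \<lparr>obj = V \<odot> dual D, mult = \<one> V \<otimes> ev D \<otimes> \<one> (dual D), eta = coev D\<rparr>"

end

end

theory Submission
  imports Defs
begin

text \<open>
  Classically, \<open>(R # H) # H\<^sup>*\<close> acts on \<open>R # H\<close>: the subalgebra \<open>R # H\<close> by left multiplication
  and \<open>H\<^sup>*\<close> by \<open>\<phi> \<rightharpoonup> (r # h) = \<Sum> r # h\<^sub>1 \<phi>(h\<^sub>2)\<close>. This action commutes with right multiplication
  by \<open>R\<close>, and \<open>R # H\<close> is the free right \<open>R\<close>-module on \<open>H\<close>: the map \<open>H \<otimes> R \<rightarrow> R # H\<close>,
  \<open>x \<otimes> s \<mapsto> x s = \<Sum> (x\<^sub>1 \<cdot> s) # x\<^sub>2\<close>, is invertible because the antipode is. So the action is an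
  algebra map from \<open>(R # H) # H\<^sup>*\<close> to the endomorphisms of \<open>H \<otimes> R\<close> as a right \<open>R\<close>-module, that
  is, to \<open>H \<otimes> R \<otimes> H\<^sup>*\<close> with the product that contracts \<open>H\<^sup>*\<close> with \<open>H\<close> and multiplies in \<open>R\<close>. It
  is bijective because for \<open>R = I\<close> it is the representation of the Heisenberg double \<open>H # H\<^sup>*\<close>
  on \<open>H\<close>, \<open>(h # \<phi>) x = \<Sum> h x\<^sub>1 \<phi>(x\<^sub>2)\<close>, which identifies \<open>H # H\<^sup>*\<close> with \<open>H \<otimes> H\<^sup>*\<close>; its inverse
  again uses the inverse of the antipode. Finally the braiding of \<open>H\<close> with \<open>R\<close> turns
  \<open>H \<otimes> R \<otimes> H\<^sup>*\<close> into \<open>R \<otimes> (H \<otimes> H\<^sup>*)\<close>. The whole construction survives in a braided category,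
  since \<open>R\<close> is only ever crossed by \<open>H\<close> and \<open>H\<^sup>*\<close> in one direction, or back by the inverse
  braiding (\<open>duality_iso_hom\<close>, \<open>duality_iso_inverse\<close>, \<open>braid_hom\<close>). Associativity of
  \<open>(R # H) # H\<^sup>*\<close> is transported from \<open>H \<otimes> R \<otimes> H\<^sup>*\<close>, where it is evident.

  Bijectivity of the antipode \<open>S\<close> is the deepest ingredient. With dual bases \<open>e\<^sub>i\<close>, \<open>e\<^sup>i\<close>, the
  map \<open>K x = \<Sum> e\<^sup>i(z\<^sub>1) z\<^sub>2\<close>, \<open>z = x S\<^sup>2(e\<^sub>i)\<close>, is the projection of the fundamental theorem of
  Hopf modules onto the integrals: its values are right integrals, it is itself an integral as a
  functional, it is idempotent, and \<open>K S\<close> has trace one. In a general category there is no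
  integral to pick out, but \<open>Q = K S K\<close> has the same invariance and trace one, and
  \<open>T y = \<Sum> e\<^sup>i(Q(e\<^sub>i)\<^sub>2 y) Q(e\<^sub>i)\<^sub>1\<close> is an inverse of \<open>S\<close> (\<open>Inv_left\<close>, \<open>Ant_Inv\<close>, \<open>Inv_Ant\<close>).

  If the braiding of \<open>H\<close> with itself is an involution, then so are all braidings among \<open>H\<close> and
  \<open>H\<^sup>*\<close> (\<open>Braid_dual_symmetric\<close>), so identities between maps built from these two objects are
  identities of string diagrams in a symmetric category. They are proved in a calculus of named
  wires: a diagram is a list of nodes, each consuming and producing wires, as in Sweedler
  notation, and the crossings are filled in canonically. The coherence of the symmetric group
  action makes the value independent of the order of the nodes (\<open>sem_same_nodes\<close>), so that a
  diagram may be rewritten wherever one side of a known identity occurs in it (\<open>rewrite\<close>).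
  Identities that involve \<open>R\<close> reduce to such diagrams by \<open>cross_via_comp\<close>, which composes any
  two maps that move \<open>R\<close> past a word of \<open>H\<close> and \<open>H\<^sup>*\<close> while acting on it.
\<close>

section \<open>Typing and interchange\<close>

context category
begin

lemma hom_self: "f \<in> Arr \<C> \<Longrightarrow> \<guillemotleft>f : Dom \<C> f \<rightarrow> Cod \<C> f\<guillemotright>"
  by (simp add: in_hom_def)

lemma Ident_typing:
  "X \<in> Obj \<C> \<Longrightarrow> \<one> X \<in> Arr \<C>"
  "X \<in> Obj \<C> \<Longrightarrow> Dom \<C> (\<one> X) = X"
  "X \<in> Obj \<C> \<Longrightarrow> Cod \<C> (\<one> X) = X"
  using Ident_hom by (auto simp: in_hom_def)

lemma Comp_typing:
  assumes "f \<in> Arr \<C>" "g \<in> Arr \<C>" "Dom \<C> g = Cod \<C> f"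
  shows "g \<cdot> f \<in> Arr \<C>" "Dom \<C> (g \<cdot> f) = Dom \<C> f" "Cod \<C> (g \<cdot> f) = Cod \<C> g"
  using Comp_hom[of f "Dom \<C> f" "Cod \<C> f" g "Cod \<C> g"] assms by (auto simp: in_hom_def)

lemma Comp_assoc':
  assumes "f \<in> Arr \<C>" "g \<in> Arr \<C>" "h \<in> Arr \<C>" "Dom \<C> g = Cod \<C> f" "Dom \<C> h = Cod \<C> g"
  shows "(h \<cdot> g) \<cdot> f = h \<cdot> (g \<cdot> f)"
  using Comp_assoc[of f "Dom \<C> f" "Cod \<C> f" g "Cod \<C> g" h "Cod \<C> h"] assms
  by (auto simp: in_hom_def)

lemma Comp_Ident_left': "f \<in> Arr \<C> \<Longrightarrow> Cod \<C> f = X \<Longrightarrow> \<one> X \<cdot> f = f"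
  using Comp_Ident_left[of f "Dom \<C> f" X] by (auto simp: in_hom_def)

lemma Comp_Ident_right': "f \<in> Arr \<C> \<Longrightarrow> Dom \<C> f = X \<Longrightarrow> f \<cdot> \<one> X = f"
  using Comp_Ident_right[of f X "Cod \<C> f"] by (auto simp: in_hom_def)

end

context strict_tensor_category
begin

lemma Tensor_typing:
  assumes "f \<in> Arr \<C>" "g \<in> Arr \<C>"
  shows "f \<otimes> g \<in> Arr \<C>" "Dom \<C> (f \<otimes> g) = Dom \<C> f \<odot> Dom \<C> g"
    "Cod \<C> (f \<otimes> g) = Cod \<C> f \<odot> Cod \<C> g"
  using Tensor_hom[OF hom_self[OF assms(1)] hom_self[OF assms(2)]] by (auto simp: in_hom_def)

lemma interchange:
  assumes "f \<in> Arr \<C>" "g \<in> Arr \<C>" "f' \<in> Arr \<C>" "g' \<in> Arr \<C>"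
    and "Dom \<C> g = Cod \<C> f" "Dom \<C> g' = Cod \<C> f'"
  shows "(g \<otimes> g') \<cdot> (f \<otimes> f') = (g \<cdot> f) \<otimes> (g' \<cdot> f')"
  using Tensor_Comp[of f "Dom \<C> f" "Cod \<C> f" g "Cod \<C> g" f' "Dom \<C> f'" "Cod \<C> f'" g' "Cod \<C> g'"]
    assms by (auto simp: in_hom_def)

lemma interchange_left:
  assumes "f \<in> Arr \<C>" "g \<in> Arr \<C>" "f' \<in> Arr \<C>" "g' \<in> Arr \<C>" "k \<in> Arr \<C>"
    and "Dom \<C> g = Cod \<C> f" "Dom \<C> g' = Cod \<C> f'" "Cod \<C> k = Dom \<C> f \<odot> Dom \<C> f'"
  shows "(g \<otimes> g') \<cdot> ((f \<otimes> f') \<cdot> k) = ((g \<cdot> f) \<otimes> (g' \<cdot> f')) \<cdot> k"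
proof -
  have "(g \<otimes> g') \<cdot> ((f \<otimes> f') \<cdot> k) = ((g \<otimes> g') \<cdot> (f \<otimes> f')) \<cdot> k"
    using assms by (simp add: Comp_assoc' Tensor_typing)
  then show ?thesis using assms by (simp add: interchange)
qed

lemmas typing = Ident_typing Comp_typing Tensor_typing Unit_Obj Tensor_Obj Dom_Obj Cod_Obj
  Tensor_obj_assoc Tensor_obj_unit_left Tensor_obj_unit_right

text \<open>
  Together with these rules, \<open>split\<close> and \<open>merge\<close> bring every composite into the form of a
  right-bracketed sequence of single arrows tensored with identities.
\<close>

lemmas normal = typing Comp_assoc' Comp_Ident_left' Comp_Ident_right' Tensor_arr_assoc
  Tensor_arr_unit_left Tensor_arr_unit_right

lemma split_right:
  "f \<in> Arr \<C> \<Longrightarrow> g \<in> Arr \<C> \<Longrightarrow> Dom \<C> g = Cod \<C> f \<Longrightarrow> X \<in> Obj \<C> \<Longrightarrow>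
    (g \<cdot> f) \<otimes> \<one> X = (g \<otimes> \<one> X) \<cdot> (f \<otimes> \<one> X)"
  by (simp add: normal interchange)

lemma split_left:
  "f \<in> Arr \<C> \<Longrightarrow> g \<in> Arr \<C> \<Longrightarrow> Dom \<C> g = Cod \<C> f \<Longrightarrow> X \<in> Obj \<C> \<Longrightarrow>
    \<one> X \<otimes> (g \<cdot> f) = (\<one> X \<otimes> g) \<cdot> (\<one> X \<otimes> f)"
  by (simp add: normal interchange)

lemmas split = split_right split_left

lemma Ident_merge:
  "X \<in> Obj \<C> \<Longrightarrow> Y \<in> Obj \<C> \<Longrightarrow> f \<in> Arr \<C> \<Longrightarrow> \<one> X \<otimes> (\<one> Y \<otimes> f) = \<one> (X \<odot> Y) \<otimes> f"
  by (simp add: typing flip: Tensor_arr_assoc Tensor_Ident)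

lemmas merge = Tensor_Ident Ident_merge

text \<open>
  The interchange law in the form in which it moves one arrow past a parallel one.
\<close>

lemma exchange:
  assumes "f \<in> Arr \<C>" "g \<in> Arr \<C>" "Dom \<C> f = X" "Cod \<C> f = Y" "Dom \<C> g = X'" "Cod \<C> g = Y'"
  shows "(f \<otimes> \<one> Y') \<cdot> (\<one> X \<otimes> g) = (\<one> Y \<otimes> g) \<cdot> (f \<otimes> \<one> X')"
  using assms by (auto simp: normal interchange)

text \<open>
  Composites are kept bracketed to the right, so an identity for a composite of two arrows has
  to be usable in front of a further arrow.
\<close>

lemma tail:
  assumes "g \<cdot> f = k" "f \<in> Arr \<C>" "g \<in> Arr \<C>" "Dom \<C> g = Cod \<C> f" "l \<in> Arr \<C>" "Cod \<C> l = Dom \<C> f"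
  shows "g \<cdot> (f \<cdot> l) = k \<cdot> l"
  using assms by (auto simp flip: Comp_assoc')

lemma tail3:
  assumes "h \<cdot> (g \<cdot> f) = k" "f \<in> Arr \<C>" "g \<in> Arr \<C>" "h \<in> Arr \<C>" "Dom \<C> g = Cod \<C> f"
      "Dom \<C> h = Cod \<C> g"
    "l \<in> Arr \<C>" "Cod \<C> l = Dom \<C> f"
  shows "h \<cdot> (g \<cdot> (f \<cdot> l)) = k \<cdot> l"
  using assms by (auto simp: Comp_typing simp flip: Comp_assoc')

end

section \<open>Transport of algebra structures\<close>

context strict_tensor_category
begin

lemma algebra_hom_inverse:
  assumes inv: "inverse_arrows \<C> f g" and f: "algebra_hom \<C> f X Y"
    and O: "obj X \<in> Obj \<C>" "obj Y \<in> Obj \<C>"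
    and m: "\<guillemotleft>mult X : obj X \<odot> obj X \<rightarrow> obj X\<guillemotright>" "\<guillemotleft>eta X : \<I> \<rightarrow> obj X\<guillemotright>"
      "\<guillemotleft>mult Y : obj Y \<odot> obj Y \<rightarrow> obj Y\<guillemotright>" "\<guillemotleft>eta Y : \<I> \<rightarrow> obj Y\<guillemotright>"
  shows "algebra_hom \<C> g Y X"
proof -
  have F: "f \<in> Arr \<C>" "Dom \<C> f = obj X" "Cod \<C> f = obj Y" "g \<in> Arr \<C>" "Dom \<C> g = obj Y"
      "Cod \<C> g = obj X"
    "g \<cdot> f = \<one> (obj X)" "f \<cdot> g = \<one> (obj Y)" "f \<cdot> mult X = mult Y \<cdot> (f \<otimes> f)" "f \<cdot> eta X = eta Y"
    using inv f by (auto simp: inverse_arrows_def algebra_hom_def in_hom_def)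
  note M = m[unfolded in_hom_def]
  have "mult Y = mult Y \<cdot> ((f \<otimes> f) \<cdot> (g \<otimes> g))"
    using F M O by (simp add: normal interchange Tensor_Ident)
  also have "\<dots> = f \<cdot> (mult X \<cdot> (g \<otimes> g))"
    using F M O F(9)[symmetric] by (simp add: normal flip: Comp_assoc')
  finally have "g \<cdot> mult Y = (g \<cdot> f) \<cdot> (mult X \<cdot> (g \<otimes> g))"
    using F(1-6) M O by (simp add: normal)
  then have 1: "g \<cdot> mult Y = mult X \<cdot> (g \<otimes> g)"
    unfolding F(7) using F(1-6) M O by (simp add: normal)
  have "g \<cdot> eta Y = (g \<cdot> f) \<cdot> eta X"
    using F(1-6) M O F(10)[symmetric] by (simp add: normal)
  then have 2: "g \<cdot> eta Y = eta X" unfolding F(7) using M O by (simp add: normal)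
  show ?thesis using 1 2 F by (simp add: algebra_hom_def in_hom_def)
qed

text \<open>
  All algebra laws are equations between arrows into the object, so they can be checked after
  composing with an invertible arrow that preserves product and unit.
\<close>

lemma algebra_transport:
  assumes inv: "inverse_arrows \<C> f g" and f: "algebra_hom \<C> f X Y" and Y: "algebra \<C> Y"
    and O: "obj X \<in> Obj \<C>"
    and m: "\<guillemotleft>mult X : obj X \<odot> obj X \<rightarrow> obj X\<guillemotright>" "\<guillemotleft>eta X : \<I> \<rightarrow> obj X\<guillemotright>"
  shows "algebra \<C> X"
proof -
  have F: "f \<in> Arr \<C>" "Dom \<C> f = obj X" "Cod \<C> f = obj Y" "g \<in> Arr \<C>" "Dom \<C> g = obj Y"
      "Cod \<C> g = obj X"
    "g \<cdot> f = \<one> (obj X)" "f \<cdot> mult X = mult Y \<cdot> (f \<otimes> f)" "f \<cdot> eta X = eta Y"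
    using inv f by (auto simp: inverse_arrows_def algebra_hom_def in_hom_def)
  have A: "obj Y \<in> Obj \<C>" "mult Y \<in> Arr \<C>" "Dom \<C> (mult Y) = obj Y \<odot> obj Y" "Cod \<C> (mult Y) = obj Y"
    "eta Y \<in> Arr \<C>" "Dom \<C> (eta Y) = \<I>" "Cod \<C> (eta Y) = obj Y"
    "mult Y \<cdot> (mult Y \<otimes> \<one> (obj Y)) = mult Y \<cdot> (\<one> (obj Y) \<otimes> mult Y)"
    "mult Y \<cdot> (eta Y \<otimes> \<one> (obj Y)) = \<one> (obj Y)" "mult Y \<cdot> (\<one> (obj Y) \<otimes> eta Y) = \<one> (obj Y)"
    using Y by (auto simp: algebra_def in_hom_def)
  note M = m[unfolded in_hom_def]
  have cancel: "x = y" if "f \<cdot> x = f \<cdot> y" "x \<in> Arr \<C>" "y \<in> Arr \<C>" "Cod \<C> x = obj X"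
      "Cod \<C> y = obj X" for x y
  proof -
    have "(g \<cdot> f) \<cdot> x = (g \<cdot> f) \<cdot> y" using that F(1-6) O A(1) by (simp add: normal)
    then show ?thesis using that F(7) O by (simp add: normal)
  qed
  note t = F(1-6) M O A(1-7)
  note m1 = tail[OF F(8)] and e1 = tail[OF F(9)]
  have 1: "mult X \<cdot> (mult X \<otimes> \<one> (obj X)) = mult X \<cdot> (\<one> (obj X) \<otimes> mult X)"
  proof (rule cancel)
    have "f \<cdot> (mult X \<cdot> (mult X \<otimes> \<one> (obj X))) = mult Y \<cdot> ((f \<cdot> mult X) \<otimes> f)"
      using t by (simp add: normal m1 interchange)
    also have "\<dots> = (mult Y \<cdot> (mult Y \<otimes> \<one> (obj Y))) \<cdot> (f \<otimes> f \<otimes> f)"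
      unfolding F(8) using t interchange[of "f \<otimes> f" "mult Y" f "\<one> (obj Y)"] by (simp add: normal)
    also have "\<dots> = mult Y \<cdot> (f \<otimes> (f \<cdot> mult X))"
      unfolding A(8) F(8) using t by (simp add: normal interchange)
    also have "\<dots> = f \<cdot> (mult X \<cdot> (\<one> (obj X) \<otimes> mult X))"
      using t by (simp add: normal m1 interchange)
    finally show "f \<cdot> (mult X \<cdot> (mult X \<otimes> \<one> (obj X))) = f \<cdot> (mult X \<cdot> (\<one> (obj X) \<otimes> mult X))" .
  qed (use t in \<open>simp_all add: normal\<close>)
  have 2: "mult X \<cdot> (eta X \<otimes> \<one> (obj X)) = \<one> (obj X)"
  proof (rule cancel)
    have "f \<cdot> (mult X \<cdot> (eta X \<otimes> \<one> (obj X))) = mult Y \<cdot> ((f \<cdot> eta X) \<otimes> f)"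
      using t by (simp add: normal m1 interchange)
    also have "\<dots> = (mult Y \<cdot> (eta Y \<otimes> \<one> (obj Y))) \<cdot> f"
      unfolding F(9) using t interchange[of "\<one> \<I>" "eta Y" f "\<one> (obj Y)"] by (simp add: normal)
    finally show "f \<cdot> (mult X \<cdot> (eta X \<otimes> \<one> (obj X))) = f \<cdot> \<one> (obj X)"
      unfolding A(9) using t by (simp add: normal)
  qed (use t in \<open>simp_all add: normal\<close>)
  have 3: "mult X \<cdot> (\<one> (obj X) \<otimes> eta X) = \<one> (obj X)"
  proof (rule cancel)
    have "f \<cdot> (mult X \<cdot> (\<one> (obj X) \<otimes> eta X)) = mult Y \<cdot> (f \<otimes> (f \<cdot> eta X))"
      using t by (simp add: normal m1 interchange)
    also have "\<dots> = (mult Y \<cdot> (\<one> (obj Y) \<otimes> eta Y)) \<cdot> f"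
      unfolding F(9) using t interchange[of f "\<one> (obj Y)" "\<one> \<I>" "eta Y"] by (simp add: normal)
    finally show "f \<cdot> (mult X \<cdot> (\<one> (obj X) \<otimes> eta X)) = f \<cdot> \<one> (obj X)"
      unfolding A(10) using t by (simp add: normal)
  qed (use t in \<open>simp_all add: normal\<close>)
  show ?thesis using 1 2 3 O m by (simp add: algebra_def)
qed

lemma algebra_hom_comp:
  assumes "algebra_hom \<C> f X Y" "algebra_hom \<C> g Y Z" "algebra \<C> Z" "obj X \<in> Obj \<C>" "obj Y \<in> Obj \<C>"
    "\<guillemotleft>mult X : obj X \<odot> obj X \<rightarrow> obj X\<guillemotright>" "\<guillemotleft>eta X : \<I> \<rightarrow> obj X\<guillemotright>"
    "\<guillemotleft>mult Y : obj Y \<odot> obj Y \<rightarrow> obj Y\<guillemotright>" "\<guillemotleft>eta Y : \<I> \<rightarrow> obj Y\<guillemotright>"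
  shows "algebra_hom \<C> (g \<cdot> f) X Z"
proof -
  have F: "f \<in> Arr \<C>" "Dom \<C> f = obj X" "Cod \<C> f = obj Y" "g \<in> Arr \<C>" "Dom \<C> g = obj Y"
      "Cod \<C> g = obj Z"
    "f \<cdot> mult X = mult Y \<cdot> (f \<otimes> f)" "g \<cdot> mult Y = mult Z \<cdot> (g \<otimes> g)" "f \<cdot> eta X = eta Y"
        "g \<cdot> eta Y = eta Z"
    using assms by (auto simp: algebra_hom_def in_hom_def)
  note M = assms(4-9)[unfolded in_hom_def]
  have Z: "mult Z \<in> Arr \<C>" "Dom \<C> (mult Z) = obj Z \<odot> obj Z" "obj Z \<in> Obj \<C>"
    using assms(3) by (auto simp: algebra_def in_hom_def)
  show ?thesis
    using F M Z by (simp add: algebra_hom_def in_hom_def normal tail[OF F(8)] interchange)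
qed

end

section \<open>Braidings, units and duals\<close>

context strict_braided_tensor_category
begin

lemma Braid_typing:
  assumes "X \<in> Obj \<C>" "Y \<in> Obj \<C>"
  shows "\<beta> X Y \<in> Arr \<C>" "Dom \<C> (\<beta> X Y) = X \<odot> Y" "Cod \<C> (\<beta> X Y) = Y \<odot> X"
  using Braid_hom[OF assms] by (auto simp: in_hom_def)

lemma Braid_natural':
  assumes "f \<in> Arr \<C>" "g \<in> Arr \<C>"
  shows "\<beta> (Cod \<C> f) (Cod \<C> g) \<cdot> (f \<otimes> g) = (g \<otimes> f) \<cdot> \<beta> (Dom \<C> f) (Dom \<C> g)"
  using Braid_natural[OF hom_self[OF assms(1)] hom_self[OF assms(2)]] by simp

lemma Braid_cancel:
  assumes "X \<in> Obj \<C>" "Y \<in> Obj \<C>" "f \<in> Arr \<C>" "g \<in> Arr \<C>" "Cod \<C> f = X \<odot> Y" "Cod \<C> g = X \<odot> Y"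
    and "\<beta> X Y \<cdot> f = \<beta> X Y \<cdot> g"
  shows "f = g"
proof -
  obtain h where h: "inverse_arrows \<C> (\<beta> X Y) h" using Braid_iso assms by blast
  have "h \<cdot> (\<beta> X Y \<cdot> f) = h \<cdot> (\<beta> X Y \<cdot> g)" using assms by simp
  then have "(h \<cdot> \<beta> X Y) \<cdot> f = (h \<cdot> \<beta> X Y) \<cdot> g"
    using h assms Comp_assoc'[of f "\<beta> X Y" h] Comp_assoc'[of g "\<beta> X Y" h]
    by (simp only: inverse_arrows_def in_hom_def Braid_typing)
  moreover have "h \<cdot> \<beta> X Y = \<one> (X \<odot> Y)"
    using h assms(1,2) by (simp add: inverse_arrows_def Braid_typing)
  ultimately have "\<one> (X \<odot> Y) \<cdot> f = \<one> (X \<odot> Y) \<cdot> g" by simp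
  then show ?thesis using assms(3-6) by (simp add: Comp_Ident_left')
qed

text \<open>
  By the hexagon identity for \<open>\<I> \<odot> \<I> = \<I>\<close> the braiding is an idempotent, and it is invertible.
\<close>

lemma Braid_unit_left:
  assumes X: "X \<in> Obj \<C>"
  shows "\<beta> \<I> X = \<one> X"
proof -
  have "\<beta> \<I> X = \<beta> \<I> X \<cdot> \<beta> \<I> X"
    using Braid_tensor_left[of \<I> \<I> X] X by (simp add: normal Braid_typing)
  then have "\<beta> \<I> X \<cdot> \<beta> \<I> X = \<beta> \<I> X \<cdot> \<one> X"
    using X by (simp add: normal Braid_typing)
  then show ?thesis
    by (rule Braid_cancel[rotated -1]) (use X in \<open>simp_all add: normal Braid_typing\<close>)
qed

lemma Braid_unit_right:
  assumes X: "X \<in> Obj \<C>"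
  shows "\<beta> X \<I> = \<one> X"
proof -
  have "\<beta> X \<I> = \<beta> X \<I> \<cdot> \<beta> X \<I>"
    using Braid_tensor_right[of X \<I> \<I>] X by (simp add: normal Braid_typing)
  then have "\<beta> X \<I> \<cdot> \<beta> X \<I> = \<beta> X \<I> \<cdot> \<one> X"
    using X by (simp add: normal Braid_typing)
  then show ?thesis
    by (rule Braid_cancel[rotated -1]) (use X in \<open>simp_all add: normal Braid_typing\<close>)
qed

end

context strict_braided_tensor_category
begin

lemma left_dualD:
  assumes "left_dual \<C> V D"
  shows "V \<in> Obj \<C>" "dual D \<in> Obj \<C>" "ev D \<in> Arr \<C>" "coev D \<in> Arr \<C>"
    "Dom \<C> (ev D) = dual D \<odot> V" "Cod \<C> (ev D) = \<I>" "Dom \<C> (coev D) = \<I>" "Cod \<C> (coev D) = V \<odot> dual D"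
    "(ev D \<otimes> \<one> (dual D)) \<cdot> (\<one> (dual D) \<otimes> coev D) = \<one> (dual D)"
    "(\<one> V \<otimes> ev D) \<cdot> (coev D \<otimes> \<one> V) = \<one> V"
  using assms by (simp_all add: left_dual_def in_hom_def)

text \<open>
  Naturality of the braiding with respect to the evaluation, used once for each order of the
  factors, shows that \<open>f = \<beta> V\<^sup>* X \<cdot> \<beta> X V\<^sup>*\<close> satisfies \<open>(X \<otimes> ev) (f \<otimes> V) = X \<otimes> ev\<close>: the two
  braidings with \<open>V\<close> that appear are inverse to each other. Bending the last strand back gives
  \<open>f = 1\<close>.
\<close>

lemma Braid_dual_symmetric:
  assumes D: "left_dual \<C> V D" and X: "X \<in> Obj \<C>"
    and sym: "\<beta> X V \<cdot> \<beta> V X = \<one> (V \<odot> X)"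
  shows "\<beta> (dual D) X \<cdot> \<beta> X (dual D) = \<one> (X \<odot> dual D)"
proof -
  note d = left_dualD[OF D]
  let ?W = "dual D"
  let ?f = "\<beta> ?W X \<cdot> \<beta> X ?W"
  have e1: "(\<one> X \<otimes> ev D) \<cdot> ((\<beta> ?W X \<otimes> \<one> V) \<cdot> (\<one> ?W \<otimes> \<beta> V X)) = ev D \<otimes> \<one> X"
    using Braid_natural'[of "ev D" "\<one> X"] d X
    by (simp add: normal Braid_typing Braid_unit_left Braid_tensor_left)
  have e2: "(ev D \<otimes> \<one> X) \<cdot> ((\<one> ?W \<otimes> \<beta> X V) \<cdot> (\<beta> X ?W \<otimes> \<one> V)) = \<one> X \<otimes> ev D"
    using Braid_natural'[of "\<one> X" "ev D"] d X
    by (simp add: normal Braid_typing Braid_unit_right Braid_tensor_right)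
  have inv: "(\<one> ?W \<otimes> \<beta> X V) \<cdot> (\<one> ?W \<otimes> \<beta> V X) = \<one> (?W \<odot> V \<odot> X)"
    using sym d X by (simp add: normal Braid_typing interchange Tensor_Ident)
  have inv': "\<beta> V X \<cdot> \<beta> X V = \<one> (X \<odot> V)"
    by (rule Braid_cancel[of X V]) (use sym d X
        in \<open>simp_all add: normal Braid_typing flip: Comp_assoc'\<close>)
  have "(\<one> X \<otimes> ev D) \<cdot> (\<beta> ?W X \<otimes> \<one> V)
      = (\<one> X \<otimes> ev D) \<cdot> ((\<beta> ?W X \<otimes> \<one> V) \<cdot> ((\<one> ?W \<otimes> \<beta> V X) \<cdot> (\<one> ?W \<otimes> \<beta> X V)))"
    using inv' d X by (simp add: normal Braid_typing interchange Tensor_Ident)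
  also have "\<dots> = ((\<one> X \<otimes> ev D) \<cdot> ((\<beta> ?W X \<otimes> \<one> V) \<cdot> (\<one> ?W \<otimes> \<beta> V X))) \<cdot> (\<one> ?W \<otimes> \<beta> X V)"
    using d X by (simp add: normal Braid_typing)
  also have "\<dots> = (ev D \<otimes> \<one> X) \<cdot> (\<one> ?W \<otimes> \<beta> X V)"
    unfolding e1 ..
  finally have e3: "(\<one> X \<otimes> ev D) \<cdot> (\<beta> ?W X \<otimes> \<one> V) = (ev D \<otimes> \<one> X) \<cdot> (\<one> ?W \<otimes> \<beta> X V)" .
  have "?f \<otimes> \<one> V = (\<beta> ?W X \<otimes> \<one> V) \<cdot> (\<beta> X ?W \<otimes> \<one> V)"
    using d X by (simp add: normal Braid_typing interchange)
  then have "(\<one> X \<otimes> ev D) \<cdot> (?f \<otimes> \<one> V) = ((\<one> X \<otimes> ev D) \<cdot> (\<beta> ?W X \<otimes> \<one> V)) \<cdot> (\<beta> X ?W \<otimes> \<one> V)"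
    using d X by (simp add: normal Braid_typing)
  also have "\<dots> = ((ev D \<otimes> \<one> X) \<cdot> (\<one> ?W \<otimes> \<beta> X V)) \<cdot> (\<beta> X ?W \<otimes> \<one> V)"
    unfolding e3 ..
  finally have "(\<one> X \<otimes> ev D) \<cdot> (?f \<otimes> \<one> V) = ((ev D \<otimes> \<one> X) \<cdot> (\<one> ?W \<otimes> \<beta> X V)) \<cdot> (\<beta> X ?W \<otimes> \<one> V)" .
  then have f: "(\<one> X \<otimes> ev D) \<cdot> (?f \<otimes> \<one> V) = \<one> X \<otimes> ev D"
    using e2 d X by (simp add: normal Braid_typing)
  have "?f = (\<one> X \<otimes> ((ev D \<otimes> \<one> ?W) \<cdot> (\<one> ?W \<otimes> coev D))) \<cdot> ?f"
    using d X by (simp add: normal Braid_typing Tensor_Ident)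
  also have "\<dots> = (((\<one> X \<otimes> ev D) \<cdot> (?f \<otimes> \<one> V)) \<otimes> \<one> ?W) \<cdot> (\<one> (X \<odot> ?W) \<otimes> coev D)"
  proof -
    define f where "f = ?f"
    have f: "f \<in> Arr \<C>" "Dom \<C> f = X \<odot> ?W" "Cod \<C> f = X \<odot> ?W"
      using d X by (simp_all add: f_def normal Braid_typing)
    have "(((\<one> X \<otimes> ev D) \<cdot> (f \<otimes> \<one> V)) \<otimes> \<one> ?W) \<cdot> (\<one> (X \<odot> ?W) \<otimes> coev D)
        = (\<one> X \<otimes> ev D \<otimes> \<one> ?W) \<cdot> ((f \<otimes> \<one> (V \<odot> ?W)) \<cdot> (\<one> (X \<odot> ?W) \<otimes> coev D))"
    proof -
      have "((\<one> X \<otimes> ev D) \<cdot> (f \<otimes> \<one> V)) \<otimes> \<one> ?W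
          = ((\<one> X \<otimes> ev D) \<otimes> \<one> ?W) \<cdot> ((f \<otimes> \<one> V) \<otimes> \<one> ?W)"
        using f d X by (subst interchange) (simp_all add: normal)
      then show ?thesis using f d X by (simp add: normal Tensor_Ident)
    qed
    also have "(f \<otimes> \<one> (V \<odot> ?W)) \<cdot> (\<one> (X \<odot> ?W) \<otimes> coev D) = (\<one> (X \<odot> ?W) \<otimes> coev D) \<cdot> f"
      using f d X interchange[of f "\<one> (X \<odot> ?W)" "\<one> \<I>" "coev D"] by (simp add: normal interchange)
    also have "(\<one> X \<otimes> ev D \<otimes> \<one> ?W) \<cdot> ((\<one> (X \<odot> ?W) \<otimes> coev D) \<cdot> f)
        = ((\<one> X \<otimes> ev D \<otimes> \<one> ?W) \<cdot> (\<one> (X \<odot> ?W) \<otimes> coev D)) \<cdot> f"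
      using f d X by (simp add: normal)
    also have "(\<one> X \<otimes> ev D \<otimes> \<one> ?W) \<cdot> (\<one> (X \<odot> ?W) \<otimes> coev D)
        = \<one> X \<otimes> ((ev D \<otimes> \<one> ?W) \<cdot> (\<one> ?W \<otimes> coev D))"
      using d(1-8) X by (simp add: normal interchange flip: Tensor_Ident)
    finally show ?thesis unfolding f_def ..
  qed
  also have "\<dots> = \<one> X \<otimes> ((ev D \<otimes> \<one> ?W) \<cdot> (\<one> ?W \<otimes> coev D))"
    unfolding f using d X by (simp add: normal interchange flip: Tensor_Ident)
  also have "\<dots> = \<one> (X \<odot> ?W)" using d X by (simp add: Tensor_Ident)
  finally show ?thesis .
qed

end

section \<open>Permutations of words of symmetric wires\<close>

text \<open>
  Wires carry objects whose braidings with each other are involutions. Only those objects need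
  to be symmetric; the category itself is merely braided.
\<close>

locale symmetric_wires = strict_braided_tensor_category \<C>
  for \<C> :: "('o, 'm) braided_category" (structure) +
  fixes ob :: "'w \<Rightarrow> 'o"
  assumes ob_Obj: "ob a \<in> Obj \<C>"
    and ob_symmetric: "\<beta> (ob b) (ob a) \<cdot> \<beta> (ob a) (ob b) = \<one> (ob a \<odot> ob b)"
begin

primrec obs :: "'w list \<Rightarrow> 'o" where
  "obs [] = \<I>"
| "obs (a # w) = ob a \<odot> obs w"

lemma obs_Obj: "obs w \<in> Obj \<C>"
  by (induction w) (simp_all add: Unit_Obj Tensor_Obj ob_Obj)

lemma obs_append: "obs (u @ v) = obs u \<odot> obs v"
  by (induction u) (simp_all add: normal ob_Obj obs_Obj)

lemmas wire_normal = normal Braid_typing ob_Obj obs_Obj obs_append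

text \<open>
  The canonical arrow that permutes a word of distinct wires: the first wire of the goal is
  pulled to the front past everything before it, then the rest is permuted.
\<close>

primrec perm :: "'w list \<Rightarrow> 'w list \<Rightarrow> 'm" where
  "perm w [] = \<one> \<I>"
| "perm w (a # w') = (\<one> (ob a) \<otimes> perm (remove1 a w) w')
     \<cdot> (\<beta> (obs (takeWhile (\<lambda>b. b \<noteq> a) w)) (ob a) \<otimes> \<one> (obs (tl (dropWhile (\<lambda>b. b \<noteq> a) w))))"

text \<open>
  The side condition under which \<^term>\<open>perm w w'\<close> has a meaning. Distinctness makes the
  permutation unique.
\<close>

definition reorders :: "'w list \<Rightarrow> 'w list \<Rightarrow> bool" where
  "reorders w w' \<longleftrightarrow> distinct w \<and> distinct w' \<and> set w = set w'"

lemma perm_Cons: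
  assumes "a \<notin> set u"
  shows "perm (u @ a # v) (a # w') =
    (\<one> (ob a) \<otimes> perm (u @ v) w') \<cdot> (\<beta> (obs u) (ob a) \<otimes> \<one> (obs v))"
proof -
  have "takeWhile (\<lambda>b. b \<noteq> a) (u @ a # v) = u" "dropWhile (\<lambda>b. b \<noteq> a) (u @ a # v) = a # v"
    using assms by (induction u) auto
  then show ?thesis using assms by (simp add: remove1_append)
qed

lemma reorders_ConsE:
  assumes "reorders w (a # w')"
  obtains u v where "w = u @ a # v" "a \<notin> set u" "a \<notin> set v" "reorders (u @ v) w'"
proof -
  have "a \<in> set w" using assms by (auto simp: reorders_def)
  then obtain u v where w: "w = u @ a # v" "a \<notin> set u" by (meson split_list_first)
  have "set (u @ v) = set w'"
    using assms w by (fastforce simp: reorders_def)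
  then show ?thesis using that[OF w] assms w by (auto simp: reorders_def)
qed

lemma perm_typing:
  "reorders w w' \<Longrightarrow>
    perm w w' \<in> Arr \<C> \<and> Dom \<C> (perm w w') = obs w \<and> Cod \<C> (perm w w') = obs w'"
proof (induction w' arbitrary: w)
  case Nil
  then show ?case by (simp add: reorders_def wire_normal)
next
  case (Cons a w')
  obtain u v where uv: "w = u @ a # v" "a \<notin> set u" "a \<notin> set v" "reorders (u @ v) w'"
    using Cons.prems by (rule reorders_ConsE)
  show ?case
    unfolding uv(1) perm_Cons[OF uv(2)] using Cons.IH[OF uv(4)] by (simp add: wire_normal)
qed

lemma perm_refl: "perm w w = \<one> (obs w)"
proof (induction w)
  case (Cons a w)
  then show ?case by (simp add: wire_normal Braid_unit_left Tensor_Ident)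
qed simp

text \<open>
  The coherence theorem in its smallest instance: undoing an exchange of two neighbours first
  does not change the permutation. If the wire to be pulled out lies beyond the two
  neighbours, this is naturality of the braiding; if it is one of them, it is involutivity;
  otherwise the exchange happens in the part that is permuted later.
\<close>

lemma perm_swap:
  assumes "reorders (u @ a # b # v) w'"
  shows "perm (u @ b # a # v) w' \<cdot> (\<one> (obs u) \<otimes> \<beta> (ob a) (ob b) \<otimes> \<one> (obs v))
    = perm (u @ a # b # v) w'"
  using assms
proof (induction w' arbitrary: u v)
  case Nil
  then show ?case by (simp add: reorders_def)
next
  case (Cons c w')
  let ?s = "\<beta> (ob a) (ob b)"
  have d: "distinct (u @ a # b # v)" using Cons.prems by (simp add: reorders_def)
  have "c \<in> set u \<or> c = a \<or> c = b \<or> c \<in> set v"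
    using Cons.prems by (auto simp: reorders_def)
  then consider "c \<in> set u" | "c = a" | "c = b" | "c \<in> set v" by blast
  then show ?case
  proof cases
    case 1
    then obtain p q where u: "u = p @ c # q" "c \<notin> set p" by (meson split_list_first)
    have r: "reorders ((p @ q) @ a # b # v) w'"
      using Cons.prems d u by (fastforce simp: reorders_def)
    have r': "reorders ((p @ q) @ b # a # v) w'"
      using r by (auto simp: reorders_def)
    have e: "perm (u @ b # a # v) (c # w') = (\<one> (ob c) \<otimes> perm ((p @ q) @ b # a # v) w')
         \<cdot> (\<beta> (obs p) (ob c) \<otimes> \<one> (obs (q @ b # a # v)))"
      using perm_Cons[OF u(2), of "q @ b # a # v"] u by simp
    have e': "perm (u @ a # b # v) (c # w') = (\<one> (ob c) \<otimes> perm ((p @ q) @ a # b # v) w')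
         \<cdot> (\<beta> (obs p) (ob c) \<otimes> \<one> (obs (q @ a # b # v)))"
      using perm_Cons[OF u(2), of "q @ a # b # v"] u by simp
    have "perm (u @ b # a # v) (c # w') \<cdot> (\<one> (obs u) \<otimes> ?s \<otimes> \<one> (obs v))
      = (\<one> (ob c) \<otimes> perm ((p @ q) @ b # a # v) w') \<cdot>
        ((\<beta> (obs p) (ob c) \<otimes> \<one> (obs (q @ b # a # v)))
          \<cdot> (\<one> (obs (p @ [c])) \<otimes> (\<one> (obs q) \<otimes> ?s \<otimes> \<one> (obs v))))"
      unfolding e unfolding u(1) using perm_typing[OF r']
          by (simp add: wire_normal flip: Tensor_Ident)
    also have "(\<beta> (obs p) (ob c) \<otimes> \<one> (obs (q @ b # a # v)))
          \<cdot> (\<one> (obs (p @ [c])) \<otimes> (\<one> (obs q) \<otimes> ?s \<otimes> \<one> (obs v)))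
       = (\<one> (obs (c # p)) \<otimes> (\<one> (obs q) \<otimes> ?s \<otimes> \<one> (obs v)))
          \<cdot> (\<beta> (obs p) (ob c) \<otimes> \<one> (obs (q @ a # b # v)))"
      by (simp add: wire_normal interchange)
    also have "(\<one> (ob c) \<otimes> perm ((p @ q) @ b # a # v) w') \<cdot> \<dots> =
       (\<one> (ob c) \<otimes> (perm ((p @ q) @ b # a # v) w' \<cdot> (\<one> (obs (p @ q)) \<otimes> ?s \<otimes> \<one> (obs v))))
        \<cdot> (\<beta> (obs p) (ob c) \<otimes> \<one> (obs (q @ a # b # v)))"
      using perm_typing[OF r'] by (simp add: wire_normal interchange_left flip: Tensor_Ident)
    finally show ?thesis unfolding e' using Cons.IH[OF r] by simp
  next
    case 2
    have au: "a \<notin> set u" "a \<notin> set (u @ [b])" using d by auto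
    have r: "reorders (u @ b # v) w'" using Cons.prems d 2 by (fastforce simp: reorders_def)
    have e: "perm (u @ b # a # v) (c # w') = (\<one> (ob a) \<otimes> perm (u @ b # v) w')
         \<cdot> (\<beta> (obs (u @ [b])) (ob a) \<otimes> \<one> (obs v))"
      using perm_Cons[OF au(2)] 2 by simp
    have "\<beta> (obs (u @ [b])) (ob a) = (\<beta> (obs u) (ob a) \<otimes> \<one> (ob b)) \<cdot> (\<one> (obs u) \<otimes> \<beta> (ob b) (ob a))"
      by (simp add: wire_normal Braid_tensor_left)
    then have "(\<beta> (obs (u @ [b])) (ob a) \<otimes> \<one> (obs v)) \<cdot> (\<one> (obs u) \<otimes> ?s \<otimes> \<one> (obs v))
       = ((\<beta> (obs u) (ob a) \<otimes> \<one> (ob b)) \<cdot> (\<one> (obs u) \<otimes> (\<beta> (ob b) (ob a) \<cdot> ?s))) \<otimes> \<one> (obs v)"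
      by (simp add: wire_normal interchange flip: Tensor_arr_assoc)
    also have "\<dots> = \<beta> (obs u) (ob a) \<otimes> \<one> (obs (b # v))"
      by (simp add: ob_symmetric wire_normal flip: Tensor_Ident)
        (simp add: wire_normal Tensor_Ident interchange)
    finally show ?thesis unfolding e using perm_Cons[OF au(1), of "b # v" w'] 2 perm_typing[OF r]
      by (simp add: wire_normal)
  next
    case 3
    have bu: "b \<notin> set u" "b \<notin> set (u @ [a])" using d by auto
    have r: "reorders (u @ a # v) w'" using Cons.prems d 3 by (fastforce simp: reorders_def)
    have e: "perm (u @ b # a # v) (c # w') = (\<one> (ob b) \<otimes> perm (u @ a # v) w')
         \<cdot> (\<beta> (obs u) (ob b) \<otimes> \<one> (obs (a # v)))"
      using perm_Cons[OF bu(1)] 3 by simp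
    have b2: "\<beta> (obs (u @ [a])) (ob b) = (\<beta> (obs u) (ob b) \<otimes> \<one> (ob a)) \<cdot> (\<one> (obs u) \<otimes> ?s)"
      by (simp add: wire_normal Braid_tensor_left)
    have "(\<beta> (obs u) (ob b) \<otimes> \<one> (obs (a # v))) \<cdot> (\<one> (obs u) \<otimes> ?s \<otimes> \<one> (obs v))
       = \<beta> (obs (u @ [a])) (ob b) \<otimes> \<one> (obs v)"
      unfolding b2 by (simp add: wire_normal interchange flip: Tensor_arr_assoc Tensor_Ident)
    then show ?thesis unfolding e using perm_Cons[OF bu(2), of v w'] 3 perm_typing[OF r]
      by (simp add: wire_normal)
  next
    case 4
    then obtain p q where v: "v = p @ c # q" "c \<notin> set p" by (meson split_list_first)
    have cu: "c \<notin> set (u @ a # b # p)" "c \<notin> set (u @ b # a # p)" using v 4 d by auto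
    have r: "reorders (u @ a # b # p @ q) w'"
      using Cons.prems d v by (fastforce simp: reorders_def)
    have r': "reorders (u @ b # a # p @ q) w'"
      using r by (auto simp: reorders_def)
    have e: "perm (u @ b # a # v) (c # w') = (\<one> (ob c) \<otimes> perm (u @ b # a # p @ q) w')
         \<cdot> (\<beta> (obs (u @ b # a # p)) (ob c) \<otimes> \<one> (obs q))"
      using perm_Cons[OF cu(2), of q] v by simp
    have e': "perm (u @ a # b # v) (c # w') = (\<one> (ob c) \<otimes> perm (u @ a # b # p @ q) w')
         \<cdot> (\<beta> (obs (u @ a # b # p)) (ob c) \<otimes> \<one> (obs q))"
      using perm_Cons[OF cu(1), of q] v by simp
    have n: "\<beta> (obs (u @ b # a # p)) (ob c) \<cdot> ((\<one> (obs u) \<otimes> ?s \<otimes> \<one> (obs p)) \<otimes> \<one> (ob c))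
       = (\<one> (ob c) \<otimes> (\<one> (obs u) \<otimes> ?s \<otimes> \<one> (obs p))) \<cdot> \<beta> (obs (u @ a # b # p)) (ob c)"
      using Braid_natural'[of "\<one> (obs u) \<otimes> ?s \<otimes> \<one> (obs p)" "\<one> (ob c)"] by (simp add: wire_normal)
    have "(\<beta> (obs (u @ b # a # p)) (ob c) \<otimes> \<one> (obs q)) \<cdot> (\<one> (obs u) \<otimes> ?s \<otimes> \<one> (obs v))
      = (\<beta> (obs (u @ b # a # p)) (ob c) \<cdot> ((\<one> (obs u) \<otimes> ?s \<otimes> \<one> (obs p)) \<otimes> \<one> (ob c))) \<otimes> \<one> (obs q)"
      unfolding v by (simp add: wire_normal interchange flip: Tensor_arr_assoc Tensor_Ident)
    also have "\<dots> = (\<one> (ob c) \<otimes> \<one> (obs u) \<otimes> ?s \<otimes> \<one> (obs (p @ q)))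
        \<cdot> (\<beta> (obs (u @ a # b # p)) (ob c) \<otimes> \<one> (obs q))"
      unfolding n by (simp add: wire_normal interchange flip: Tensor_arr_assoc Tensor_Ident)
    finally have cross: "(\<beta> (obs (u @ b # a # p)) (ob c) \<otimes> \<one> (obs q)) \<cdot> (\<one> (obs u) \<otimes> ?s \<otimes> \<one> (obs v))
      = (\<one> (ob c) \<otimes> \<one> (obs u) \<otimes> ?s \<otimes> \<one> (obs (p @ q)))
        \<cdot> (\<beta> (obs (u @ a # b # p)) (ob c) \<otimes> \<one> (obs q))" .
    have "perm (u @ b # a # v) (c # w') \<cdot> (\<one> (obs u) \<otimes> ?s \<otimes> \<one> (obs v))
      = (\<one> (ob c) \<otimes> perm (u @ b # a # p @ q) w') \<cdot>
        ((\<beta> (obs (u @ b # a # p)) (ob c) \<otimes> \<one> (obs q)) \<cdot> (\<one> (obs u) \<otimes> ?s \<otimes> \<one> (obs v)))"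
      unfolding e using perm_typing[OF r'] by (simp add: wire_normal v(1))
    also have "\<dots> = (\<one> (ob c) \<otimes> (perm (u @ b # a # p @ q) w' \<cdot> (\<one> (obs u) \<otimes> ?s \<otimes> \<one> (obs (p @ q)))))
        \<cdot> (\<beta> (obs (u @ a # b # p)) (ob c) \<otimes> \<one> (obs q))"
      unfolding cross using perm_typing[OF r'] by (simp add: wire_normal interchange_left)
    finally show ?thesis unfolding e' Cons.IH[OF r] .
  qed
qed

lemma perm_pull:
  assumes "reorders (u @ a # v) w'"
  shows "perm (a # u @ v) w' \<cdot> (\<beta> (obs u) (ob a) \<otimes> \<one> (obs v)) = perm (u @ a # v) w'"
  using assms
proof (induction u arbitrary: v rule: rev_induct)
  case Nil
  then show ?case using perm_typing[of "a # v" w']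
    by (simp add: wire_normal Braid_unit_left Tensor_Ident)
next
  case (snoc b u)
  have r: "reorders (u @ b # a # v) w'" "reorders (u @ a # b # v) w'" "reorders (a # u @ b # v) w'"
    using snoc.prems by (auto simp: reorders_def)
  have b2: "\<beta> (obs (u @ [b])) (ob a) = (\<beta> (obs u) (ob a) \<otimes> \<one> (ob b)) \<cdot> (\<one> (obs u) \<otimes> \<beta> (ob b) (ob a))"
    by (simp add: wire_normal Braid_tensor_left)
  have "\<beta> (obs (u @ [b])) (ob a) \<otimes> \<one> (obs v) =
      (\<beta> (obs u) (ob a) \<otimes> \<one> (obs (b # v))) \<cdot> (\<one> (obs u) \<otimes> \<beta> (ob b) (ob a) \<otimes> \<one> (obs v))"
    unfolding b2 by (simp add: wire_normal interchange flip: Tensor_arr_assoc Tensor_Ident)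
  then have "perm (a # (u @ [b]) @ v) w' \<cdot> (\<beta> (obs (u @ [b])) (ob a) \<otimes> \<one> (obs v))
     = (perm (a # u @ b # v) w' \<cdot> (\<beta> (obs u) (ob a) \<otimes> \<one> (obs (b # v))))
       \<cdot> (\<one> (obs u) \<otimes> \<beta> (ob b) (ob a) \<otimes> \<one> (obs v))"
    using perm_typing[OF r(3)] by (simp add: wire_normal)
  also have "\<dots> = perm (u @ b # a # v) w'"
    using snoc.IH[OF r(2)] perm_swap[OF r(1)] by simp
  finally show ?case by simp
qed

lemma perm_prefix: "reorders w w' \<Longrightarrow> set u \<inter> set w = {} \<Longrightarrow>
    perm (u @ w) (u @ w') = \<one> (obs u) \<otimes> perm w w'"
proof (induction u)
  case Nil
  then show ?case using perm_typing[of w w'] by (simp add: wire_normal)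
next
  case (Cons a u)
  have "perm (a # u @ w) (a # u @ w') = \<one> (ob a) \<otimes> perm (u @ w) (u @ w')"
    using perm_Cons[of a "[]" "u @ w" "u @ w'"] Cons perm_typing[of w w']
    by (simp add: wire_normal Braid_unit_left Tensor_Ident)
  then show ?case using Cons perm_typing[of w w']
    by (simp add: wire_normal flip: Tensor_Ident)
qed

lemma perm_suffix: "reorders w w' \<Longrightarrow>
    perm (w @ v) (w' @ v) = perm w w' \<otimes> \<one> (obs v)"
proof (induction w' arbitrary: w)
  case Nil
  then show ?case by (simp add: reorders_def wire_normal perm_refl)
next
  case (Cons a w')
  obtain p q where w: "w = p @ a # q" "a \<notin> set p" "a \<notin> set q" "reorders (p @ q) w'"
    using Cons.prems by (rule reorders_ConsE)
  have "perm (w @ v) ((a # w') @ v) =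
      (\<one> (ob a) \<otimes> perm ((p @ q) @ v) (w' @ v)) \<cdot> (\<beta> (obs p) (ob a) \<otimes> \<one> (obs (q @ v)))"
    using perm_Cons[OF w(2), of "q @ v" "w' @ v"] w(1) by simp
  also have "\<dots> = perm w (a # w') \<otimes> \<one> (obs v)"
    unfolding Cons.IH[OF w(4)] w(1) perm_Cons[OF w(2)]
    using perm_typing[OF w(4)] by (simp add: wire_normal interchange flip: Tensor_arr_assoc
        Tensor_Ident)
  finally show ?case .
qed

text \<open>
  Each canonical permutation is a sequence of pulls, and each pull is absorbed by \<open>perm_pull\<close>.
  The untouched prefix \<open>p\<close> collects the wires that are already in place.
\<close>

lemma perm_comp_prefixed:
  assumes "reorders w w'" "reorders (p @ w') w''"
  shows "perm (p @ w') w'' \<cdot> (\<one> (obs p) \<otimes> perm w w') = perm (p @ w) w''"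
  using assms
proof (induction w' arbitrary: w p)
  case Nil
  then have "w = []" by (simp add: reorders_def)
  then show ?case using perm_typing[of p w''] Nil by (simp add: wire_normal)
next
  case (Cons a w')
  obtain u v where w: "w = u @ a # v" "a \<notin> set u" "a \<notin> set v" "reorders (u @ v) w'"
    using Cons.prems(1) by (rule reorders_ConsE)
  have r: "reorders ((p @ [a]) @ w') w''" "reorders (p @ a # w') w''"
    "reorders (p @ a # u @ v) w''" "reorders (p @ u @ a # v) w''" "reorders ((p @ u) @ a # v) w''"
    "reorders (a # u @ v) (u @ a # v)" "reorders (a # p @ u @ v) w''"
    using Cons.prems w by (auto simp: reorders_def)
  have "perm (p @ a # w') w'' \<cdot> (\<one> (obs p) \<otimes> perm w (a # w'))
     = (perm ((p @ [a]) @ w') w'' \<cdot> (\<one> (obs (p @ [a])) \<otimes> perm (u @ v) w'))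
         \<cdot> (\<one> (obs p) \<otimes> \<beta> (obs u) (ob a) \<otimes> \<one> (obs v))"
    unfolding w(1) perm_Cons[OF w(2)] using perm_typing[OF r(2)] perm_typing[OF w(4)]
    by (simp add: wire_normal interchange flip: Tensor_Ident)
  also have "\<dots> = perm (p @ a # u @ v) w'' \<cdot> (\<one> (obs p) \<otimes> \<beta> (obs u) (ob a) \<otimes> \<one> (obs v))"
    using Cons.IH[OF w(4) r(1)] by simp
  also have "\<dots> = perm (a # p @ u @ v) w'' \<cdot> ((\<beta> (obs p) (ob a) \<otimes> \<one> (obs (u @ v)))
       \<cdot> (\<one> (obs p) \<otimes> \<beta> (obs u) (ob a) \<otimes> \<one> (obs v)))"
    unfolding perm_pull[OF r(3), symmetric]
    using perm_typing[OF r(7)] by (simp add: wire_normal flip: Tensor_Ident)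
  also have "(\<beta> (obs p) (ob a) \<otimes> \<one> (obs (u @ v))) \<cdot> (\<one> (obs p) \<otimes> \<beta> (obs u) (ob a) \<otimes> \<one> (obs v))
      = \<beta> (obs (p @ u)) (ob a) \<otimes> \<one> (obs v)"
    by (simp add: wire_normal Braid_tensor_left interchange flip: Tensor_arr_assoc Tensor_Ident)
  also have "perm (a # p @ u @ v) w'' \<cdot> \<dots> = perm (p @ u @ a # v) w''"
    using perm_pull[OF r(5)] by simp
  finally show ?case unfolding w(1) .
qed

lemma perm_comp:
  assumes "reorders w w'" "reorders w' w''"
  shows "perm w' w'' \<cdot> perm w w' = perm w w''"
  using perm_comp_prefixed[OF assms(1), of "[]" w''] assms perm_typing[OF assms(1)]
  by (simp add: wire_normal)

text \<open>
  A whole block pulled to the front is a single braiding, by the hexagon identity.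
\<close>

lemma perm_block:
  "distinct (u @ i @ v) \<Longrightarrow> perm (u @ i @ v) (i @ u @ v) = \<beta> (obs u) (obs i) \<otimes> \<one> (obs v)"
proof (induction i)
  case Nil
  then show ?case by (simp add: perm_refl wire_normal Braid_unit_right Tensor_Ident)
next
  case (Cons a i)
  have "perm (u @ (a # i) @ v) ((a # i) @ u @ v)
     = (\<one> (ob a) \<otimes> \<beta> (obs u) (obs i) \<otimes> \<one> (obs v)) \<cdot> (\<beta> (obs u) (ob a) \<otimes> \<one> (obs (i @ v)))"
    using perm_Cons[of a u "i @ v" "i @ u @ v"] Cons by simp
  also have "\<dots> = \<beta> (obs u) (obs (a # i)) \<otimes> \<one> (obs v)"
    by (simp add: wire_normal Braid_tensor_right interchange flip: Tensor_arr_assoc Tensor_Ident)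
  finally show ?case .
qed

end

section \<open>Wire diagrams\<close>

type_synonym ('f, 'v) node = "'f \<times> 'v list \<times> 'v list"

abbreviation box :: "('f, 'v) node \<Rightarrow> 'f" where "box n \<equiv> fst n"
abbreviation ins :: "('f, 'v) node \<Rightarrow> 'v list" where "ins n \<equiv> fst (snd n)"
abbreviation outs :: "('f, 'v) node \<Rightarrow> 'v list" where "outs n \<equiv> snd (snd n)"

context symmetric_wires
begin

abbreviation rest :: "'w list \<Rightarrow> 'w list \<Rightarrow> 'w list" where
  "rest i w \<equiv> filter (\<lambda>a. a \<notin> set i) w"

text \<open>
  The value of a diagram with input wires \<open>w\<close> and output wires \<open>out\<close>: for each node its inputs
  are permuted to the front and replaced by its outputs, and at the end the remaining wires
  are put in the order \<open>out\<close>.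
\<close>

primrec sem :: "'w list \<Rightarrow> ('m, 'w) node list \<Rightarrow> 'w list \<Rightarrow> 'm" where
  "sem w [] out = perm w out"
| "sem w (n # N) out = sem (outs n @ rest (ins n) w) N out
     \<cdot> ((box n \<otimes> \<one> (obs (rest (ins n) w))) \<cdot> perm w (ins n @ rest (ins n) w))"

primrec valid :: "'w list \<Rightarrow> ('m, 'w) node list \<Rightarrow> 'w list \<Rightarrow> bool" where
  "valid w [] out \<longleftrightarrow> reorders w out"
| "valid w (n # N) out \<longleftrightarrow> distinct w \<and> distinct (ins n) \<and> set (ins n) \<subseteq> set w \<and>
     distinct (outs n @ rest (ins n) w) \<and> valid (outs n @ rest (ins n) w) N out"

definition typed_node :: "('m, 'w) node \<Rightarrow> bool" where
  "typed_node n \<longleftrightarrow> \<guillemotleft>box n : obs (ins n) \<rightarrow> obs (outs n)\<guillemotright>"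

abbreviation typed :: "('m, 'w) node list \<Rightarrow> bool" where
  "typed N \<equiv> list_all typed_node N"

lemma typed_nodeD:
  "typed_node n \<Longrightarrow> box n \<in> Arr \<C> \<and> Dom \<C> (box n) = obs (ins n) \<and> Cod \<C> (box n) = obs (outs n)"
  by (simp add: typed_node_def in_hom_def)

lemma valid_distinct: "valid w N out \<Longrightarrow> distinct w \<and> distinct out"
  by (induction N arbitrary: w) (auto simp: reorders_def)

lemma rest_disjoint: "set w \<inter> set i = {} \<Longrightarrow> rest i w = w"
  by (rule filter_True) auto

lemma rest_self: "rest i i = []"
  by simp

lemma reorders_check: "reorders w w' \<longleftrightarrow>
    distinct w \<and> distinct w' \<and> length w = length w' \<and> list_all (\<lambda>a. a \<in> set w') w"
  unfolding reorders_def list_all_iff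
  by (metis List.finite_set card_subset_eq distinct_card subsetI subset_refl subset_code(1))

lemma reorders_rest: "distinct w \<Longrightarrow> distinct i \<Longrightarrow> set i \<subseteq> set w \<Longrightarrow> reorders w (i @ rest i w)"
  by (auto simp: reorders_def)

lemma sem_typing:
  "valid w N out \<Longrightarrow> typed N \<Longrightarrow>
    sem w N out \<in> Arr \<C> \<and> Dom \<C> (sem w N out) = obs w \<and> Cod \<C> (sem w N out) = obs out"
proof (induction N arbitrary: w)
  case Nil
  then show ?case using perm_typing by simp
next
  case (Cons n N)
  have r: "reorders w (ins n @ rest (ins n) w)" using Cons.prems by (intro reorders_rest) auto
  have v: "valid (outs n @ rest (ins n) w) N out" "typed N" "typed_node n" using Cons.prems by auto
  note t = Cons.IH[OF v(1,2)] perm_typing[OF r] typed_nodeD[OF v(3)]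
  show ?case unfolding sem.simps using t by (auto simp only: wire_normal)
qed

lemma reorders_step:
  assumes "reorders w w'" "distinct (p @ rest i w)"
  shows "reorders (p @ rest i w) (p @ rest i w')"
proof -
  have s: "set (rest i w') = set (rest i w)" and d: "distinct (rest i w')"
    using assms(1) unfolding reorders_def set_filter by auto
  show ?thesis using assms(2) s d unfolding reorders_def set_append distinct_append by argo
qed

lemma valid_reorders: "valid w N out \<Longrightarrow> reorders w w' \<Longrightarrow> valid w' N out"
proof (induction N arbitrary: w w')
  case Nil
  then show ?case by (auto simp: reorders_def)
next
  case (Cons n N)
  have r: "reorders (outs n @ rest (ins n) w) (outs n @ rest (ins n) w')"
    using Cons.prems by (intro reorders_step) auto
  then have "valid (outs n @ rest (ins n) w') N out"
    using Cons.prems by (intro Cons.IH[OF _ r]) simp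
  moreover have "distinct w'" "set w' = set w" "distinct (outs n @ rest (ins n) w')"
    using Cons.prems(2) r by (simp_all add: reorders_def)
  ultimately show ?case using Cons.prems(1) by simp
qed

text \<open>
  Since every node first permutes its inputs to the front, the order of the current wires may
  be changed freely.
\<close>

lemma sem_reorders:
  "valid w N out \<Longrightarrow> typed N \<Longrightarrow> reorders w w' \<Longrightarrow> sem w' N out \<cdot> perm w w' = sem w N out"
proof (induction N arbitrary: w w')
  case Nil
  then show ?case by (auto intro!: perm_comp simp: reorders_def)
next
  case (Cons n N)
  let ?i = "ins n" and ?o = "outs n" and ?r = "rest (ins n) w" and ?r' = "rest (ins n) w'"
  have v: "valid (?o @ ?r) N out" "typed N" "typed_node n" using Cons.prems by auto
  have i: "distinct ?i" "set ?i \<subseteq> set w" "set ?i \<subseteq> set w'" "distinct w" "distinct w'"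
      "distinct (?o @ ?r)"
    "distinct (?i @ ?r)"
    using Cons.prems by (auto simp: reorders_def)
  have r: "reorders w (?i @ ?r)" "reorders w' (?i @ ?r')" "reorders ?r ?r'"
      "reorders (?i @ ?r) (?i @ ?r')"
    "reorders (?o @ ?r) (?o @ ?r')"
    using i reorders_rest reorders_step[OF Cons.prems(3), of "[]" ?i] reorders_step[OF Cons.prems(3)]
    by simp_all
  have disj: "set ?i \<inter> set ?r = {}" "set ?o \<inter> set ?r = {}" using Cons.prems by auto
  note t = typed_nodeD[OF v(3)] perm_typing[OF r(1)] perm_typing[OF r(2)] perm_typing[OF r(3)]
    perm_typing[OF Cons.prems(3)] sem_typing[OF valid_reorders[OF v(1) r(5)] v(2)]
  have p: "perm w' (?i @ ?r') \<cdot> perm w w' = (\<one> (obs ?i) \<otimes> perm ?r ?r') \<cdot> perm w (?i @ ?r)"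
    using perm_comp[OF Cons.prems(3) r(2)] perm_comp[OF r(1) r(4)] perm_prefix[OF r(3) disj(1)]
    by simp
  have "sem w' (n # N) out \<cdot> perm w w'
      = sem (?o @ ?r') N out \<cdot> ((box n \<otimes> \<one> (obs ?r')) \<cdot> (perm w' (?i @ ?r') \<cdot> perm w w'))"
    using t by (simp add: wire_normal)
  also have "\<dots> = (sem (?o @ ?r') N out \<cdot> (\<one> (obs ?o) \<otimes> perm ?r ?r'))
       \<cdot> ((box n \<otimes> \<one> (obs ?r)) \<cdot> perm w (?i @ ?r))"
    unfolding p using t by (simp add: wire_normal interchange_left)
  also have "sem (?o @ ?r') N out \<cdot> (\<one> (obs ?o) \<otimes> perm ?r ?r') = sem (?o @ ?r) N out"
    using Cons.IH[OF v(1,2) r(5)] perm_prefix[OF r(3) disj(2)] by simp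
  finally show ?case by simp
qed

text \<open>
  A node whose inputs already are neighbours can be evaluated in place: pulling them to the
  front and pushing the outputs back cancels by naturality of the braiding.
\<close>

lemma sem_layer:
  assumes "valid (u @ i @ v) ((f, i, o') # N) out" "typed ((f, i, o') # N)"
  shows "sem (u @ i @ v) ((f, i, o') # N) out = sem (u @ o' @ v) N out \<cdot> (\<one> (obs u) \<otimes> f \<otimes> \<one> (obs v))"
proof -
  have d: "distinct (u @ i @ v)" using assms valid_distinct by blast
  have "rest i u = u" "rest i v = v" by (rule rest_disjoint; use d in auto)+
  then have r: "rest i (u @ i @ v) = u @ v" by simp
  have d': "distinct (o' @ u @ v)" and val: "valid (o' @ u @ v) N out" using assms(1) r by auto
  have ro: "reorders (u @ o' @ v) (o' @ u @ v)" using d' by (auto simp: reorders_def)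
  then have ro': "reorders (o' @ u @ v) (u @ o' @ v)" by (auto simp: reorders_def)
  have t: "f \<in> Arr \<C>" "Dom \<C> f = obs i" "Cod \<C> f = obs o'" "typed N"
    using assms(2) typed_nodeD[of "(f, i, o')"] by auto
  note ts = sem_typing[OF val t(4)]
  have nat: "(f \<otimes> \<one> (obs u)) \<cdot> \<beta> (obs u) (obs i) = \<beta> (obs u) (obs o') \<cdot> (\<one> (obs u) \<otimes> f)"
    using Braid_natural'[of "\<one> (obs u)" f] t by (simp add: wire_normal)
  have "sem (u @ i @ v) ((f, i, o') # N) out
      = sem (o' @ u @ v) N out \<cdot> (((f \<otimes> \<one> (obs u)) \<cdot> \<beta> (obs u) (obs i)) \<otimes> \<one> (obs v))"
    using r perm_block[OF d] t by (simp add: wire_normal interchange flip: Tensor_arr_assoc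
        Tensor_Ident)
  also have "\<dots> = (sem (o' @ u @ v) N out \<cdot> (\<beta> (obs u) (obs o') \<otimes> \<one> (obs v)))
       \<cdot> (\<one> (obs u) \<otimes> f \<otimes> \<one> (obs v))"
    unfolding nat using t ts by (simp add: wire_normal interchange flip: Tensor_arr_assoc
        Tensor_Ident)
  also have "sem (o' @ u @ v) N out \<cdot> (\<beta> (obs u) (obs o') \<otimes> \<one> (obs v)) = sem (u @ o' @ v) N out"
    using sem_reorders[OF valid_reorders[OF val ro'] t(4) ro] perm_block[of u o' v] ro
    by (simp add: reorders_def)
  finally show ?thesis .
qed

lemma sem_braid:
  assumes "valid (u @ a # b # v) N out" "typed N"
  shows "sem (u @ b # a # v) N out \<cdot> (\<one> (obs u) \<otimes> \<beta> (ob a) (ob b) \<otimes> \<one> (obs v))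
      = sem (u @ a # b # v) N out"
proof -
  have d: "distinct (u @ a # b # v)" using assms valid_distinct by blast
  have r: "reorders (u @ a # b # v) (u @ b # a # v)" "reorders ([a, b] @ v) ([b, a] @ v)"
      "reorders [a, b] [b, a]"
    using d by (auto simp: reorders_def)
  have "perm (u @ a # b # v) (u @ b # a # v) = \<one> (obs u) \<otimes> perm [a, b] [b, a] \<otimes> \<one> (obs v)"
    using perm_prefix[OF r(2), of u] perm_suffix[OF r(3), of v] d by auto
  also have "perm [a, b] [b, a] = \<beta> (ob a) (ob b)"
    using perm_block[of "[a]" "[b]" "[]"] d by (simp add: wire_normal del: perm.simps)
  finally show ?thesis using sem_reorders[OF assms r(1)] by simp
qed

text \<open>
  Wires that a part \<open>L\<close> of the diagram does not touch may be carried along as an identity.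
  This is what allows \<open>L\<close> to be replaced by another diagram with the same value.
\<close>

lemma sem_frame:
  "valid w L wo \<Longrightarrow> valid (w @ v) (L @ B) out \<Longrightarrow> typed L \<Longrightarrow> typed B \<Longrightarrow>
    valid (wo @ v) B out \<and>
    sem (w @ v) (L @ B) out = sem (wo @ v) B out \<cdot> (sem w L wo \<otimes> \<one> (obs v))"
proof (induction L arbitrary: w)
  case Nil
  then have r: "reorders w wo" by simp
  then have "reorders (w @ v) (wo @ v)" using Nil.prems valid_distinct[of "w @ v"]
      by (auto simp: reorders_def)
  moreover have "valid (w @ v) B out" using Nil.prems by simp
  ultimately show ?case
    using sem_reorders[of "w @ v" B out "wo @ v"] perm_suffix[OF r,
        of v] Nil.prems valid_reorders by auto
next
  case (Cons n L)
  have d: "distinct (w @ v)" and i: "set (ins n) \<subseteq> set w" using Cons.prems valid_distinct by auto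
  then have "set (ins n) \<inter> set v = {}" by auto
  then have rv: "rest (ins n) v = v" by (auto simp: filter_id_conv)
  then have r: "rest (ins n) (w @ v) = rest (ins n) w @ v" by simp
  have IH: "valid (wo @ v) B out"
    "sem ((outs n @ rest (ins n) w) @ v) (L @ B) out
       = sem (wo @ v) B out \<cdot> (sem (outs n @ rest (ins n) w) L wo \<otimes> \<one> (obs v))"
    using Cons.IH[of "outs n @ rest (ins n) w"] Cons.prems rv by auto
  have ro: "reorders w (ins n @ rest (ins n) w)"
    using Cons.prems by (intro reorders_rest) auto
  have v: "valid (outs n @ rest (ins n) w) L wo" "typed L" "typed_node n" using Cons.prems by auto
  note t = sem_typing[OF IH(1) Cons.prems(4)] sem_typing[OF v(1,2)]
    perm_typing[OF ro] typed_nodeD[OF v(3)]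
  have "sem (w @ v) ((n # L) @ B) out = sem ((outs n @ rest (ins n) w) @ v) (L @ B) out
     \<cdot> ((box n \<otimes> \<one> (obs (rest (ins n) w @ v))) \<cdot> perm (w @ v) ((ins n @ rest (ins n) w) @ v))"
    using rv by simp
  also have "\<dots> = sem (wo @ v) B out \<cdot> (sem w (n # L) wo \<otimes> \<one> (obs v))"
    unfolding IH(2) perm_suffix[OF ro] using t
    by (simp add: wire_normal interchange flip: Tensor_arr_assoc Tensor_Ident)
  finally show ?case using IH(1) by blast
qed

lemma sem_exchange:
  assumes v1: "valid w (n # k # N) out" and v2: "valid w (k # n # N) out" and t: "typed (n # k # N)"
    and disj: "set (ins n) \<inter> set (ins k) = {}"
  shows "sem w (n # k # N) out = sem w (k # n # N) out"
proof -
  obtain f i o1 where n: "n = (f, i, o1)" by (metis prod.collapse)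
  obtain g j o2 where k: "k = (g, j, o2)" by (metis prod.collapse)
  let ?r = "rest (i @ j) w"
  have r: "reorders w (i @ j @ ?r)" "reorders (i @ j @ ?r) w"
    using v1 v2 disj n k by (auto simp: reorders_def)
  have a1: "valid (i @ j @ ?r) (n # k # N) out" "valid (i @ j @ ?r) (k # n # N) out"
    using valid_reorders v1 v2 r by blast+
  have ri: "rest i (i @ j @ ?r) = j @ ?r" "rest j (i @ j @ ?r) = i @ ?r"
  proof -
    have "rest i j = j" "rest j i = i" "rest i ?r = ?r" "rest j ?r = ?r"
      by (rule rest_disjoint; use disj n k in auto)+
    then show "rest i (i @ j @ ?r) = j @ ?r" "rest j (i @ j @ ?r) = i @ ?r"
      unfolding filter_append rest_self by (simp_all only: append_Nil)
  qed
  have a2: "valid (o1 @ j @ ?r) (k # N) out"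
    using a1(1) ri(1) unfolding n valid.simps(2)[of _ "(f, i, o1)"] fst_conv snd_conv by metis
  have a2': "valid (o2 @ i @ ?r) (n # N) out"
    using a1(2) ri(2) unfolding k valid.simps(2)[of _ "(g, j, o2)"] fst_conv snd_conv by metis
  have "reorders (o2 @ i @ ?r) (i @ o2 @ ?r)"
      using valid_distinct[OF a2'] unfolding reorders_def by auto
  then have a3: "valid (i @ o2 @ ?r) (n # N) out" using a2' valid_reorders by blast
  have "sem (i @ j @ ?r) (n # k # N) out =
     (sem (o1 @ o2 @ ?r) N out \<cdot> (\<one> (obs o1) \<otimes> g \<otimes> \<one> (obs ?r))) \<cdot> (f \<otimes> \<one> (obs (j @ ?r)))"
    using sem_layer[of "[]" i "j @ ?r" f o1 "k # N" out] sem_layer[of o1 j ?r g o2 N out] a1 a2 t n k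
       typed_nodeD[of n] by (simp add: wire_normal del: sem.simps valid.simps)
  also have "\<dots> = (sem (o1 @ o2 @ ?r) N out \<cdot> (f \<otimes> \<one> (obs (o2 @ ?r)))) \<cdot> (\<one> (obs i) \<otimes> g \<otimes> \<one> (obs ?r))"
  proof -
    have val: "valid (o1 @ o2 @ ?r) N out"
    proof -
      have "rest i (i @ o2 @ ?r) = o2 @ ?r"
        using valid_distinct[OF a3] rest_disjoint[of "o2 @ ?r" i] by auto
      then show ?thesis using a3 n by simp
    qed
    then show ?thesis using sem_typing[OF val] t n k typed_nodeD[of n] typed_nodeD[of k]
      by (simp add: wire_normal interchange flip: Tensor_Ident)
  qed
  also have "\<dots> = sem (i @ j @ ?r) (k # n # N) out"
    using sem_layer[of i j ?r g o2 "n # N" out] sem_layer[of "[]" i "o2 @ ?r" f o1 N out] a1 a3 t n k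
       typed_nodeD[of n] by (simp add: wire_normal del: sem.simps valid.simps)
  finally show ?thesis
    using sem_reorders[OF v1 t r(1)] sem_reorders[OF v2 _ r(1)] t by auto
qed

primrec state :: "'w list \<Rightarrow> ('m, 'w) node list \<Rightarrow> 'w list" where
  "state w [] = w"
| "state w (n # N) = state (outs n @ rest (ins n) w) N"

lemma sem_append:
  "valid w (A @ X) out \<Longrightarrow> typed A \<Longrightarrow> typed X \<Longrightarrow>
    valid (state w A) X out \<and> valid w A (state w A) \<and>
    sem w (A @ X) out = sem (state w A) X out \<cdot> sem w A (state w A)"
proof (induction A arbitrary: w)
  case Nil
  then show ?case using sem_typing[of w X out] valid_distinct[of w X out]
    by (simp add: perm_refl wire_normal reorders_def)
next
  case (Cons n A)
  let ?s = "outs n @ rest (ins n) w"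
  have r: "reorders w (ins n @ rest (ins n) w)" using Cons.prems by (intro reorders_rest) auto
  have v: "valid ?s (A @ X) out" "typed A" "typed_node n" using Cons.prems by auto
  have IH: "valid (state ?s A) X out" "valid ?s A (state ?s A)"
    "sem ?s (A @ X) out = sem (state ?s A) X out \<cdot> sem ?s A (state ?s A)"
    using Cons.IH[OF v(1,2) Cons.prems(3)] by auto
  note t = sem_typing[OF IH(1) Cons.prems(3)] sem_typing[OF IH(2) v(2)] perm_typing[OF r]
      typed_nodeD[OF v(3)]
  have "sem w ((n # A) @ X) out = sem (state w (n # A)) X out \<cdot> sem w (n # A) (state w (n # A))"
    unfolding append_Cons sem.simps state.simps IH(3) using t by (simp only: wire_normal)
  moreover have "valid w (n # A) (state w (n # A))" using IH(2) Cons.prems(1) by simp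
  ultimately show ?case using IH(1) by simp
qed

definition names :: "'w list \<Rightarrow> ('m, 'w) node list \<Rightarrow> 'w list" where
  "names w N = w @ concat (map outs N)"

text \<open>
  No name may be used twice, not even after the first wire of that name has been consumed;
  otherwise moving a node in front of another one could capture a wire.
\<close>

definition well_formed :: "'w list \<Rightarrow> ('m, 'w) node list \<Rightarrow> 'w list \<Rightarrow> bool" where
  "well_formed w N out \<longleftrightarrow> valid w N out \<and> distinct (names w N)"

lemma used_names: "valid w (A @ n # B) out \<Longrightarrow> set (ins n) \<subseteq> set (names w A)"
proof (induction A arbitrary: w)
  case (Cons a A)
  then show ?case by (fastforce simp: names_def)
qed (simp add: names_def)

lemma sem_move_front:
  "well_formed w (A @ n # B) out \<Longrightarrow> set (ins n) \<subseteq> set w \<Longrightarrow> typed (A @ n # B) \<Longrightarrow> distinct (ins n) \<Longrightarrow>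
    well_formed w (n # A @ B) out \<and> sem w (A @ n # B) out = sem w (n # A @ B) out"
proof (induction A arbitrary: w)
  case (Cons a A)
  let ?s = "outs a @ rest (ins a) w"
  have g: "well_formed ?s (A @ n # B) out"
    using Cons.prems(1) by (auto simp: well_formed_def names_def)
  have dn: "distinct (names w (a # A @ n # B))" using Cons.prems(1) by (simp add: well_formed_def)
  have "set (ins n) \<subseteq> set (names ?s A)"
    using g used_names[of ?s A n B out] by (simp add: well_formed_def)
  then have i: "set (ins n) \<inter> set (ins a) = {}" "set (ins n) \<subseteq> set ?s"
    using dn Cons.prems(1,2) by (auto simp: names_def well_formed_def)
  have IH: "well_formed ?s (n # A @ B) out" "sem ?s (A @ n # B) out = sem ?s (n # A @ B) out"
    using Cons.IH[OF g i(2)] Cons.prems by auto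
  have r: "rest (ins n) (outs a @ rest (ins a) w) = outs a @ rest (ins n) (rest (ins a) w)"
  proof -
    have "rest (ins n) (outs a) = outs a"
      by (rule rest_disjoint) (use dn Cons.prems(2) in \<open>auto simp: names_def\<close>)
    then show ?thesis by simp
  qed
  have r2: "rest (ins a) (outs n @ rest (ins n) w) = outs n @ rest (ins a) (rest (ins n) w)"
  proof -
    have "set (ins a) \<subseteq> set w" using Cons.prems(1) by (simp add: well_formed_def)
    then have "rest (ins a) (outs n) = outs n"
      by (intro rest_disjoint) (use dn in \<open>auto simp: names_def\<close>)
    then show ?thesis by simp
  qed
  have v1: "valid w (a # n # A @ B) out" using IH(1) Cons.prems(1) by (simp add: well_formed_def)
  have v2: "valid w (n # a # A @ B) out"
  proof -
    have "valid (outs n @ outs a @ rest (ins n) (rest (ins a) w)) (A @ B) out"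
      using v1 r by simp
    moreover have "reorders (outs n @ outs a @ rest (ins n) (rest (ins a) w))
        (outs a @ outs n @ rest (ins a) (rest (ins n) w))"
      using dn by (auto simp: reorders_def names_def)
    ultimately have "valid (outs a @ rest (ins a) (outs n @ rest (ins n) w)) (A @ B) out"
      using valid_reorders r2 by simp
    then show ?thesis using Cons.prems dn i by (auto simp: names_def well_formed_def)
  qed
  have "sem w (a # n # A @ B) out = sem w (n # a # A @ B) out"
    using sem_exchange[OF v1 v2] i Cons.prems(3) by (auto simp: Int_commute)
  moreover have "sem w (a # A @ n # B) out = sem w (a # n # A @ B) out"
    using IH(2) by simp
  moreover have "distinct (names w (n # a # A @ B))" using dn by (auto simp: names_def)
  ultimately show ?case using v2 by (simp add: well_formed_def)
qed simp

primrec same_nodes :: "('m, 'w) node list \<Rightarrow> ('m, 'w) node list \<Rightarrow> bool" where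
  "same_nodes [] N \<longleftrightarrow> N = []"
| "same_nodes (n # M) N \<longleftrightarrow> n \<in> set N \<and> same_nodes M (remove1 n N)"

text \<open>
  The order in which the nodes are listed is irrelevant: the node that comes first in one list
  can be moved to the front of the other, since none of the nodes it passes produces one of
  its inputs.
\<close>

lemma sem_same_nodes:
  "well_formed w N out \<Longrightarrow> well_formed w M out \<Longrightarrow> typed N \<Longrightarrow> same_nodes M N \<Longrightarrow> sem w N out = sem w M out"
proof (induction M arbitrary: w N)
  case (Cons n M)
  then obtain A B where N: "N = A @ n # B" "n \<notin> set A" by (auto dest: split_list_first)
  then have r: "remove1 n N = A @ B" by (simp add: remove1_append)
  have m: "well_formed w (n # A @ B) out" "sem w N out = sem w (n # A @ B) out"
    using sem_move_front[of w A n B out] Cons.prems N by (auto simp: well_formed_def)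
  have "sem (outs n @ rest (ins n) w) (A @ B) out = sem (outs n @ rest (ins n) w) M out"
    using m(1) Cons.prems N r by (intro Cons.IH) (auto simp: well_formed_def names_def)
  then show ?case using m(2) by simp
qed simp

definition rename :: "('w \<Rightarrow> 'w) \<Rightarrow> ('m, 'w) node \<Rightarrow> ('m, 'w) node" where
  "rename r n = (box n, map r (ins n), map r (outs n))"

lemma rename_simps: "box (rename r n) = box n" "ins (rename r n) = map r (ins n)"
  "outs (rename r n) = map r (outs n)"
  by (simp_all add: rename_def)

lemma obs_map: "(\<And>a. ob (r a) = ob a) \<Longrightarrow> obs (map r w) = obs w"
  by (induction w) auto

lemma perm_map:
  "(\<And>a. ob (r a) = ob a) \<Longrightarrow> inj_on r (set w) \<Longrightarrow> reorders w w' \<Longrightarrow> perm (map r w) (map r w') = perm w w'"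
proof (induction w' arbitrary: w)
  case (Cons a w')
  obtain u v where w: "w = u @ a # v" "a \<notin> set u" "a \<notin> set v" "reorders (u @ v) w'"
    using Cons.prems(3) by (rule reorders_ConsE)
  have "r a \<notin> set (map r u)" using Cons.prems(2) w by (auto simp: inj_on_def)
  moreover have "perm (map r (u @ v)) (map r w') = perm (u @ v) w'"
    using Cons.prems w by (intro Cons.IH) (auto simp: inj_on_def)
  ultimately show ?case
    using perm_Cons[of "r a" "map r u" "map r v"] perm_Cons[OF w(2)] w(1) Cons.prems(1)
    by (simp add: obs_map)
qed simp

lemma rest_map:
  "inj_on r (set i \<union> set w) \<Longrightarrow> rest (map r i) (map r w) = map r (rest i w)"
  by (induction w) (auto simp: inj_on_def)

lemma sem_rename:
  "(\<And>a. ob (r a) = ob a) \<Longrightarrow> inj_on r (set (names w N)) \<Longrightarrow> valid w N out \<Longrightarrow>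
    valid (map r w) (map (rename r) N) (map r out) \<and>
    sem (map r w) (map (rename r) N) (map r out) = sem w N out"
proof (induction N arbitrary: w)
  case Nil
  then show ?case using perm_map[of r w out]
    by (auto simp: reorders_def names_def distinct_map intro: inj_on_subset)
next
  case (Cons n N)
  let ?s = "outs n @ rest (ins n) w"
  have i: "set (ins n) \<subseteq> set w" "reorders w (ins n @ rest (ins n) w)"
    using Cons.prems(3) reorders_rest by auto
  have inj: "inj_on r (set w)" "inj_on r (set (names ?s N))" "inj_on r (set (ins n) \<union> set w)"
      "inj_on r (set ?s)"
    by (rule inj_on_subset[OF Cons.prems(2)], use i in \<open>auto simp: names_def\<close>)+
  have IH: "valid (map r ?s) (map (rename r) N) (map r out)"
     "sem (map r ?s) (map (rename r) N) (map r out) = sem ?s N out"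
    using Cons.IH[OF Cons.prems(1) inj(2)] Cons.prems(3) by auto
  have d: "distinct (map r w)" "distinct (map r (ins n))" "distinct (map r ?s)"
    using Cons.prems(3) inj by (auto simp only: valid.simps distinct_map intro: inj_on_subset)
  show ?case
    using IH perm_map[OF Cons.prems(1) inj(1) i(2)] rest_map[OF inj(3)] d i(1)
    by (auto simp: rename_simps obs_map[OF Cons.prems(1)])
qed

section \<open>Rewriting of wire diagrams\<close>

definition ren :: "('w \<times> 'w) list \<Rightarrow> 'w \<Rightarrow> 'w" where
  "ren xs a = (case map_of xs a of Some b \<Rightarrow> b | None \<Rightarrow> a)"

definition kind_preserving :: "('w \<times> 'w) list \<Rightarrow> bool" where
  "kind_preserving xs \<longleftrightarrow> list_all (\<lambda>(a, b). ob b = ob a) xs"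

lemma ob_ren: "kind_preserving xs \<Longrightarrow> ob (ren xs a) = ob a"
  by (auto simp: ren_def kind_preserving_def list_all_iff split: option.split dest!: map_of_SomeD)

text \<open>
  Equality of the values of two diagrams. The output wires may have different names on the two
  sides, so that for instance an identity wire can replace a node; only the objects carried by
  them have to agree.
\<close>

definition equivalent :: "'w list \<times> ('m, 'w) node list \<times> 'w list
    \<Rightarrow> 'w list \<times> ('m, 'w) node list \<times> 'w list \<Rightarrow> bool"
    (infix \<open>\<simeq>\<close> 50) where
  "D \<simeq> E \<longleftrightarrow> (case D of (w, N, out) \<Rightarrow> case E of (w', N', out') \<Rightarrow>
     w = w' \<and> well_formed w N out \<and> well_formed w N' out' \<and> typed N \<and> typed N' \<and>
     map ob out = map ob out' \<and> sem w N out = sem w N' out')"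

lemma equivalent_sym: "D \<simeq> E \<Longrightarrow> E \<simeq> D"
  by (auto simp: equivalent_def split: prod.splits)

lemma equivalent_trans [trans]: "D \<simeq> E \<Longrightarrow> E \<simeq> F \<Longrightarrow> D \<simeq> F"
  by (auto simp: equivalent_def split: prod.splits)

lemma typed_rename: "(\<And>a. ob (r a) = ob a) \<Longrightarrow> typed N \<Longrightarrow> typed (map (rename r) N)"
  by (induction N) (simp_all add: typed_node_def rename_simps obs_map)

lemma same_nodes_set: "same_nodes M N \<Longrightarrow> set M = set N"
proof (induction M arbitrary: N)
  case (Cons n M)
  then have "set M = set (remove1 n N)" "n \<in> set N" by auto
  moreover have "set N = insert n (set (remove1 n N))"
    using \<open>n \<in> set N\<close> by (induction N) auto
  ultimately show ?case by simp
qed simp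

text \<open>
  The nodes \<open>A\<close> come before the renamed left hand side, the nodes \<open>B\<close> after it. As the outputs
  of the two sides of the rule may be named differently, the names in \<open>B\<close> are adjusted by \<open>t\<close>.
\<close>

lemma sem_rewrite:
  assumes rule: "(wi, L, wo) \<simeq> (wi, R, wo')"
    and r: "\<And>a. ob (r a) = ob a" "distinct (map r (names wi L))" "distinct (map r (names wi R))"
    and t: "\<And>a. ob (t a) = ob a" "map t (map r wo) = map r wo'"
        "\<forall>x\<in>set (rest (map r wi) (state w A)). t x = x"
    and wi: "set (map r wi) \<subseteq> set (state w A)"
    and ty: "typed (A @ B)"
    and g: "well_formed w (A @ map (rename r) L @ B) out"
    and g': "well_formed w (A @ map (rename r) R @ map (rename t) B) (map t out)"
  shows "sem w (A @ map (rename r) L @ B) out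
       = sem w (A @ map (rename r) R @ map (rename t) B) (map t out)"
proof -
  let ?st = "state w A" and ?L = "map (rename r) L" and ?R = "map (rename r) R" and ?B
      = "map (rename t) B"
  let ?wi = "map r wi" and ?wo = "map r wo" and ?wo' = "map r wo'"
  let ?v = "rest ?wi ?st"
  have LR: "valid wi L wo" "valid wi R wo'" "typed L" "typed R" "sem wi L wo = sem wi R wo'"
    using rule by (auto simp: equivalent_def well_formed_def)
  have inj: "inj_on r (set (names wi L))" "inj_on r (set (names wi R))"
    using r(2,3) by (simp_all add: distinct_map)
  note rL = sem_rename[OF r(1) inj(1) LR(1)] and rR = sem_rename[OF r(1) inj(2) LR(2)]
  have ty': "typed A" "typed B" "typed ?L" "typed ?R" "typed ?B" "typed (?L @ B)" "typed (?R @ ?B)"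
    using ty LR typed_rename[OF r(1)] typed_rename[OF t(1)] by auto
  have aL: "valid ?st (?L @ B) out" "sem w (A @ ?L @ B) out = sem ?st (?L @ B) out \<cdot> sem w A ?st"
    using sem_append[of w A "?L @ B" out] g ty' by (auto simp: well_formed_def)
  have aR: "valid ?st (?R @ ?B) (map t out)"
    "sem w (A @ ?R @ ?B) (map t out) = sem ?st (?R @ ?B) (map t out) \<cdot> sem w A ?st"
    using sem_append[of w A "?R @ ?B" "map t out"] g' ty' by (auto simp: well_formed_def)
  have dwi: "distinct ?wi" using r(2) by (simp add: names_def)
  have ro: "reorders ?st (?wi @ ?v)"
    using reorders_rest[of ?st ?wi] valid_distinct[OF aL(1)] dwi wi by blast
  note fL = sem_frame[OF conjunct1[OF rL] valid_reorders[OF aL(1) ro] ty'(3,2)]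
  note fR = sem_frame[OF conjunct1[OF rR] valid_reorders[OF aR(1) ro] ty'(4,5)]
  have stn: "valid w N' out' \<Longrightarrow> set (state w N') \<subseteq> set (names w N')" for N' out' w
  proof (induction N' arbitrary: w)
    case (Cons n N')
    then have "set (state (outs n @ rest (ins n) w) N') \<subseteq> set (names (outs n @ rest (ins n) w) N')"
        by simp
    then show ?case by (auto simp: names_def)
  qed (simp add: names_def)
  have v_names: "set ?v \<subseteq> set (names w A)"
    using stn[of w A ?st] sem_append[of w A "?L @ B" out] g ty' by (auto simp: well_formed_def)
  have tv: "map t ?v = ?v" using t(3) by (intro map_idI) blast
  have d1: "distinct (?wo @ ?v)" using valid_distinct conjunct1[OF fL] by blast
  have d2: "distinct (?wo' @ ?v)" using valid_distinct conjunct1[OF fR] by blast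
  have nb: "set (concat (map outs B)) \<inter> set (?wo @ ?v) = {}" "distinct (concat (map outs B))"
  proof -
    have "set ?wo \<subseteq> set (names ?wi ?L)"
    proof -
      have "reorders (state ?wi ?L) ?wo"
        using sem_append[of ?wi ?L "[]" ?wo] conjunct1[OF rL] ty'(3) by simp
      then show ?thesis using stn[OF conjunct1[OF rL]] by (auto simp: reorders_def)
    qed
    then have "set ?wo \<subseteq> set (names w (A @ ?L))"
      using wi stn[of w A ?st] sem_append[of w A "?L @ B" out] g ty'
      by (auto simp: well_formed_def names_def)
    moreover have "set (names w A) \<subseteq> set (names w (A @ ?L))" by (auto simp: names_def)
    moreover have "distinct (names w (A @ ?L) @ concat (map outs B))"
      using g by (simp add: well_formed_def names_def)
    ultimately show "set (concat (map outs B)) \<inter> set (?wo @ ?v) = {}" "distinct (concat (map outs B))"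
      unfolding distinct_append set_append using v_names by blast+
  qed
  have nb': "set (concat (map outs ?B)) \<inter> set (?wo' @ ?v) = {}" "distinct (concat (map outs ?B))"
  proof -
    have "set ?wo' \<subseteq> set (names ?wi ?R)"
    proof -
      have "reorders (state ?wi ?R) ?wo'"
        using sem_append[of ?wi ?R "[]" ?wo'] conjunct1[OF rR] ty'(4) by simp
      then show ?thesis using stn[OF conjunct1[OF rR]] by (auto simp: reorders_def)
    qed
    then have "set ?wo' \<subseteq> set (names w (A @ ?R))"
      using wi stn[of w A ?st] sem_append[of w A "?L @ B" out] g ty'
      by (auto simp: well_formed_def names_def)
    moreover have "set (names w A) \<subseteq> set (names w (A @ ?R))" by (auto simp: names_def)
    moreover have "distinct (names w (A @ ?R) @ concat (map outs ?B))"
      using g' by (simp add: well_formed_def names_def)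
    ultimately show "set (concat (map outs ?B)) \<inter> set (?wo' @ ?v) = {}"
        "distinct (concat (map outs ?B))"
      unfolding distinct_append set_append using v_names by blast+
  qed
  have outsB: "concat (map outs ?B) = map t (concat (map outs B))"
    by (induction B) (simp_all add: rename_simps)
  have "distinct (map t (names (?wo @ ?v) B))"
  proof -
    have "map t (names (?wo @ ?v) B) = (?wo' @ ?v) @ concat (map outs ?B)"
      unfolding names_def map_append outsB tv t(2) by (rule refl)
    moreover have "distinct ((?wo' @ ?v) @ concat (map outs ?B))"
      using nb' d2 distinct_append[of "?wo' @ ?v"
          "concat (map outs ?B)"] by (simp only: Int_commute simp_thms)
    ultimately show ?thesis by (simp only:)
  qed
  then have "inj_on t (set (names (?wo @ ?v) B))" by (simp add: distinct_map)
  note tB = sem_rename[OF t(1) this conjunct1[OF fL]]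
  have "sem (?wo @ ?v) B out = sem (?wo' @ ?v) ?B (map t out)"
    using tB tv t(2) by simp
  then have "sem (?wi @ ?v) (?L @ B) out = sem (?wi @ ?v) (?R @ ?B) (map t out)"
    using fL fR rL rR LR(5) by simp
  then have "sem ?st (?L @ B) out = sem ?st (?R @ ?B) (map t out)"
    using sem_reorders[OF aL(1) ty'(6) ro] sem_reorders[OF aR(1) ty'(7) ro] by simp
  then show ?thesis using aL(2) aR(2) by simp
qed

definition wires :: "('m, 'w) node list \<Rightarrow> 'w list" where
  "wires N = concat (map (\<lambda>n. ins n @ outs n) N)"

text \<open>
  The side conditions of \<open>sem_rewrite\<close> for concrete lists, with the renamings given as
  association lists. Each predicate takes the results of the one before as arguments, so that
  a renaming is computed once and not at every place where it occurs.
\<close>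

definition fits_names where
  "fits_names rs ts w A B L wi wo R wo' \<longleftrightarrow> kind_preserving rs \<and> kind_preserving ts \<and>
     distinct (map (ren rs) (names wi L)) \<and> distinct (map (ren rs) (names wi R)) \<and>
     map (ren ts) (map (ren rs) wo) = map (ren rs) wo' \<and>
     list_all (\<lambda>x. ren ts x = x) (rest (map (ren rs) wi) (state w A)) \<and>
     list_all (\<lambda>x. x \<in> set (state w A)) (map (ren rs) wi)"

definition replaces where
  "replaces rs ts w N out A B L wi wo R wo' N' out' \<longleftrightarrow> fits_names rs ts w A B L wi wo R wo' \<and>
     N = A @ map (rename (ren rs)) L @ B \<and> map (ren ts) out = out' \<and> well_formed w N' out' \<and>
     well_formed w (A @ map (rename (ren rs)) R @ map (rename (ren ts)) B) out' \<and>
     same_nodes N' (A @ map (rename (ren rs)) R @ map (rename (ren ts)) B)"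

definition replaces_with where
  "replaces_with rs w N out n wi L wo R wo' N' out' \<longleftrightarrow>
     replaces rs (zip (map (ren rs) wo) (map (ren rs) wo')) w N out
       (take n N) (drop (n + length L) N) L wi wo R wo' N' out'"

text \<open>
  One application of a rule at position \<open>n\<close>. The renaming of the wires of the left hand side
  is read off by comparing its nodes with those found in \<open>N\<close>; \<open>new\<close> names the remaining wires
  of the rule, which are those that only occur on the right and those that bypass every node
  on the left.
\<close>

definition rewrite_step where
  "rewrite_step w N out n new wi L wo R wo' N' out' \<longleftrightarrow>
     replaces_with (new @ zip (wires L) (wires (take (length L) (drop n N)))) w N out n wi L wo R wo'
         N' out'"

lemmas rewrite_step_defs = rewrite_step_def replaces_with_def replaces_def fits_names_def

text \<open>
  Both diagrams are given explicitly, and all side conditions are computations with lists of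
  names. The nodes of the result may be listed in any order, so the next rewriting finds its
  left hand side as a contiguous sublist.
\<close>

lemma rewrite:
  assumes rule: "(wi, L, wo) \<simeq> (wi, R, wo')"
    and N: "well_formed w N out" "typed N"
    and rw: "rewrite_step w N out n new wi L wo R wo' N' out'"
  shows "(w, N, out) \<simeq> (w, N', out')"
proof -
  define r where "r = ren (new @ zip (wires L) (wires (take (length L) (drop n N))))"
  define t where "t = ren (zip (map r wo) (map r wo'))"
  define A where "A = take n N"
  define B where "B = drop (n + length L) N"
  define M where "M = A @ map (rename r) R @ map (rename t) B"
  have c: "\<And>a. ob (r a) = ob a" "\<And>a. ob (t a) = ob a"
    "distinct (map r (names wi L))" "distinct (map r (names wi R))"
    "map t (map r wo) = map r wo'" "N = A @ map (rename r) L @ B"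
    "list_all (\<lambda>x. t x = x) (rest (map r wi) (state w A))"
    "list_all (\<lambda>x. x \<in> set (state w A)) (map r wi)"
    "well_formed w M out'" "well_formed w N' out'" "map t out = out'" "same_nodes N' M"
    using rw unfolding rewrite_step_defs r_def t_def A_def B_def M_def by (blast intro: ob_ren)+
  have ty: "typed A" "typed B" "typed (map (rename r) R)" "typed (map (rename t) B)"
    using N(2) c(1,2,6) typed_rename[of r R] typed_rename[of t B] rule by (auto simp: equivalent_def)
  then have tM: "typed M" by (simp add: M_def)
  have "set (map r wi) \<subseteq> set (state w A)" "\<forall>x\<in>set (rest (map r wi) (state w A)). t x = x"
    using c(7,8) unfolding list_all_iff set_map by blast+
  then have "sem w (A @ map (rename r) L @ B) out
      = sem w (A @ map (rename r) R @ map (rename t) B) (map t out)"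
    using sem_rewrite[OF rule c(1,3,4,2,5)] ty(1,2) N(1) c(6,9,11) unfolding M_def by simp
  then have "sem w N out = sem w M out'" unfolding M_def using c(6,11) by simp
  also have "\<dots> = sem w N' out'" by (rule sem_same_nodes[OF c(9,10) tM c(12)])
  finally show ?thesis
    using N c same_nodes_set[OF c(12)] tM by (auto simp: equivalent_def list_all_iff)
qed

lemmas rewrite_back = rewrite[OF equivalent_sym]

lemma box_equivalent:
  assumes "well_formed w [(f, w, out)] out" "well_formed w N out" "typed N" "f = sem w N out"
  shows "(w, [(f, w, out)], out) \<simeq> (w, N, out)"
proof -
  note t = sem_typing[of w N out]
  have v: "valid w N out" "distinct w"
      "distinct out" using assms valid_distinct[of w N out] by (auto simp: well_formed_def)
  have r: "rest w w = []" by simp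
  have "sem w [(f, w, out)] out = f"
    unfolding sem.simps fst_conv snd_conv r append_Nil2 perm_refl
    using t[OF v(1) assms(3)] assms(4) by (simp add: wire_normal)
  moreover have "typed_node (f, w, out)"
    using t[OF v(1) assms(3)] assms(4) by (simp add: typed_node_def in_hom_def)
  ultimately show ?thesis using assms by (simp add: equivalent_def)
qed

lemma equivalent_typed: "(w, [n], out) \<simeq> E \<Longrightarrow> typed_node n"
  by (auto simp: equivalent_def)

end

section \<open>Planar composites as wire diagrams\<close>

text \<open>
  A layer is a node placed next to \<open>k\<close> untouched wires on its left, or the crossing of the
  wires at positions \<open>k\<close> and \<open>k + 1\<close>.
\<close>

datatype ('f, 'v) layer = At nat "('f, 'v) node" | Cross nat

fun nodes :: "('f, 'v) layer list \<Rightarrow> ('f, 'v) node list" where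
  "nodes [] = []"
| "nodes (At k n # Ls) = n # nodes Ls"
| "nodes (Cross k # Ls) = nodes Ls"

context symmetric_wires
begin

fun after :: "'w list \<Rightarrow> ('m, 'w) layer \<Rightarrow> 'w list" where
  "after w (At k n) = take k w @ outs n @ drop (k + length (ins n)) w"
| "after w (Cross k) = take k w @ [w ! Suc k, w ! k] @ drop (Suc (Suc k)) w"

fun fits :: "'w list \<Rightarrow> ('m, 'w) layer \<Rightarrow> bool" where
  "fits w (At k n) \<longleftrightarrow> take (length (ins n)) (drop k w) = ins n"
| "fits w (Cross k) \<longleftrightarrow> Suc k < length w"

fun layer_arrow :: "'w list \<Rightarrow> ('m, 'w) layer \<Rightarrow> 'm" where
  "layer_arrow w (At k n) =
    \<one> (obs (take k w)) \<otimes> box n \<otimes> \<one> (obs (drop (k + length (ins n)) w))"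
| "layer_arrow w (Cross k) =
    \<one> (obs (take k w)) \<otimes> \<beta> (ob (w ! k)) (ob (w ! Suc k)) \<otimes> \<one> (obs (drop (Suc (Suc k)) w))"

primrec planar :: "'w list \<Rightarrow> ('m, 'w) layer list \<Rightarrow> 'w list \<Rightarrow> bool" where
  "planar w [] out \<longleftrightarrow> w = out"
| "planar w (l # Ls) out \<longleftrightarrow> fits w l \<and> planar (after w l) Ls out"

primrec layered :: "'w list \<Rightarrow> ('m, 'w) layer list \<Rightarrow> 'm" where
  "layered w [] = \<one> (obs w)"
| "layered w (l # Ls) = layered (after w l) Ls \<cdot> layer_arrow w l"

text \<open>
  The bridge between diagrams and ordinary composites of arrows: crossings disappear from the
  list of nodes, and every other layer is a node evaluated in place.
\<close>

lemma sem_layered: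
  "planar w Ls out \<Longrightarrow> valid w (nodes Ls) out \<Longrightarrow> typed (nodes Ls) \<Longrightarrow> sem w (nodes Ls) out = layered w Ls"
proof (induction Ls arbitrary: w)
  case Nil
  then show ?case by (simp add: perm_refl)
next
  case (Cons l Ls)
  show ?case
  proof (cases l)
    case (At k n)
    let ?u = "take k w" and ?v = "drop (k + length (ins n)) w"
    have i: "take (length (ins n)) (drop k w) = ins n" using Cons.prems At by simp
    have w: "w = ?u @ ins n @ ?v"
      using append_take_drop_id[of k w] append_take_drop_id[of "length (ins n)" "drop k w"] i
      by (metis add.commute drop_drop)
    have v: "valid (?u @ ins n @ ?v) ((box n, ins n, outs n) # nodes Ls) out"
      using Cons.prems(2) At w by simp
    have t: "typed ((box n, ins n, outs n) # nodes Ls)" using Cons.prems(3) At by simp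
    have d: "distinct (?u @ ins n @ ?v)" using valid_distinct[OF v] by blast
    have "rest (ins n) ?u = ?u" "rest (ins n) ?v = ?v" by (rule rest_disjoint; use d in auto)+
    then have r: "rest (ins n) (?u @ ins n @ ?v) = ?u @ ?v" by simp
    then have v1: "valid (outs n @ ?u @ ?v) (nodes Ls) out"
      using v unfolding valid.simps(2) fst_conv snd_conv by metis
    have "valid (?u @ outs n @ ?v) (nodes Ls) out"
      by (rule valid_reorders[OF v1]) (use valid_distinct[OF v1] in \<open>auto simp: reorders_def\<close>)
    then have "sem (?u @ outs n @ ?v) (nodes Ls) out = layered (?u @ outs n @ ?v) Ls"
      using Cons.prems At by (intro Cons.IH) simp_all
    then show ?thesis
      using sem_layer[OF v t] w At by simp
  next
    case (Cross k)
    let ?u = "take k w" and ?v = "drop (Suc (Suc k)) w"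
    have k: "Suc k < length w" using Cons.prems Cross by simp
    then have w: "w = ?u @ w ! k # w ! Suc k # ?v"
      by (metis Cons_nth_drop_Suc Suc_lessD append_take_drop_id)
    have v: "valid (?u @ w ! k # w ! Suc k # ?v) (nodes Ls) out"
      using Cons.prems(2) Cross w by simp
    have t: "typed (nodes Ls)" using Cons.prems(3) Cross by simp
    have "valid (?u @ w ! Suc k # w ! k # ?v) (nodes Ls) out"
      by (rule valid_reorders[OF v]) (use valid_distinct[OF v] in \<open>auto simp: reorders_def\<close>)
    then have "sem (?u @ w ! Suc k # w ! k # ?v) (nodes Ls) out
        = layered (?u @ w ! Suc k # w ! k # ?v) Ls"
      using Cons.prems Cross by (intro Cons.IH) simp_all
    then show ?thesis
      using sem_braid[OF v t] w Cross by simp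
  qed
qed

lemma equivalent_layersI:
  assumes "planar w Ls out" "planar w Ls' out'" "well_formed w (nodes Ls) out"
      "well_formed w (nodes Ls') out'"
    "typed (nodes Ls)" "typed (nodes Ls')" "map ob out = map ob out'" "layered w Ls = layered w Ls'"
  shows "(w, nodes Ls, out) \<simeq> (w, nodes Ls', out')"
  using assms sem_layered[of w Ls out] sem_layered[of w Ls' out']
  by (simp add: equivalent_def well_formed_def)

lemma layered_eq:
  assumes D: "(w, N, out) \<simeq> (w, N', out')"
    and "well_formed w (nodes Ls) out" "same_nodes (nodes Ls) N" "planar w Ls out"
    and "well_formed w (nodes Ls') out'" "same_nodes (nodes Ls') N'" "planar w Ls' out'"
  shows "layered w Ls = layered w Ls'"
proof -
  have N: "well_formed w N out" "well_formed w N' out'" "typed N" "typed N'"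
      "sem w N out = sem w N' out'"
    using D by (simp_all add: equivalent_def)
  have "typed (nodes Ls)" "typed (nodes Ls')"
    using N same_nodes_set[OF assms(3)] same_nodes_set[OF assms(6)] by (auto simp: list_all_iff)
  then have "sem w (nodes Ls) out = layered w Ls" "sem w (nodes Ls') out' = layered w Ls'"
    using sem_layered assms by (auto simp: well_formed_def)
  then show ?thesis
    using N sem_same_nodes[OF N(1) assms(2) N(3) assms(3)] sem_same_nodes[OF N(2) assms(5) N(4)
        assms(6)]
    by simp
qed

end

section \<open>Finite Hopf algebras as wire diagrams\<close>

text \<open>
  From here on wires are numbered by integers. A positive wire carries \<open>H\<close>, all others its
  dual, so that \<open>Coev x (-x)\<close> starts a pair of dual strands.
\<close>

locale finite_hopf = strict_braided_tensor_category \<C>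
  for \<C> :: "('o, 'm) braided_category" (structure) +
  fixes H :: "('o, 'm) hopf_data" and D :: "('o, 'm) dual_data"
  assumes hopf: "hopf_algebra \<C> H"
    and dual: "left_dual \<C> (obj H) D"
    and involutive: "\<beta> (obj H) (obj H) \<cdot> \<beta> (obj H) (obj H) = \<one> (obj H \<odot> obj H)"
begin

definition wire :: "int \<Rightarrow> 'o" where
  "wire a = (if 0 < a then obj H else dual D)"

lemma wires_symmetric: "symmetric_wires \<C> wire"
proof -
  have O: "obj H \<in> Obj \<C>" "dual D \<in> Obj \<C>" using left_dualD[OF dual] by auto
  have HW: "\<beta> (dual D) (obj H) \<cdot> \<beta> (obj H) (dual D) = \<one> (obj H \<odot> dual D)"
    by (rule Braid_dual_symmetric[OF dual O(1) involutive])
  have WH: "\<beta> (obj H) (dual D) \<cdot> \<beta> (dual D) (obj H) = \<one> (dual D \<odot> obj H)"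
    by (rule Braid_cancel[of "dual D" "obj H"])
      (use HW O in \<open>simp_all add: normal Braid_typing flip: Comp_assoc'\<close>)
  have WW: "\<beta> (dual D) (dual D) \<cdot> \<beta> (dual D) (dual D) = \<one> (dual D \<odot> dual D)"
    by (rule Braid_dual_symmetric[OF dual O(2) HW])
  show ?thesis
    by unfold_locales (use O HW WH WW involutive in \<open>auto simp: wire_def\<close>)
qed

sublocale symmetric_wires \<C> wire
  by (rule wires_symmetric)

notation equivalent (infix \<open>\<simeq>\<close> 50)

abbreviation Mul where "Mul x y z \<equiv> (mult H, [x, y], [z :: int])"
abbreviation Unit where "Unit z \<equiv> (eta H, [] :: int list, [z])"
abbreviation Com where "Com x y z \<equiv> (comult H, [x], [y, z :: int])"
abbreviation Cou where "Cou x \<equiv> (counit H, [x :: int], [] :: int list)"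
abbreviation Ant where "Ant x y \<equiv> (antipode H, [x], [y :: int])"
abbreviation Ev where "Ev p x \<equiv> (ev D, [p, x :: int], [] :: int list)"
abbreviation Coev where "Coev x p \<equiv> (coev D, [] :: int list, [x, p :: int])"

lemma wire_simps [simp]: "0 < a \<Longrightarrow> wire a = obj H" "\<not> 0 < a \<Longrightarrow> wire a = dual D"
  by (simp_all add: wire_def)

lemma H_Obj: "obj H \<in> Obj \<C>" and W_Obj: "dual D \<in> Obj \<C>"
  using dual by (simp_all add: left_dual_def)

lemma H_typing:
  "mult H \<in> Arr \<C>" "Dom \<C> (mult H) = obj H \<odot> obj H" "Cod \<C> (mult H) = obj H"
  "eta H \<in> Arr \<C>" "Dom \<C> (eta H) = \<I>" "Cod \<C> (eta H) = obj H"
  "comult H \<in> Arr \<C>" "Dom \<C> (comult H) = obj H" "Cod \<C> (comult H) = obj H \<odot> obj H"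
  "counit H \<in> Arr \<C>" "Dom \<C> (counit H) = obj H" "Cod \<C> (counit H) = \<I>"
  "antipode H \<in> Arr \<C>" "Dom \<C> (antipode H) = obj H" "Cod \<C> (antipode H) = obj H"
  "ev D \<in> Arr \<C>" "coev D \<in> Arr \<C>"
  "Dom \<C> (ev D) = dual D \<odot> obj H" "Cod \<C> (ev D) = \<I>" "Dom \<C> (coev D) = \<I>"
      "Cod \<C> (coev D) = obj H \<odot> dual D"
  using hopf left_dualD[OF dual]
  by (simp_all add: hopf_algebra_def bialgebra_def algebra_def coalgebra_def in_hom_def)

lemmas H_normal = wire_normal H_Obj W_Obj H_typing

lemma typed_nodes [simp]:
  "0 < x \<Longrightarrow> 0 < y \<Longrightarrow> 0 < z \<Longrightarrow> typed_node (Mul x y z)"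
  "0 < z \<Longrightarrow> typed_node (Unit z)"
  "0 < x \<Longrightarrow> 0 < y \<Longrightarrow> 0 < z \<Longrightarrow> typed_node (Com x y z)"
  "0 < x \<Longrightarrow> typed_node (Cou x)"
  "0 < x \<Longrightarrow> 0 < y \<Longrightarrow> typed_node (Ant x y)"
  "p < 0 \<Longrightarrow> 0 < x \<Longrightarrow> typed_node (Ev p x)"
  "0 < x \<Longrightarrow> p < 0 \<Longrightarrow> typed_node (Coev x p)"
  by (simp_all add: typed_node_def in_hom_def H_normal)

lemma hopf_axioms:
  "mult H \<cdot> (mult H \<otimes> \<one> (obj H)) = mult H \<cdot> (\<one> (obj H) \<otimes> mult H)"
  "mult H \<cdot> (eta H \<otimes> \<one> (obj H)) = \<one> (obj H)"
  "mult H \<cdot> (\<one> (obj H) \<otimes> eta H) = \<one> (obj H)"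
  "(comult H \<otimes> \<one> (obj H)) \<cdot> comult H = (\<one> (obj H) \<otimes> comult H) \<cdot> comult H"
  "(counit H \<otimes> \<one> (obj H)) \<cdot> comult H = \<one> (obj H)"
  "(\<one> (obj H) \<otimes> counit H) \<cdot> comult H = \<one> (obj H)"
  "comult H \<cdot> eta H = (\<one> (obj H) \<otimes> eta H) \<cdot> eta H"
  "counit H \<cdot> mult H = counit H \<cdot> (counit H \<otimes> \<one> (obj H))"
  "counit H \<cdot> eta H = \<one> \<I>"
  "mult H \<cdot> ((antipode H \<otimes> \<one> (obj H)) \<cdot> comult H) = eta H \<cdot> counit H"
  "mult H \<cdot> ((\<one> (obj H) \<otimes> antipode H) \<cdot> comult H) = eta H \<cdot> counit H"
  using hopf unfolding hopf_algebra_def bialgebra_def algebra_def coalgebra_def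
    algebra_hom_def tensor_algebra_def unit_algebra_def
  using interchange[of "eta H" "\<one> (obj H)" "\<one> \<I>" "eta H"]
    interchange[of "counit H" "\<one> \<I>" "\<one> (obj H)" "counit H"]
  by (simp_all add: H_normal)

lemma comult_mult: "comult H \<cdot> mult H =
    (\<one> (obj H) \<otimes> mult H) \<cdot> ((mult H \<otimes> \<one> (obj H \<odot> obj H)) \<cdot>
      ((\<one> (obj H) \<otimes> \<beta> (obj H) (obj H) \<otimes> \<one> (obj H)) \<cdot>
        ((\<one> (obj H \<odot> obj H) \<otimes> comult H) \<cdot> (comult H \<otimes> \<one> (obj H)))))"
proof -
  have "comult H \<cdot> mult H = (mult H \<otimes> mult H) \<cdot> ((\<one> (obj H) \<otimes> \<beta> (obj H) (obj H) \<otimes> \<one> (obj H))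
     \<cdot> (comult H \<otimes> comult H))"
    using hopf unfolding hopf_algebra_def bialgebra_def algebra_hom_def tensor_algebra_def
    by (simp add: H_normal)
  also have "mult H \<otimes> mult H = (\<one> (obj H) \<otimes> mult H) \<cdot> (mult H \<otimes> \<one> (obj H \<odot> obj H))"
    by (simp add: H_normal interchange)
  also have "comult H \<otimes> comult H = (\<one> (obj H \<odot> obj H) \<otimes> comult H) \<cdot> (comult H \<otimes> \<one> (obj H))"
    by (simp add: H_normal interchange)
  finally show ?thesis by (simp add: H_normal)
qed

lemmas checks = well_formed_def names_def reorders_check rename_def ren_def kind_preserving_def
  rewrite_step_defs wires_def

lemmas layers = checks H_normal left_dualD(9,10)[OF dual]

text \<open>
  The axioms of a Hopf algebra and of a left dual as equivalences of diagrams. A node is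
  written with its input wires followed by its output wires, so \<open>Mul 1 2 3\<close> reads
  \<open>x\<^sub>3 = x\<^sub>1 x\<^sub>2\<close> and \<open>Com 1 2 3\<close> splits wire 1 into its coproduct on wires 2 and 3. In the
  names of the equivalences the map that is applied last comes first.
\<close>

lemma Mul_assoc: "([1, 2, 3], [Mul 1 2 4, Mul 4 3 5], [5]) \<simeq> ([1, 2, 3], [Mul 2 3 4, Mul 1 4 5], [5])"
proof -
  have "([1, 2, 3], nodes [At 0 (Mul 1 2 4), At 0 (Mul 4 3 5)], [5])
      \<simeq> ([1, 2, 3], nodes [At 1 (Mul 2 3 4), At 0 (Mul 1 4 5)], [5])"
    by (rule equivalent_layersI) (simp_all add: layers hopf_axioms)
  then show ?thesis by simp
qed

lemma Unit_left: "([1], [Unit 2, Mul 2 1 3], [3]) \<simeq> ([1], [], [1])"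
proof -
  have "([1], nodes [At 0 (Unit 2), At 0 (Mul 2 1 3)], [3])
      \<simeq> ([1], nodes [], [1])"
    by (rule equivalent_layersI) (simp_all add: layers hopf_axioms)
  then show ?thesis by simp
qed

lemma Unit_right: "([1], [Unit 2, Mul 1 2 3], [3]) \<simeq> ([1], [], [1])"
proof -
  have "([1], nodes [At 1 (Unit 2), At 0 (Mul 1 2 3)], [3])
      \<simeq> ([1], nodes [], [1])"
    by (rule equivalent_layersI) (simp_all add: layers hopf_axioms)
  then show ?thesis by simp
qed

lemma Com_assoc: "([1], [Com 1 2 3, Com 2 4 5], [4, 5, 3]) \<simeq> ([1], [Com 1 4 6, Com 6 5 3], [4, 5, 3])"
proof -
  have "([1], nodes [At 0 (Com 1 2 3), At 0 (Com 2 4 5)], [4, 5, 3])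
      \<simeq> ([1], nodes [At 0 (Com 1 4 6), At 1 (Com 6 5 3)], [4, 5, 3])"
    by (rule equivalent_layersI) (simp_all add: layers hopf_axioms)
  then show ?thesis by simp
qed

lemma Cou_left: "([1], [Com 1 2 3, Cou 2], [3]) \<simeq> ([1], [], [1])"
proof -
  have "([1], nodes [At 0 (Com 1 2 3), At 0 (Cou 2)], [3])
      \<simeq> ([1], nodes [], [1])"
    by (rule equivalent_layersI) (simp_all add: layers hopf_axioms)
  then show ?thesis by simp
qed

lemma Cou_right: "([1], [Com 1 2 3, Cou 3], [2]) \<simeq> ([1], [], [1])"
proof -
  have "([1], nodes [At 0 (Com 1 2 3), At 1 (Cou 3)], [2])
      \<simeq> ([1], nodes [], [1])"
    by (rule equivalent_layersI) (simp_all add: layers hopf_axioms)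
  then show ?thesis by simp
qed

lemma Com_Mul: "([1, 2], [Mul 1 2 3, Com 3 4 5], [4, 5]) \<simeq>
    ([1, 2], [Com 1 6 7, Com 2 8 9, Mul 6 8 4, Mul 7 9 5], [4, 5])"
proof -
  have "([1, 2], nodes [At 0 (Mul 1 2 3), At 0 (Com 3 4 5)], [4, 5])
      \<simeq> ([1, 2], nodes [At 0 (Com 1 6 7), At 2 (Com 2 8 9), Cross 1, At 0 (Mul 6 8 4),
          At 1 (Mul 7 9 5)], [4, 5])"
    by (rule equivalent_layersI) (simp_all add: layers comult_mult)
  then show ?thesis by simp
qed

lemma Cou_Mul: "([1, 2], [Mul 1 2 3, Cou 3], []) \<simeq> ([1, 2], [Cou 1, Cou 2], [])"
proof -
  have "([1, 2], nodes [At 0 (Mul 1 2 3), At 0 (Cou 3)], [])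
      \<simeq> ([1, 2], nodes [At 0 (Cou 1), At 0 (Cou 2)], [])"
    by (rule equivalent_layersI) (simp_all add: layers hopf_axioms)
  then show ?thesis by simp
qed

lemma Com_Unit: "([], [Unit 1, Com 1 2 3], [2, 3]) \<simeq> ([], [Unit 2, Unit 3], [2, 3])"
proof -
  have "([], nodes [At 0 (Unit 1), At 0 (Com 1 2 3)], [2, 3])
      \<simeq> ([], nodes [At 0 (Unit 2), At 1 (Unit 3)], [2, 3])"
    by (rule equivalent_layersI) (simp_all add: layers hopf_axioms)
  then show ?thesis by simp
qed

lemma Cou_Unit: "([], [Unit 1, Cou 1], []) \<simeq> ([], [], [])"
proof -
  have "([], nodes [At 0 (Unit 1), At 0 (Cou 1)], [])
      \<simeq> ([], nodes [], [])"
    by (rule equivalent_layersI) (simp_all add: layers hopf_axioms)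
  then show ?thesis by simp
qed

lemma Ant_left: "([1], [Com 1 2 3, Ant 2 4, Mul 4 3 5], [5]) \<simeq> ([1], [Cou 1, Unit 5], [5])"
proof -
  have "([1], nodes [At 0 (Com 1 2 3), At 0 (Ant 2 4), At 0 (Mul 4 3 5)], [5])
      \<simeq> ([1], nodes [At 0 (Cou 1), At 0 (Unit 5)], [5])"
    by (rule equivalent_layersI) (simp_all add: layers hopf_axioms)
  then show ?thesis by simp
qed

lemma Ant_right: "([1], [Com 1 2 3, Ant 3 4, Mul 2 4 5], [5]) \<simeq> ([1], [Cou 1, Unit 5], [5])"
proof -
  have "([1], nodes [At 0 (Com 1 2 3), At 1 (Ant 3 4), At 0 (Mul 2 4 5)], [5])
      \<simeq> ([1], nodes [At 0 (Cou 1), At 0 (Unit 5)], [5])"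
    by (rule equivalent_layersI) (simp_all add: layers hopf_axioms)
  then show ?thesis by simp
qed

text \<open>
  The two snake identities. Used backwards and then forwards at another place, they also slide
  a node around a closed loop.
\<close>

lemma Zig: "([1], [Coev 2 (-3), Ev (-3) 1], [2]) \<simeq> ([1], [], [1])"
proof -
  have "([1], nodes [At 0 (Coev 2 (-3)), At 1 (Ev (-3) 1)], [2])
      \<simeq> ([1], nodes [], [1])"
    by (rule equivalent_layersI) (simp_all add: layers hopf_axioms)
  then show ?thesis by simp
qed

lemma Zag: "([-1], [Coev 2 (-3), Ev (-1) 2], [-3]) \<simeq> ([-1], [], [-1])"
proof -
  have "([-1], nodes [At 1 (Coev 2 (-3)), At 0 (Ev (-1) 2)], [-3])
      \<simeq> ([-1], nodes [], [-1])"
    by (rule equivalent_layersI) (simp_all add: layers hopf_axioms)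
  then show ?thesis by simp
qed

section \<open>The antipode reverses products and coproducts\<close>

text \<open>
  \<open>S(1) = S(1) 1\<close>, and the coproduct of \<open>1\<close> is \<open>1 \<otimes> 1\<close>.
\<close>

lemma Ant_Unit:
  "([], [Unit 1, Ant 1 2], [2]) \<simeq>
    ([], [Unit 4], [4])"
proof -
  have "([], [Unit 1, Ant 1 2], [2]) \<simeq>
      ([], [Unit 1, Unit 3, Ant 1 2, Mul 2 3 4], [4])"
    by (rule rewrite_back[OF Unit_right,
        where n = 2 and new = "[(1, 2), (2, 3), (3, 4)]"]) (simp_all add: checks)
  also have "\<dots> \<simeq> ([], [Unit 5, Com 5 1 3, Ant 1 2, Mul 2 3 4], [4])"
    by (rule rewrite_back[OF Com_Unit, where n = 0 and new = "[(1, 5)]"]) (simp_all add: checks)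
  also have "\<dots> \<simeq> ([], [Unit 5, Cou 5, Unit 4], [4])"
    by (rule rewrite[OF Ant_left, where n = 1 and new = "[]"]) (simp_all add: checks)
  also have "\<dots> \<simeq> ([], [Unit 4], [4])"
    by (rule rewrite[OF Cou_Unit, where n = 0 and new = "[]"]) (simp_all add: checks)
  finally show ?thesis .
qed

text \<open>
  \<open>\<epsilon>(S(x)) = \<Sum> \<epsilon>(S(x\<^sub>1)) \<epsilon>(x\<^sub>2) = \<Sum> \<epsilon>(S(x\<^sub>1) x\<^sub>2)\<close>.
\<close>

lemma Cou_Ant:
  "([1], [Ant 1 2, Cou 2], []) \<simeq>
    ([1], [Cou 1], [])"
proof -
  have "([1], [Ant 1 2, Cou 2], []) \<simeq>
      ([1], [Com 1 3 4, Ant 3 2, Cou 2, Cou 4], [])"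
    by (rule rewrite_back[OF Cou_right,
        where n = 0 and new = "[(2, 3), (3, 4)]"]) (simp_all add: checks)
  also have "\<dots> \<simeq> ([1], [Com 1 3 4, Ant 3 2, Mul 2 4 5, Cou 5], [])"
    by (rule rewrite_back[OF Cou_Mul, where n = 2 and new = "[(3, 5)]"]) (simp_all add: checks)
  also have "\<dots> \<simeq> ([1], [Unit 5, Cou 5, Cou 1], [])"
    by (rule rewrite[OF Ant_left, where n = 0 and new = "[]"]) (simp_all add: checks)
  also have "\<dots> \<simeq> ([1], [Cou 1], [])"
    by (rule rewrite[OF Cou_Unit, where n = 0 and new = "[]"]) (simp_all add: checks)
  finally show ?thesis .
qed

text \<open>
  \<open>S(x y) = \<Sum> S(x\<^sub>1 y\<^sub>1) x\<^sub>2 y\<^sub>2 S(y\<^sub>3) S(x\<^sub>3) = S(y) S(x)\<close>: both are convolution inverse to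
  the product.
\<close>

lemma Ant_Mul:
  "([1, 2], [Mul 1 2 3, Ant 3 4], [4]) \<simeq>
    ([1, 2], [Ant 2 18, Ant 1 13, Mul 18 13 15], [15])"
proof -
  have "([1, 2], [Mul 1 2 3, Ant 3 4], [4]) \<simeq>
      ([1, 2], [Com 1 5 6, Cou 6, Mul 5 2 3, Ant 3 4], [4])"
    by (rule rewrite_back[OF Cou_right,
        where n = 0 and new = "[(2, 5), (3, 6)]"]) (simp_all add: checks)
  also have "\<dots> \<simeq> ([1, 2], [Com 2 7 8, Com 1 5 6, Mul 5 7 3, Ant 3 4, Cou 8, Cou 6], [4])"
    by (rule rewrite_back[OF Cou_right,
        where n = 0 and new = "[(1, 2), (2, 7), (3, 8)]"]) (simp_all add: checks)
  also have "\<dots> \<simeq> ([1, 2], [Com 1 5 6, Cou 6, Unit 9, Com 2 7 8, Mul 5 7 3, Ant 3 4, Mul 4 9 10,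
      Cou 8], [10])"
    by (rule rewrite_back[OF Unit_right,
        where n = 4 and new = "[(1, 4), (2, 9), (3, 10)]"]) (simp_all add: checks)
  also have "\<dots> \<simeq> ([1, 2], [Com 1 5 6, Com 6 11 12, Ant 12 13, Mul 11 13 9, Com 2 7 8, Mul 5 7 3,
      Ant 3 4, Mul 4 9 10, Cou 8], [10])"
    by (rule rewrite_back[OF Ant_right,
        where n = 1 and new = "[(2, 11), (3, 12), (4, 13)]"]) (simp_all add: checks)
  also have "\<dots> \<simeq> ([1, 2], [Com 2 7 8, Cou 8, Unit 14, Com 1 5 6, Com 6 11 12, Mul 11 14 15,
      Ant 12 13, Mul 15 13 9, Mul 5 7 3, Ant 3 4, Mul 4 9 10], [10])"
    by (rule rewrite_back[OF Unit_right,
        where n = 2 and new = "[(1, 11), (2, 14), (3, 15)]"]) (simp_all add: checks)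
  also have "\<dots> \<simeq> ([1, 2], [Com 1 5 6, Com 6 11 12, Com 2 7 8, Com 8 16 17, Ant 17 18,
      Mul 16 18 14, Mul 11 14 15, Ant 12 13, Mul 15 13 9, Mul 5 7 3, Ant 3 4, Mul 4 9 10], [10])"
    by (rule rewrite_back[OF Ant_right,
        where n = 1 and new = "[(2, 16), (3, 17), (4, 18)]"]) (simp_all add: checks)
  also have "\<dots> \<simeq> ([1, 2], [Com 2 7 8, Com 8 16 17, Com 1 19 12, Com 19 5 11, Ant 17 18,
      Mul 16 18 14, Mul 11 14 15, Ant 12 13, Mul 15 13 9, Mul 5 7 3, Ant 3 4, Mul 4 9 10], [10])"
    by (rule rewrite_back[OF Com_assoc, where n = 0 and new = "[(2, 19)]"]) (simp_all add: checks)
  also have "\<dots> \<simeq> ([1, 2], [Com 2 6 17, Com 6 7 16, Com 1 19 12, Com 19 5 11, Ant 17 18,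
      Mul 16 18 14, Mul 11 14 15, Ant 12 13, Mul 15 13 9, Mul 5 7 3, Ant 3 4, Mul 4 9 10], [10])"
    by (rule rewrite_back[OF Com_assoc, where n = 0 and new = "[(2, 6)]"]) (simp_all add: checks)
  also have "\<dots> \<simeq> ([1, 2], [Com 2 6 17, Com 6 7 16, Com 1 19 12, Com 19 5 11, Ant 17 18,
      Mul 11 16 14, Ant 12 13, Mul 14 18 15, Mul 15 13 9, Mul 5 7 3, Ant 3 4, Mul 4 9 10], [10])"
    by (rule rewrite_back[OF Mul_assoc, where n = 5 and new = "[]"]) (simp_all add: checks)
  also have "\<dots> \<simeq> ([1, 2], [Com 2 6 17, Com 6 7 16, Com 1 19 12, Com 19 5 11, Ant 17 18,
      Mul 11 16 14, Ant 12 13, Mul 18 13 15, Mul 5 7 3, Ant 3 4, Mul 14 15 9, Mul 4 9 10], [10])"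
    by (rule rewrite[OF Mul_assoc, where n = 7 and new = "[]"]) (simp_all add: checks)
  also have "\<dots> \<simeq> ([1, 2], [Com 2 6 17, Com 1 19 12, Com 19 5 11, Com 6 7 16, Mul 5 7 3,
      Mul 11 16 14, Ant 17 18, Ant 12 13, Mul 18 13 15, Ant 3 4, Mul 4 14 9, Mul 9 15 10], [10])"
    by (rule rewrite_back[OF Mul_assoc, where n = 10 and new = "[]"]) (simp_all add: checks)
  also have "\<dots> \<simeq> ([1, 2], [Com 2 6 17, Com 1 19 12, Mul 19 6 8, Com 8 3 14, Ant 3 4, Mul 4 14 9,
      Ant 17 18, Ant 12 13, Mul 18 13 15, Mul 9 15 10], [10])"
    by (rule rewrite_back[OF Com_Mul, where n = 2 and new = "[(3, 8)]"]) (simp_all add: checks)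
  also have "\<dots> \<simeq> ([1, 2], [Com 2 6 17, Com 1 19 12, Mul 19 6 8, Cou 8, Unit 9, Ant 17 18,
      Ant 12 13, Mul 18 13 15, Mul 9 15 10], [10])"
    by (rule rewrite[OF Ant_left, where n = 3 and new = "[]"]) (simp_all add: checks)
  also have "\<dots> \<simeq> ([1, 2], [Com 1 19 12, Cou 19, Com 2 6 17, Cou 6, Unit 9, Ant 17 18, Ant 12 13,
      Mul 18 13 15, Mul 9 15 10], [10])"
    by (rule rewrite[OF Cou_Mul, where n = 2 and new = "[]"]) (simp_all add: checks)
  also have "\<dots> \<simeq> ([1, 2], [Com 2 6 17, Cou 6, Unit 9, Ant 17 18, Ant 1 13, Mul 18 13 15,
      Mul 9 15 10], [10])"
    by (rule rewrite[OF Cou_left, where n = 0 and new = "[]"]) (simp_all add: checks)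
  also have "\<dots> \<simeq> ([1, 2], [Ant 2 18, Ant 1 13, Mul 18 13 15, Unit 9, Mul 9 15 10], [10])"
    by (rule rewrite[OF Cou_left, where n = 0 and new = "[]"]) (simp_all add: checks)
  also have "\<dots> \<simeq> ([1, 2], [Ant 2 18, Ant 1 13, Mul 18 13 15], [15])"
    by (rule rewrite[OF Unit_left, where n = 3 and new = "[]"]) (simp_all add: checks)
  finally show ?thesis .
qed

text \<open>
  The dual computation: both sides are convolution inverse to the coproduct, so \<open>\<Delta>(S(x))\<close> is
  extended by \<open>(x\<^sub>2 \<otimes> x\<^sub>3) (S(x\<^sub>5) \<otimes> S(x\<^sub>4))\<close>, which is trivial.
\<close>

lemma Com_Ant:
  "([1], [Ant 1 2, Com 2 3 4], [3, 4]) \<simeq>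
    ([1], [Com 1 17 12, Ant 17 18, Ant 12 13], [13, 18])"
proof -
  have "([1], [Ant 1 2, Com 2 3 4], [3, 4]) \<simeq>
      ([1], [Ant 1 2, Com 2 3 4, Unit 5, Mul 3 5 6], [6, 4])"
    by (rule rewrite_back[OF Unit_right,
        where n = 2 and new = "[(1, 3), (2, 5), (3, 6)]"]) (simp_all add: checks)
  also have "\<dots> \<simeq> ([1], [Ant 1 2, Com 2 3 4, Unit 7, Mul 4 7 8, Unit 5, Mul 3 5 6], [6, 8])"
    by (rule rewrite_back[OF Unit_right,
        where n = 2 and new = "[(1, 4), (2, 7), (3, 8)]"]) (simp_all add: checks)
  also have "\<dots> \<simeq> ([1], [Com 1 9 10, Cou 10, Unit 5, Ant 9 2, Com 2 3 4, Unit 7, Mul 4 7 8,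
      Mul 3 5 6], [6, 8])"
    by (rule rewrite_back[OF Cou_right,
        where n = 0 and new = "[(2, 9), (3, 10)]"]) (simp_all add: checks)
  also have "\<dots> \<simeq> ([1], [Com 1 9 10, Com 10 11 12, Ant 12 13, Mul 11 13 5, Ant 9 2, Com 2 3 4,
      Unit 7, Mul 4 7 8, Mul 3 5 6], [6, 8])"
    by (rule rewrite_back[OF Ant_right,
        where n = 1 and new = "[(2, 11), (3, 12), (4, 13)]"]) (simp_all add: checks)
  also have "\<dots> \<simeq> ([1], [Com 1 9 10, Com 10 11 12, Com 11 14 15, Cou 15, Unit 7, Ant 12 13,
      Mul 14 13 5, Ant 9 2, Com 2 3 4, Mul 4 7 8, Mul 3 5 6], [6, 8])"
    by (rule rewrite_back[OF Cou_right,
        where n = 2 and new = "[(1, 11), (2, 14), (3, 15)]"]) (simp_all add: checks)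
  also have "\<dots> \<simeq> ([1], [Com 1 9 10, Com 10 11 12, Com 11 14 15, Ant 12 13, Ant 9 2, Com 2 3 4,
      Mul 14 13 5, Mul 3 5 6, Com 15 16 17, Ant 17 18, Mul 16 18 7, Mul 4 7 8], [6, 8])"
    by (rule rewrite_back[OF Ant_right,
        where n = 3 and new = "[(2, 16), (3, 17), (4, 18)]"]) (simp_all add: checks)
  also have "\<dots> \<simeq> ([1], [Com 1 9 10, Com 10 11 12, Com 11 14 15, Ant 9 2, Com 2 3 4, Com 15 16 17,
      Ant 17 18, Mul 16 18 7, Mul 4 7 8, Ant 12 13, Mul 3 14 5, Mul 5 13 6], [6, 8])"
    by (rule rewrite_back[OF Mul_assoc, where n = 6 and new = "[]"]) (simp_all add: checks)
  also have "\<dots> \<simeq> ([1], [Com 1 9 10, Com 10 11 12, Com 11 14 15, Com 15 16 17, Ant 9 2, Com 2 3 4,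
      Ant 17 18, Mul 4 16 7, Mul 7 18 8, Ant 12 13, Mul 3 14 5, Mul 5 13 6], [6, 8])"
    by (rule rewrite_back[OF Mul_assoc, where n = 7 and new = "[]"]) (simp_all add: checks)
  also have "\<dots> \<simeq> ([1], [Com 1 9 10, Com 10 11 12, Com 11 19 17, Ant 9 2, Com 2 3 4, Com 19 14 16,
      Mul 3 14 5, Mul 4 16 7, Ant 17 18, Mul 7 18 8, Ant 12 13, Mul 5 13 6], [6, 8])"
    by (rule rewrite_back[OF Com_assoc, where n = 2 and new = "[(2, 19)]"]) (simp_all add: checks)
  also have "\<dots> \<simeq> ([1], [Com 1 9 10, Com 10 11 12, Com 11 19 17, Ant 9 2, Mul 2 19 15, Com 15 5 7,
      Ant 17 18, Mul 7 18 8, Ant 12 13, Mul 5 13 6], [6, 8])"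
    by (rule rewrite_back[OF Com_Mul, where n = 4 and new = "[(3, 15)]"]) (simp_all add: checks)
  also have "\<dots> \<simeq> ([1], [Com 1 9 10, Com 10 19 3, Com 3 17 12, Ant 9 2, Mul 2 19 15, Com 15 5 7,
      Ant 17 18, Mul 7 18 8, Ant 12 13, Mul 5 13 6], [6, 8])"
    by (rule rewrite[OF Com_assoc, where n = 1 and new = "[(6, 3)]"]) (simp_all add: checks)
  also have "\<dots> \<simeq> ([1], [Com 1 4 3, Com 4 9 19, Ant 9 2, Mul 2 19 15, Com 3 17 12, Com 15 5 7,
      Ant 17 18, Mul 7 18 8, Ant 12 13, Mul 5 13 6], [6, 8])"
    by (rule rewrite_back[OF Com_assoc, where n = 0 and new = "[(2, 4)]"]) (simp_all add: checks)
  also have "\<dots> \<simeq> ([1], [Com 1 4 3, Cou 4, Unit 15, Com 3 17 12, Com 15 5 7, Ant 17 18, Mul 7 18 8,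
      Ant 12 13, Mul 5 13 6], [6, 8])"
    by (rule rewrite[OF Ant_left, where n = 1 and new = "[]"]) (simp_all add: checks)
  also have "\<dots> \<simeq> ([1], [Unit 15, Com 15 5 7, Com 1 17 12, Ant 17 18, Mul 7 18 8, Ant 12 13,
      Mul 5 13 6], [6, 8])"
    by (rule rewrite[OF Cou_left, where n = 0 and new = "[]"]) (simp_all add: checks)
  also have "\<dots> \<simeq> ([1], [Com 1 17 12, Ant 12 13, Unit 5, Mul 5 13 6, Unit 7, Ant 17 18,
      Mul 7 18 8], [6, 8])"
    by (rule rewrite[OF Com_Unit, where n = 0 and new = "[]"]) (simp_all add: checks)
  also have "\<dots> \<simeq> ([1], [Com 1 17 12, Ant 17 18, Unit 7, Mul 7 18 8, Ant 12 13], [13, 8])"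
    by (rule rewrite[OF Unit_left, where n = 2 and new = "[]"]) (simp_all add: checks)
  also have "\<dots> \<simeq> ([1], [Com 1 17 12, Ant 17 18, Ant 12 13], [13, 18])"
    by (rule rewrite[OF Unit_left, where n = 2 and new = "[]"]) (simp_all add: checks)
  finally show ?thesis .
qed

section \<open>Integrals and the inverse of the antipode\<close>

text \<open>
  The map \<open>K x = \<Sum> e\<^sup>i(z\<^sub>1) z\<^sub>2\<close> with \<open>z = x S\<^sup>2(e\<^sub>i)\<close>. It is the transpose of the projection
  of the Hopf module \<open>H\<^sup>*\<close> onto its coinvariants; for vector spaces it is \<open>x \<mapsto> \<lambda>(x) \<Lambda>\<close> with a
  right integral \<open>\<Lambda>\<close> in \<open>H\<close> and an integral \<open>\<lambda>\<close> on \<open>H\<close>. The two antipodes compensate for the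
  reversal of factors around the loop.
\<close>

definition integral_proj :: 'm where
  "integral_proj = sem [1] [Coev 3 (-3), Ant 3 4, Ant 4 5, Mul 1 5 6, Com 6 7 2, Ev (-3) 7] [2]"

abbreviation Prj where "Prj x y \<equiv> (integral_proj, [x], [y :: int])"

lemma Prj_diagram: "([1], [Prj 1 2], [2]) \<simeq>
    ([1], [Coev 3 (-3), Ant 3 4, Ant 4 5, Mul 1 5 6, Com 6 7 2, Ev (-3) 7], [2])"
  by (rule box_equivalent) (simp_all add: checks integral_proj_def)

lemma typed_Prj [simp]: "0 < x \<Longrightarrow> 0 < y \<Longrightarrow> typed_node (Prj x y)"
  using equivalent_typed[OF Prj_diagram] by (simp add: typed_node_def)

text \<open>
  The identity \<open>K(x) y = \<epsilon>(y) K(x)\<close>, from right to left. Insert \<open>\<epsilon>(y) = \<Sum> S(y\<^sub>1) y\<^sub>2\<close> behind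
  \<open>S\<^sup>2(e\<^sub>i)\<close> and take the coproduct of \<open>x S\<^sup>2(e\<^sub>i) S(y\<^sub>1) y\<^sub>2\<close>. Its last factors are
  \<open>y\<^sub>2 \<otimes> y\<^sub>3\<close>. Carried around the loop, \<open>y\<^sub>2\<close> turns \<open>S\<^sup>2(e\<^sub>i) S(y\<^sub>1)\<close> into \<open>S\<^sup>2(e\<^sub>i y\<^sub>2)
  S(y\<^sub>1) = S\<^sup>2(e\<^sub>i) S(y\<^sub>1 S(y\<^sub>2))\<close>, so only the factor \<open>y\<close> of the output is left.
\<close>

lemma Prj_right_integral:
  "([1, 2], [Prj 1 3, Cou 2], [3]) \<simeq>
    ([1, 2], [Prj 1 15, Mul 15 2 3], [3])"
proof -
  have "([1, 2], [Prj 1 3, Cou 2], [3]) \<simeq>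
      ([1, 2], [Coev 4 (-4), Ant 4 5, Ant 5 6, Mul 1 6 7, Com 7 8 3, Ev (-4) 8, Cou 2], [3])"
    by (rule rewrite[OF Prj_diagram,
        where n = 0 and new = "[(3, 4), (-3, -4), (4, 5), (5, 6), (6, 7), (7, 8)]"]) (simp_all
            add: checks)
  also have "\<dots> \<simeq> ([1, 2], [Cou 2, Unit 9, Coev 4 (-4), Ant 4 5, Ant 5 6, Mul 6 9 10, Mul 1 10 7,
      Com 7 8 3, Ev (-4) 8], [3])"
    by (rule rewrite_back[OF Unit_right,
        where n = 3 and new = "[(1, 6), (2, 9), (3, 10)]"]) (simp_all add: checks)
  also have "\<dots> \<simeq> ([1, 2], [Com 2 11 12, Ant 11 13, Coev 4 (-4), Ant 4 5, Ant 5 6, Mul 13 12 9,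
      Mul 6 9 10, Mul 1 10 7, Com 7 8 3, Ev (-4) 8], [3])"
    by (rule rewrite_back[OF Ant_left,
        where n = 0 and new = "[(2, 11), (3, 12), (4, 13)]"]) (simp_all add: checks)
  also have "\<dots> \<simeq> ([1, 2], [Com 2 11 12, Ant 11 13, Coev 4 (-4), Ant 4 5, Ant 5 6, Mul 6 13 9,
      Mul 9 12 10, Mul 1 10 7, Com 7 8 3, Ev (-4) 8], [3])"
    by (rule rewrite_back[OF Mul_assoc, where n = 5 and new = "[]"]) (simp_all add: checks)
  also have "\<dots> \<simeq> ([1, 2], [Com 2 11 12, Ant 11 13, Coev 4 (-4), Ant 4 5, Ant 5 6, Mul 6 13 9,
      Mul 1 9 10, Mul 10 12 7, Com 7 8 3, Ev (-4) 8], [3])"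
    by (rule rewrite_back[OF Mul_assoc, where n = 6 and new = "[]"]) (simp_all add: checks)
  also have "\<dots> \<simeq> ([1, 2], [Com 2 11 12, Ant 11 13, Coev 4 (-4), Ant 4 5, Ant 5 6, Mul 6 13 9,
      Mul 1 9 10, Com 10 14 15, Com 12 16 17, Mul 14 16 8, Mul 15 17 3, Ev (-4) 8], [3])"
    by (rule rewrite[OF Com_Mul,
        where n = 7 and new = "[(6, 14), (7, 15), (8, 16), (9, 17)]"]) (simp_all add: checks)
  (* The next two steps carry the right factor of wire 8 around the loop: a snake is inserted at
  wire 14, and the old snake, which has become removable, disappears. *)
  also have "\<dots> \<simeq> ([1, 2], [Com 2 11 12, Coev 7 (-7), Com 12 16 17, Mul 7 16 8, Coev 4 (-4),
      Ev (-4) 8, Ant 11 13, Ant 4 5, Ant 5 6, Mul 6 13 9, Mul 1 9 10, Com 10 14 15, Ev (-7) 14,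
      Mul 15 17 3], [3])"
    by (rule rewrite_back[OF Zig,
        where n = 8 and new = "[(1, 14), (2, 7), (-3, -7)]"]) (simp_all add: checks)
  also have "\<dots> \<simeq> ([1, 2], [Com 2 11 12, Coev 7 (-7), Com 12 16 17, Mul 7 16 8, Ant 8 5, Ant 11 13,
      Ant 5 6, Mul 6 13 9, Mul 1 9 10, Com 10 14 15, Ev (-7) 14, Mul 15 17 3], [3])"
    by (rule rewrite[OF Zig, where n = 4 and new = "[]"]) (simp_all add: checks)
  also have "\<dots> \<simeq> ([1, 2], [Com 2 11 12, Coev 7 (-7), Com 12 16 17, Ant 16 4, Ant 7 18,
      Mul 4 18 19, Ant 19 6, Ant 11 13, Mul 6 13 9, Mul 1 9 10, Com 10 14 15, Ev (-7) 14,
      Mul 15 17 3], [3])"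
    by (rule rewrite[OF Ant_Mul,
        where n = 3 and new = "[(18, 4), (13, 18), (15, 19)]"]) (simp_all add: checks)
  also have "\<dots> \<simeq> ([1, 2], [Com 2 11 12, Coev 7 (-7), Com 12 16 17, Ant 16 4, Ant 7 18, Ant 18 5,
      Ant 4 8, Ant 11 13, Mul 5 8 20, Mul 20 13 9, Mul 1 9 10, Com 10 14 15, Ev (-7) 14,
      Mul 15 17 3], [3])"
    by (rule rewrite[OF Ant_Mul,
        where n = 5 and new = "[(18, 5), (13, 8), (15, 20)]"]) (simp_all add: checks)
  also have "\<dots> \<simeq> ([1, 2], [Com 2 11 12, Com 12 16 17, Coev 7 (-7), Ant 16 4, Ant 7 18, Ant 18 5,
      Ant 4 8, Ant 11 13, Mul 8 13 20, Mul 5 20 9, Mul 1 9 10, Com 10 14 15, Ev (-7) 14,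
      Mul 15 17 3], [3])"
    by (rule rewrite[OF Mul_assoc, where n = 8 and new = "[]"]) (simp_all add: checks)
  also have "\<dots> \<simeq> ([1, 2], [Com 2 6 17, Com 6 11 16, Ant 16 4, Ant 4 8, Ant 11 13, Mul 8 13 20,
      Coev 7 (-7), Ant 7 18, Ant 18 5, Mul 5 20 9, Mul 1 9 10, Com 10 14 15, Ev (-7) 14,
      Mul 15 17 3], [3])"
    by (rule rewrite_back[OF Com_assoc, where n = 0 and new = "[(2, 6)]"]) (simp_all add: checks)
  also have "\<dots> \<simeq> ([1, 2], [Com 2 6 17, Com 6 11 16, Ant 16 4, Mul 11 4 12, Ant 12 19, Coev 7 (-7),
      Ant 7 18, Ant 18 5, Mul 5 19 9, Mul 1 9 10, Com 10 14 15, Ev (-7) 14, Mul 15 17 3], [3])"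
    by (rule rewrite_back[OF Ant_Mul,
        where n = 3 and new = "[(3, 12), (4, 19)]"]) (simp_all add: checks)
  also have "\<dots> \<simeq> ([1, 2], [Unit 12, Ant 12 19, Com 2 6 17, Cou 6, Coev 7 (-7), Ant 7 18, Ant 18 5,
      Mul 5 19 9, Mul 1 9 10, Com 10 14 15, Ev (-7) 14, Mul 15 17 3], [3])"
    by (rule rewrite[OF Ant_right, where n = 1 and new = "[]"]) (simp_all add: checks)
  also have "\<dots> \<simeq> ([1, 2], [Coev 7 (-7), Ant 7 18, Ant 18 5, Unit 4, Mul 5 4 9, Com 2 6 17, Cou 6,
      Mul 1 9 10, Com 10 14 15, Ev (-7) 14, Mul 15 17 3], [3])"
    by (rule rewrite[OF Ant_Unit, where n = 0 and new = "[]"]) (simp_all add: checks)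
  also have "\<dots> \<simeq> ([1, 2], [Com 2 6 17, Cou 6, Coev 7 (-7), Ant 7 18, Ant 18 5, Mul 1 5 10,
      Com 10 14 15, Ev (-7) 14, Mul 15 17 3], [3])"
    by (rule rewrite[OF Unit_right, where n = 3 and new = "[]"]) (simp_all add: checks)
  also have "\<dots> \<simeq> ([1, 2], [Coev 7 (-7), Ant 7 18, Ant 18 5, Mul 1 5 10, Com 10 14 15, Ev (-7) 14,
      Mul 15 2 3], [3])"
    by (rule rewrite[OF Cou_left, where n = 0 and new = "[]"]) (simp_all add: checks)
  also have "\<dots> \<simeq> ([1, 2], [Prj 1 15, Mul 15 2 3], [3])"
    by (rule rewrite_back[OF Prj_diagram, where n = 0 and new = "[]"]) (simp_all add: checks)
  finally show ?thesis .
qed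

text \<open>
  The identity \<open>\<Sum> x\<^sub>1 \<otimes> K(x\<^sub>2) = 1 \<otimes> K(x)\<close>, from right to left. It is the mirror image of the
  previous one, with products and coproducts exchanged: here a leg of a coproduct is carried
  around the loop.
\<close>

lemma Prj_right_cointegral:
  "([1], [Prj 1 2, Unit 3], [3, 2]) \<simeq>
    ([1], [Com 1 4 15, Prj 15 2], [4, 2])"
proof -
  have "([1], [Prj 1 2, Unit 3], [3, 2]) \<simeq>
      ([1], [Coev 4 (-4), Ant 4 5, Ant 5 6, Mul 1 6 7, Com 7 8 2, Ev (-4) 8, Unit 3], [3, 2])"
    by (rule rewrite[OF Prj_diagram,
        where n = 0 and new = "[(3, 4), (-3, -4), (4, 5), (5, 6), (6, 7), (7, 8)]"]) (simp_all
            add: checks)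
  also have "\<dots> \<simeq> ([1], [Coev 4 (-4), Ant 4 5, Ant 5 6, Mul 1 6 7, Com 7 8 2, Com 8 9 10, Cou 9,
      Unit 3, Ev (-4) 10], [3, 2])"
    by (rule rewrite_back[OF Cou_left,
        where n = 5 and new = "[(1, 8), (2, 9), (3, 10)]"]) (simp_all add: checks)
  also have "\<dots> \<simeq> ([1], [Coev 4 (-4), Ant 4 5, Ant 5 6, Mul 1 6 7, Com 7 8 2, Com 8 9 10,
      Com 9 11 12, Ant 12 13, Mul 11 13 3, Ev (-4) 10], [3, 2])"
    by (rule rewrite_back[OF Ant_right,
        where n = 6 and new = "[(2, 11), (3, 12), (4, 13)]"]) (simp_all add: checks)
  also have "\<dots> \<simeq> ([1], [Coev 4 (-4), Ant 4 5, Ant 5 6, Mul 1 6 7, Com 7 8 2, Com 8 11 14,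
      Com 14 12 10, Ant 12 13, Mul 11 13 3, Ev (-4) 10], [3, 2])"
    by (rule rewrite[OF Com_assoc, where n = 5 and new = "[(6, 14)]"]) (simp_all add: checks)
  also have "\<dots> \<simeq> ([1], [Coev 4 (-4), Ant 4 5, Ant 5 6, Mul 1 6 7, Com 7 11 9, Com 9 14 2,
      Com 14 12 10, Ant 12 13, Mul 11 13 3, Ev (-4) 10], [3, 2])"
    by (rule rewrite[OF Com_assoc, where n = 4 and new = "[(6, 9)]"]) (simp_all add: checks)
  (* The leg that becomes wire 12 is carried around the loop, again by trading one snake for
  another. *)
  also have "\<dots> \<simeq> ([1], [Coev 8 (-8), Com 8 12 10, Coev 4 (-4), Ev (-4) 10, Ant 4 5, Ant 5 6,
      Mul 1 6 7, Com 7 11 9, Com 9 14 2, Ev (-8) 14, Ant 12 13, Mul 11 13 3], [3, 2])"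
    by (rule rewrite_back[OF Zig,
        where n = 6 and new = "[(1, 14), (2, 8), (-3, -8)]"]) (simp_all add: checks)
  also have "\<dots> \<simeq> ([1], [Coev 8 (-8), Com 8 12 10, Ant 10 5, Ant 5 6, Mul 1 6 7, Com 7 11 9,
      Com 9 14 2, Ev (-8) 14, Ant 12 13, Mul 11 13 3], [3, 2])"
    by (rule rewrite[OF Zig, where n = 2 and new = "[]"]) (simp_all add: checks)
  also have "\<dots> \<simeq> ([1], [Coev 8 (-8), Com 8 12 10, Ant 10 5, Ant 5 6, Com 6 16 17, Com 1 4 15,
      Mul 4 16 11, Mul 15 17 9, Com 9 14 2, Ev (-8) 14, Ant 12 13, Mul 11 13 3], [3, 2])"
    by (rule rewrite[OF Com_Mul,
        where n = 4 and new = "[(6, 4), (7, 15), (8, 16), (9, 17)]"]) (simp_all add: checks)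
  also have "\<dots> \<simeq> ([1], [Coev 8 (-8), Com 8 12 10, Ant 10 5, Com 5 7 18, Ant 7 19, Ant 18 20,
      Com 1 4 15, Mul 4 20 11, Mul 15 19 9, Com 9 14 2, Ev (-8) 14, Ant 12 13, Mul 11 13 3],
      [3, 2])"
    by (rule rewrite[OF Com_Ant,
        where n = 3 and new = "[(17, 7), (12, 18), (18, 19), (13, 20)]"]) (simp_all add: checks)
  also have "\<dots> \<simeq> ([1], [Coev 8 (-8), Com 8 12 10, Com 10 6 16, Ant 6 17, Ant 17 20, Com 1 4 15,
      Ant 12 13, Mul 4 20 11, Mul 11 13 3, Ant 16 21, Ant 21 19, Mul 15 19 9, Com 9 14 2,
      Ev (-8) 14], [3, 2])"
    by (rule rewrite[OF Com_Ant,
        where n = 2 and new = "[(17, 6), (12, 16), (18, 17), (13, 21)]"]) (simp_all add: checks)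
  also have "\<dots> \<simeq> ([1], [Coev 8 (-8), Com 8 12 10, Com 10 6 16, Ant 6 17, Ant 17 20, Ant 12 13,
      Mul 20 13 11, Com 1 4 15, Mul 4 11 3, Ant 16 21, Ant 21 19, Mul 15 19 9, Com 9 14 2,
      Ev (-8) 14], [3, 2])"
    by (rule rewrite[OF Mul_assoc, where n = 7 and new = "[]"]) (simp_all add: checks)
  also have "\<dots> \<simeq> ([1], [Coev 8 (-8), Com 8 12 10, Com 10 6 16, Ant 6 17, Mul 12 17 5, Ant 5 7,
      Com 1 4 15, Mul 4 7 3, Ant 16 21, Ant 21 19, Mul 15 19 9, Com 9 14 2, Ev (-8) 14], [3, 2])"
    by (rule rewrite_back[OF Ant_Mul,
        where n = 4 and new = "[(3, 5), (4, 7)]"]) (simp_all add: checks)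
  also have "\<dots> \<simeq> ([1], [Coev 8 (-8), Com 8 11 16, Com 11 12 6, Ant 6 17, Mul 12 17 5, Ant 5 7,
      Com 1 4 15, Mul 4 7 3, Ant 16 21, Ant 21 19, Mul 15 19 9, Com 9 14 2, Ev (-8) 14], [3, 2])"
    by (rule rewrite_back[OF Com_assoc, where n = 1 and new = "[(2, 11)]"]) (simp_all add: checks)
  also have "\<dots> \<simeq> ([1], [Unit 5, Ant 5 7, Coev 8 (-8), Com 8 11 16, Cou 11, Com 1 4 15, Mul 4 7 3,
      Ant 16 21, Ant 21 19, Mul 15 19 9, Com 9 14 2, Ev (-8) 14], [3, 2])"
    by (rule rewrite[OF Ant_right, where n = 2 and new = "[]"]) (simp_all add: checks)
  also have "\<dots> \<simeq> ([1], [Com 1 4 15, Unit 6, Mul 4 6 3, Coev 8 (-8), Com 8 11 16, Cou 11,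
      Ant 16 21, Ant 21 19, Mul 15 19 9, Com 9 14 2, Ev (-8) 14], [3, 2])"
    by (rule rewrite[OF Ant_Unit, where n = 0 and new = "[(4, 6)]"]) (simp_all add: checks)
  also have "\<dots> \<simeq> ([1], [Coev 8 (-8), Com 8 11 16, Cou 11, Com 1 4 15, Ant 16 21, Ant 21 19,
      Mul 15 19 9, Com 9 14 2, Ev (-8) 14], [4, 2])"
    by (rule rewrite[OF Unit_right, where n = 1 and new = "[]"]) (simp_all add: checks)
  also have "\<dots> \<simeq> ([1], [Com 1 4 15, Coev 8 (-8), Ant 8 21, Ant 21 19, Mul 15 19 9, Com 9 14 2,
      Ev (-8) 14], [4, 2])"
    by (rule rewrite[OF Cou_left, where n = 1 and new = "[]"]) (simp_all add: checks)
  also have "\<dots> \<simeq> ([1], [Com 1 4 15, Prj 15 2], [4, 2])"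
    by (rule rewrite_back[OF Prj_diagram, where n = 1 and new = "[]"]) (simp_all add: checks)
  finally show ?thesis .
qed

text \<open>
  Behind a value of \<open>K\<close> the factor \<open>S\<^sup>2(e\<^sub>i)\<close> is only seen through its counit, which opens the
  loop.
\<close>

lemma Prj_idempotent:
  "([1], [Prj 1 2, Prj 2 3], [3]) \<simeq>
    ([1], [Prj 1 7], [7])"
proof -
  have "([1], [Prj 1 2, Prj 2 3], [3]) \<simeq>
      ([1], [Coev 4 (-4), Ant 4 5, Ant 5 6, Prj 1 2, Mul 2 6 7, Com 7 8 3, Ev (-4) 8], [3])"
    by (rule rewrite[OF Prj_diagram,
        where n = 1 and new = "[(3, 4), (-3, -4), (4, 5), (5, 6), (6, 7), (7, 8)]"]) (simp_all
            add: checks)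
  also have "\<dots> \<simeq> ([1], [Coev 4 (-4), Ant 4 5, Ant 5 6, Cou 6, Prj 1 7, Com 7 8 3, Ev (-4) 8], [3])"
    by (rule rewrite_back[OF Prj_right_integral, where n = 3 and new = "[]"]) (simp_all add: checks)
  also have "\<dots> \<simeq> ([1], [Coev 4 (-4), Ant 4 5, Cou 5, Prj 1 7, Com 7 8 3, Ev (-4) 8], [3])"
    by (rule rewrite[OF Cou_Ant, where n = 2 and new = "[]"]) (simp_all add: checks)
  also have "\<dots> \<simeq> ([1], [Prj 1 7, Com 7 8 3, Coev 4 (-4), Ev (-4) 8, Cou 4], [3])"
    by (rule rewrite[OF Cou_Ant, where n = 1 and new = "[]"]) (simp_all add: checks)
  also have "\<dots> \<simeq> ([1], [Prj 1 7, Com 7 8 3, Cou 8], [3])"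
    by (rule rewrite[OF Zig, where n = 2 and new = "[]"]) (simp_all add: checks)
  also have "\<dots> \<simeq> ([1], [Prj 1 7], [7])"
    by (rule rewrite[OF Cou_left, where n = 1 and new = "[]"]) (simp_all add: checks)
  finally show ?thesis .
qed

text \<open>
  The two loops have the product in common. Cut open there, the diagram is the trace of \<open>x \<mapsto> \<Sum>
  S(x\<^sub>2) S\<^sup>2(x\<^sub>1) = \<Sum> S(S(x\<^sub>1) x\<^sub>2) = \<epsilon>(x) 1\<close>, which is \<open>\<epsilon>(1) = 1\<close>.
\<close>

lemma Prj_antipode_trace:
  "([], [Coev 1 (-1), Ant 1 2, Prj 2 3, Ev (-1) 3], []) \<simeq>
    ([], [], [])"
proof -
  have "([], [Coev 1 (-1), Ant 1 2, Prj 2 3, Ev (-1) 3], []) \<simeq>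
      ([], [Coev 1 (-1), Ant 1 2, Coev 4 (-4), Ant 4 5, Ant 5 6, Mul 2 6 7, Com 7 8 3, Ev (-4) 8,
      Ev (-1) 3], [])"
    by (rule rewrite[OF Prj_diagram,
        where n = 2 and new = "[(3, 4), (-3, -4), (4, 5), (5, 6), (6, 7), (7, 8)]"]) (simp_all
            add: checks)
  (* The product, wire 7, becomes the start of the loop; this merges the two traces into one. *)
  also have "\<dots> \<simeq> ([], [Coev 9 (-9), Com 9 8 3, Coev 1 (-1), Ev (-1) 3, Ant 1 2, Coev 4 (-4),
      Ant 4 5, Ant 5 6, Mul 2 6 7, Ev (-9) 7, Ev (-4) 8], [])"
    by (rule rewrite_back[OF Zig,
        where n = 6 and new = "[(1, 7), (2, 9), (-3, -9)]"]) (simp_all add: checks)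
  also have "\<dots> \<simeq> ([], [Coev 9 (-9), Com 9 8 3, Coev 4 (-4), Ev (-4) 8, Ant 3 2, Ant 4 5, Ant 5 6,
      Mul 2 6 7, Ev (-9) 7], [])"
    by (rule rewrite[OF Zig, where n = 2 and new = "[]"]) (simp_all add: checks)
  also have "\<dots> \<simeq> ([], [Coev 9 (-9), Com 9 8 3, Ant 8 5, Ant 3 2, Ant 5 6, Mul 2 6 7, Ev (-9) 7],
      [])"
    by (rule rewrite[OF Zig, where n = 2 and new = "[]"]) (simp_all add: checks)
  also have "\<dots> \<simeq> ([], [Coev 9 (-9), Com 9 8 3, Ant 8 5, Mul 5 3 1, Ant 1 4, Ev (-9) 4], [])"
    by (rule rewrite_back[OF Ant_Mul, where n = 3 and new = "[(3, 1)]"]) (simp_all add: checks)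
  also have "\<dots> \<simeq> ([], [Unit 1, Ant 1 4, Coev 9 (-9), Cou 9, Ev (-9) 4], [])"
    by (rule rewrite[OF Ant_left, where n = 1 and new = "[]"]) (simp_all add: checks)
  also have "\<dots> \<simeq> ([], [Unit 2, Coev 9 (-9), Ev (-9) 2, Cou 9], [])"
    by (rule rewrite[OF Ant_Unit, where n = 0 and new = "[(4, 2)]"]) (simp_all add: checks)
  also have "\<dots> \<simeq> ([], [Unit 2, Cou 2], [])"
    by (rule rewrite[OF Zig, where n = 1 and new = "[]"]) (simp_all add: checks)
  also have "\<dots> \<simeq> ([], [], [])"
    by (rule rewrite[OF Cou_Unit, where n = 0 and new = "[]"]) (simp_all add: checks)
  finally show ?thesis .
qed

text \<open>
  The trace of \<open>K\<close> itself need not be one, because of signs of the symmetry for instance. The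
  composite \<open>K S K\<close> has the invariance of \<open>K\<close> on both sides and the trace of \<open>K K S = K S\<close>.
\<close>

definition trace_proj :: 'm where
  "trace_proj = sem [1] [Prj 1 3, Ant 3 4, Prj 4 2] [2]"

abbreviation Twi where "Twi x y \<equiv> (trace_proj, [x], [y :: int])"

lemma Twi_diagram: "([1], [Twi 1 2], [2]) \<simeq> ([1], [Prj 1 3, Ant 3 4, Prj 4 2], [2])"
  by (rule box_equivalent) (simp_all add: checks trace_proj_def)

lemma typed_Twi [simp]: "0 < x \<Longrightarrow> 0 < y \<Longrightarrow> typed_node (Twi x y)"
  using equivalent_typed[OF Twi_diagram] by (simp add: typed_node_def)

lemma Twi_right_integral:
  "([1, 2], [Twi 1 3, Mul 3 2 4], [4]) \<simeq>
    ([1, 2], [Twi 1 4, Cou 2], [4])"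
proof -
  have "([1, 2], [Twi 1 3, Mul 3 2 4], [4]) \<simeq>
      ([1, 2], [Prj 1 5, Ant 5 6, Prj 6 3, Mul 3 2 4], [4])"
    by (rule rewrite[OF Twi_diagram, where n = 0 and new = "[(3, 5), (4, 6)]"]) (simp_all add: checks)
  also have "\<dots> \<simeq> ([1, 2], [Prj 1 5, Ant 5 6, Prj 6 4, Cou 2], [4])"
    by (rule rewrite_back[OF Prj_right_integral, where n = 2 and new = "[]"]) (simp_all add: checks)
  also have "\<dots> \<simeq> ([1, 2], [Twi 1 4, Cou 2], [4])"
    by (rule rewrite_back[OF Twi_diagram, where n = 0 and new = "[]"]) (simp_all add: checks)
  finally show ?thesis .
qed

lemma Twi_right_cointegral:
  "([1], [Com 1 2 3, Twi 3 4], [2, 4]) \<simeq>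
    ([1], [Twi 1 4, Unit 7], [7, 4])"
proof -
  have "([1], [Com 1 2 3, Twi 3 4], [2, 4]) \<simeq>
      ([1], [Com 1 2 3, Prj 3 5, Ant 5 6, Prj 6 4], [2, 4])"
    by (rule rewrite[OF Twi_diagram, where n = 1 and new = "[(3, 5), (4, 6)]"]) (simp_all add: checks)
  also have "\<dots> \<simeq> ([1], [Prj 1 5, Ant 5 6, Prj 6 4, Unit 7], [7, 4])"
    by (rule rewrite_back[OF Prj_right_cointegral,
        where n = 0 and new = "[(3, 7)]"]) (simp_all add: checks)
  also have "\<dots> \<simeq> ([1], [Twi 1 4, Unit 7], [7, 4])"
    by (rule rewrite_back[OF Twi_diagram, where n = 0 and new = "[]"]) (simp_all add: checks)
  finally show ?thesis .
qed

lemma Twi_trace: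
  "([], [Coev 1 (-1), Twi 1 2, Ev (-1) 2], []) \<simeq>
    ([], [], [])"
proof -
  have "([], [Coev 1 (-1), Twi 1 2, Ev (-1) 2], []) \<simeq>
      ([], [Coev 1 (-1), Prj 1 3, Ant 3 4, Prj 4 2, Ev (-1) 2], [])"
    by (rule rewrite[OF Twi_diagram, where n = 1 and new = "[]"]) (simp_all add: checks)
  (* The first projection is carried around the loop, where it meets the second one. *)
  also have "\<dots> \<simeq> ([], [Coev 5 (-5), Ant 5 4, Prj 4 2, Coev 1 (-1), Ev (-1) 2, Prj 1 3, Ev (-5) 3],
      [])"
    by (rule rewrite_back[OF Zig,
        where n = 2 and new = "[(1, 3), (2, 5), (-3, -5)]"]) (simp_all add: checks)
  also have "\<dots> \<simeq> ([], [Coev 5 (-5), Ant 5 4, Prj 4 2, Prj 2 3, Ev (-5) 3], [])"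
    by (rule rewrite[OF Zig, where n = 3 and new = "[]"]) (simp_all add: checks)
  also have "\<dots> \<simeq> ([], [Coev 5 (-5), Ant 5 4, Prj 4 1, Ev (-5) 1], [])"
    by (rule rewrite[OF Prj_idempotent, where n = 2 and new = "[(7, 1)]"]) (simp_all add: checks)
  also have "\<dots> \<simeq> ([], [], [])"
    by (rule rewrite[OF Prj_antipode_trace, where n = 0 and new = "[]"]) (simp_all add: checks)
  finally show ?thesis .
qed

text \<open>
  For \<open>Q = K S K = \<lambda>(\<cdot>) \<Lambda>\<close> this is the classical formula \<open>S\<^sup>-\<^sup>1(y) = \<Sum> \<Lambda>\<^sub>1 \<lambda>(\<Lambda>\<^sub>2 y)\<close>.
\<close>

definition antipode_inv :: 'm where
  "antipode_inv = sem [1] [Coev 3 (-3), Twi 3 4, Com 4 2 5, Mul 5 1 6, Ev (-3) 6] [2]"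

abbreviation Inv where "Inv x y \<equiv> (antipode_inv, [x], [y :: int])"

lemma Inv_diagram: "([1], [Inv 1 2], [2]) \<simeq>
    ([1], [Coev 3 (-3), Twi 3 4, Com 4 2 5, Mul 5 1 6, Ev (-3) 6], [2])"
  by (rule box_equivalent) (simp_all add: checks antipode_inv_def)

lemma typed_Inv [simp]: "0 < x \<Longrightarrow> 0 < y \<Longrightarrow> typed_node (Inv x y)"
  using equivalent_typed[OF Inv_diagram] by (simp add: typed_node_def)

text \<open>
  \<open>\<Sum> T(y\<^sub>2) y\<^sub>1 = \<Sum> (\<Lambda> y)\<^sub>1 \<lambda>((\<Lambda> y)\<^sub>2) = \<epsilon>(y) \<lambda>(\<Lambda>) 1\<close>, first by integrality of \<open>\<Lambda>\<close> and then by
  that of \<open>\<lambda>\<close>.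
\<close>

lemma Inv_left:
  "([1], [Com 1 2 3, Inv 3 4, Mul 4 2 5], [5]) \<simeq>
    ([1], [Unit 3, Cou 1], [3])"
proof -
  have "([1], [Com 1 2 3, Inv 3 4, Mul 4 2 5], [5]) \<simeq>
      ([1], [Coev 6 (-6), Twi 6 7, Com 7 4 8, Com 1 2 3, Mul 4 2 5, Mul 8 3 9, Ev (-6) 9], [5])"
    by (rule rewrite[OF Inv_diagram,
        where n = 1 and new = "[(3, 6), (-3, -6), (4, 7), (5, 8), (6, 9)]"]) (simp_all add: checks)
  also have "\<dots> \<simeq> ([1], [Coev 6 (-6), Twi 6 7, Mul 7 1 10, Com 10 5 9, Ev (-6) 9], [5])"
    by (rule rewrite_back[OF Com_Mul, where n = 2 and new = "[(3, 10)]"]) (simp_all add: checks)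
  also have "\<dots> \<simeq> ([1], [Coev 6 (-6), Twi 6 10, Cou 1, Com 10 5 9, Ev (-6) 9], [5])"
    by (rule rewrite[OF Twi_right_integral, where n = 1 and new = "[]"]) (simp_all add: checks)
  (* The map with trace one is carried around the loop to the other side of the coproduct. *)
  also have "\<dots> \<simeq> ([1], [Coev 2 (-2), Com 2 5 9, Coev 6 (-6), Ev (-6) 9, Twi 6 10, Ev (-2) 10,
      Cou 1], [5])"
    by (rule rewrite_back[OF Zig, where n = 2 and new = "[(1, 10), (-3, -2)]"]) (simp_all add: checks)
  also have "\<dots> \<simeq> ([1], [Coev 2 (-2), Com 2 5 9, Twi 9 10, Ev (-2) 10, Cou 1], [5])"
    by (rule rewrite[OF Zig, where n = 2 and new = "[]"]) (simp_all add: checks)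
  also have "\<dots> \<simeq> ([1], [Coev 2 (-2), Twi 2 10, Ev (-2) 10, Unit 3, Cou 1], [3])"
    by (rule rewrite[OF Twi_right_cointegral,
        where n = 1 and new = "[(7, 3)]"]) (simp_all add: checks)
  also have "\<dots> \<simeq> ([1], [Unit 3, Cou 1], [3])"
    by (rule rewrite[OF Twi_trace, where n = 0 and new = "[]"]) (simp_all add: checks)
  finally show ?thesis .
qed

text \<open>
  Applying the antipode to \<open>Inv_left\<close> shows that \<open>S T\<close> is a right convolution inverse of \<open>S\<close>,
  as the identity is: \<open>S(T(y)) = \<Sum> y\<^sub>1 S(y\<^sub>2) S(T(y\<^sub>3)) = \<Sum> y\<^sub>1 S(T(y\<^sub>3) y\<^sub>2)\<close>.
\<close>

lemma Ant_Inv: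
  "([1], [Inv 1 2, Ant 2 3], [3]) \<simeq>
    ([1], [], [1])"
proof -
  have "([1], [Inv 1 2, Ant 2 3], [3]) \<simeq>
      ([1], [Com 1 4 5, Inv 5 2, Ant 2 3, Cou 4], [3])"
    by (rule rewrite_back[OF Cou_left,
        where n = 0 and new = "[(2, 4), (3, 5)]"]) (simp_all add: checks)
  also have "\<dots> \<simeq> ([1], [Com 1 4 5, Cou 4, Unit 6, Inv 5 2, Ant 2 3, Mul 6 3 7], [7])"
    by (rule rewrite_back[OF Unit_left,
        where n = 3 and new = "[(1, 3), (2, 6), (3, 7)]"]) (simp_all add: checks)
  also have "\<dots> \<simeq> ([1], [Com 1 4 5, Com 4 8 9, Ant 9 10, Inv 5 2, Ant 2 3, Mul 8 10 6, Mul 6 3 7],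
      [7])"
    by (rule rewrite_back[OF Ant_right,
        where n = 1 and new = "[(2, 8), (3, 9), (4, 10)]"]) (simp_all add: checks)
  also have "\<dots> \<simeq> ([1], [Com 1 4 5, Com 4 8 9, Inv 5 2, Ant 9 10, Ant 2 3, Mul 10 3 6, Mul 8 6 7],
      [7])"
    by (rule rewrite[OF Mul_assoc, where n = 5 and new = "[]"]) (simp_all add: checks)
  also have "\<dots> \<simeq> ([1], [Com 1 4 5, Com 4 8 9, Inv 5 2, Mul 2 9 11, Ant 11 12, Mul 8 12 7], [7])"
    by (rule rewrite_back[OF Ant_Mul,
        where n = 3 and new = "[(3, 11), (4, 12)]"]) (simp_all add: checks)
  also have "\<dots> \<simeq> ([1], [Com 1 8 3, Com 3 9 5, Inv 5 2, Mul 2 9 11, Ant 11 12, Mul 8 12 7], [7])"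
    by (rule rewrite[OF Com_assoc, where n = 0 and new = "[(6, 3)]"]) (simp_all add: checks)
  also have "\<dots> \<simeq> ([1], [Unit 5, Ant 5 12, Com 1 8 3, Cou 3, Mul 8 12 7], [7])"
    by (rule rewrite[OF Inv_left, where n = 1 and new = "[]"]) (simp_all add: checks)
  also have "\<dots> \<simeq> ([1], [Com 1 8 3, Unit 2, Mul 8 2 7, Cou 3], [7])"
    by (rule rewrite[OF Ant_Unit, where n = 0 and new = "[(4, 2)]"]) (simp_all add: checks)
  also have "\<dots> \<simeq> ([1], [Com 1 8 3, Cou 3], [8])"
    by (rule rewrite[OF Unit_right, where n = 1 and new = "[]"]) (simp_all add: checks)
  also have "\<dots> \<simeq> ([1], [], [1])"
    by (rule rewrite[OF Cou_right, where n = 0 and new = "[]"]) (simp_all add: checks)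
  finally show ?thesis .
qed

text \<open>
  Substituting \<open>S(y)\<close> into \<open>Inv_left\<close> shows that \<open>T S\<close> is a left convolution inverse of \<open>S\<close>.
\<close>

lemma Inv_Ant:
  "([1], [Ant 1 2, Inv 2 3], [3]) \<simeq>
    ([1], [], [1])"
proof -
  have "([1], [Ant 1 2, Inv 2 3], [3]) \<simeq>
      ([1], [Com 1 4 5, Ant 4 2, Inv 2 3, Cou 5], [3])"
    by (rule rewrite_back[OF Cou_right,
        where n = 0 and new = "[(2, 4), (3, 5)]"]) (simp_all add: checks)
  also have "\<dots> \<simeq> ([1], [Com 1 4 5, Cou 5, Unit 6, Ant 4 2, Inv 2 3, Mul 3 6 7], [7])"
    by (rule rewrite_back[OF Unit_right,
        where n = 3 and new = "[(1, 3), (2, 6), (3, 7)]"]) (simp_all add: checks)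
  also have "\<dots> \<simeq> ([1], [Com 1 4 5, Com 5 8 9, Ant 8 10, Ant 4 2, Inv 2 3, Mul 10 9 6, Mul 3 6 7],
      [7])"
    by (rule rewrite_back[OF Ant_left,
        where n = 1 and new = "[(2, 8), (3, 9), (4, 10)]"]) (simp_all add: checks)
  also have "\<dots> \<simeq> ([1], [Com 1 4 5, Com 5 8 9, Ant 8 10, Ant 4 2, Inv 2 3, Mul 3 10 6, Mul 6 9 7],
      [7])"
    by (rule rewrite_back[OF Mul_assoc, where n = 5 and new = "[]"]) (simp_all add: checks)
  also have "\<dots> \<simeq> ([1], [Com 1 11 9, Com 11 4 8, Ant 4 2, Ant 8 10, Inv 2 3, Mul 3 10 6,
      Mul 6 9 7], [7])"
    by (rule rewrite_back[OF Com_assoc, where n = 0 and new = "[(2, 11)]"]) (simp_all add: checks)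
  also have "\<dots> \<simeq> ([1], [Com 1 11 9, Ant 11 5, Com 5 12 13, Inv 13 3, Mul 3 12 6, Mul 6 9 7], [7])"
    by (rule rewrite_back[OF Com_Ant,
        where n = 1 and new = "[(2, 5), (3, 12), (4, 13)]"]) (simp_all add: checks)
  also have "\<dots> \<simeq> ([1], [Com 1 11 9, Ant 11 5, Cou 5, Unit 13, Mul 13 9 7], [7])"
    by (rule rewrite[OF Inv_left, where n = 2 and new = "[]"]) (simp_all add: checks)
  also have "\<dots> \<simeq> ([1], [Com 1 11 9, Cou 11, Unit 13, Mul 13 9 7], [7])"
    by (rule rewrite[OF Cou_Ant, where n = 1 and new = "[]"]) (simp_all add: checks)
  also have "\<dots> \<simeq> ([1], [Unit 13, Mul 13 1 7], [7])"
    by (rule rewrite[OF Cou_left, where n = 0 and new = "[]"]) (simp_all add: checks)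
  also have "\<dots> \<simeq> ([1], [], [1])"
    by (rule rewrite[OF Unit_left, where n = 0 and new = "[]"]) (simp_all add: checks)
  finally show ?thesis .
qed

lemma Inv_Unit:
  "([], [Unit 1, Inv 1 2], [2]) \<simeq>
    ([], [Unit 3], [3])"
proof -
  have "([], [Unit 1, Inv 1 2], [2]) \<simeq>
      ([], [Unit 3, Ant 3 4, Inv 4 2], [2])"
    by (rule rewrite_back[OF Ant_Unit,
        where n = 0 and new = "[(1, 3), (2, 4)]"]) (simp_all add: checks)
  also have "\<dots> \<simeq> ([], [Unit 3], [3])"
    by (rule rewrite[OF Inv_Ant, where n = 1 and new = "[]"]) (simp_all add: checks)
  finally show ?thesis .
qed

text \<open>
  Both maps of the composite \<open>T S\<close> are inserted behind the left hand side;
  \<open>S(y\<^sub>2 T(y\<^sub>1)) = y\<^sub>1 S(y\<^sub>2)\<close>.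
\<close>

lemma Inv_right:
  "([1], [Com 1 2 3, Inv 2 4, Mul 3 4 5], [5]) \<simeq>
    ([1], [Unit 2, Cou 1], [2])"
proof -
  have "([1], [Com 1 2 3, Inv 2 4, Mul 3 4 5], [5]) \<simeq>
      ([1], [Com 1 2 3, Inv 2 4, Mul 3 4 5, Ant 5 6, Inv 6 7], [7])"
    by (rule rewrite_back[OF Inv_Ant,
        where n = 3 and new = "[(1, 5), (2, 6), (3, 7)]"]) (simp_all add: checks)
  also have "\<dots> \<simeq> ([1], [Com 1 2 3, Inv 2 4, Ant 4 8, Ant 3 9, Mul 8 9 10, Inv 10 7], [7])"
    by (rule rewrite[OF Ant_Mul,
        where n = 2 and new = "[(18, 8), (13, 9), (15, 10)]"]) (simp_all add: checks)
  also have "\<dots> \<simeq> ([1], [Com 1 2 3, Ant 3 9, Mul 2 9 10, Inv 10 7], [7])"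
    by (rule rewrite[OF Ant_Inv, where n = 1 and new = "[]"]) (simp_all add: checks)
  also have "\<dots> \<simeq> ([1], [Unit 10, Inv 10 7, Cou 1], [7])"
    by (rule rewrite[OF Ant_right, where n = 0 and new = "[]"]) (simp_all add: checks)
  also have "\<dots> \<simeq> ([1], [Unit 2, Cou 1], [2])"
    by (rule rewrite[OF Inv_Unit, where n = 0 and new = "[(3, 2)]"]) (simp_all add: checks)
  finally show ?thesis .
qed

section \<open>The Heisenberg double and its representation\<close>

definition act :: 'm where "act = dual_action \<C> H D"
definition hmul :: 'm where "hmul = mult (hat_dual \<C> H D)"
definition hunit :: 'm where "hunit = eta (hat_dual \<C> H D)"
definition hcom :: 'm where "hcom = comult (hat_dual \<C> H D)"

text \<open>
  The representation of the Heisenberg double on \<open>H\<close>: \<open>h \<otimes> \<phi> \<otimes> x \<mapsto> h (\<phi> \<rightharpoonup> x)\<close>.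
\<close>

definition rep :: 'm where "rep = mult H \<cdot> (\<one> (obj H) \<otimes> act)"

text \<open>
  The same representation as a map to \<open>H \<otimes> H\<^sup>*\<close>, the matrices with respect to the dual bases.
\<close>

definition theta :: 'm where "theta = (rep \<otimes> \<one> (dual D)) \<cdot> (\<one> (obj H \<odot> dual D) \<otimes> coev D)"

text \<open>
  In Sweedler notation \<open>k \<otimes> \<psi> \<mapsto> \<Sum> k \<psi>(e\<^sub>i\<^sub>2) S\<^sup>-\<^sup>1(e\<^sub>i\<^sub>1) \<otimes> e\<^sup>i\<close>: a linear map \<open>f\<close> of \<open>H\<close>
  comes from \<open>y \<mapsto> \<Sum> f(y\<^sub>2) S\<^sup>-\<^sup>1(y\<^sub>1)\<close>.
\<close>

definition theta_inv :: 'm where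
  "theta_inv = sem [1, -2] [Coev 4 (-4), Com 4 5 6, Ev (-2) 6, Inv 5 7, Mul 1 7 3] [3, -4]"

lemma act_layers: "act = (\<one> (obj H) \<otimes> ev D) \<cdot> ((\<beta> (dual D) (obj H) \<otimes> \<one> (obj H)) \<cdot>
    (\<one> (dual D) \<otimes> comult H))"
  by (simp add: act_def dual_action_def H_normal)

text \<open>
  The transposes in the definition of the dual reverse the order of tensor factors, and the
  opposite product and coproduct reverse it back. In terms of diagrams
  \<open>(\<phi> \<psi>)(x) = \<Sum> \<phi>(x\<^sub>1) \<psi>(x\<^sub>2)\<close> and \<open>\<phi>(x y) = \<Sum> \<phi>\<^sub>1(x) \<phi>\<^sub>2(y)\<close>.
\<close>

lemma hmul_layers: "hmul = (ev D \<otimes> \<one> (dual D)) \<cdot> ((\<one> (dual D) \<otimes> ev D \<otimes> \<one> (obj H \<odot> dual D))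
    \<cdot> ((\<one> (dual D \<odot> dual D) \<otimes> comult H \<otimes> \<one> (dual D)) \<cdot>
      ((\<one> (dual D \<odot> dual D) \<otimes> coev D) \<cdot> \<beta> (dual D) (dual D))))"
proof -
  have "(ev D \<cdot> (\<one> (dual D) \<otimes> ev D \<otimes> \<one> (obj H))) \<otimes> \<one> (dual D)
      = (ev D \<otimes> \<one> (dual D)) \<cdot> (\<one> (dual D) \<otimes> ev D \<otimes> \<one> (obj H \<odot> dual D))"
    by (simp add: H_normal interchange flip: Tensor_Ident Tensor_arr_assoc)
  then show ?thesis
    by (simp add: hmul_def hat_dual_def cop_hopf_def op_hopf_def dual_hopf_def transpose_def
      tensor_dual_def Let_def H_normal)
qed

lemma hunit_layers: "hunit = (counit H \<otimes> \<one> (dual D)) \<cdot> coev D"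
  by (simp add: hunit_def hat_dual_def cop_hopf_def op_hopf_def dual_hopf_def transpose_def
      unit_dual_def Let_def H_normal)

lemma hcom_layers: "hcom = \<beta> (dual D) (dual D) \<cdot> ((ev D \<otimes> \<one> (dual D \<odot> dual D))
    \<cdot> ((\<one> (dual D) \<otimes> mult H \<otimes> \<one> (dual D \<odot> dual D)) \<cdot>
      ((\<one> (dual D \<odot> obj H) \<otimes> coev D \<otimes> \<one> (dual D)) \<cdot> (\<one> (dual D) \<otimes> coev D))))"
proof -
  have "\<one> (dual D) \<otimes> ((\<one> (obj H) \<otimes> coev D \<otimes> \<one> (dual D)) \<cdot> coev D)
      = (\<one> (dual D \<odot> obj H) \<otimes> coev D \<otimes> \<one> (dual D)) \<cdot> (\<one> (dual D) \<otimes> coev D)"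
    by (simp add: H_normal interchange flip: Tensor_Ident)
  then show ?thesis
    by (simp add: hcom_def hat_dual_def cop_hopf_def op_hopf_def dual_hopf_def transpose_def
      tensor_dual_def Let_def H_normal)
qed

lemma hom_layers:
  "act \<in> Arr \<C>" "Dom \<C> act = dual D \<odot> obj H" "Cod \<C> act = obj H"
  "hmul \<in> Arr \<C>" "Dom \<C> hmul = dual D \<odot> dual D" "Cod \<C> hmul = dual D"
  "hunit \<in> Arr \<C>" "Dom \<C> hunit = \<I>" "Cod \<C> hunit = dual D"
  "hcom \<in> Arr \<C>" "Dom \<C> hcom = dual D" "Cod \<C> hcom = dual D \<odot> dual D"
  by (simp_all add: act_layers hmul_layers hunit_layers hcom_layers H_normal)

lemma rep_typing:
  "rep \<in> Arr \<C>" "Dom \<C> rep = obj H \<odot> dual D \<odot> obj H" "Cod \<C> rep = obj H"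
  by (simp_all add: rep_def H_normal hom_layers)

lemma theta_typing:
  "theta \<in> Arr \<C>" "Dom \<C> theta = obj H \<odot> dual D" "Cod \<C> theta = obj H \<odot> dual D"
  by (simp_all add: theta_def H_normal rep_typing)

abbreviation Act where "Act p x y \<equiv> (act, [p, x], [y :: int])"
abbreviation HMul where "HMul p q r \<equiv> (hmul, [p, q], [r :: int])"
abbreviation HUnit where "HUnit r \<equiv> (hunit, [] :: int list, [r])"
abbreviation HCom where "HCom p q r \<equiv> (hcom, [p], [q, r :: int])"
abbreviation Rep where "Rep x p y z \<equiv> (rep, [x, p, y], [z :: int])"
abbreviation Th where "Th x p y q \<equiv> (theta, [x, p], [y, q :: int])"
abbreviation ThI where "ThI x p y q \<equiv> (theta_inv, [x, p], [y, q :: int])"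

lemma ThI_diagram: "([1, -2], [ThI 1 (-2) 3 (-4)], [3, -4])
    \<simeq> ([1, -2], [Coev 4 (-4), Com 4 5 6, Ev (-2) 6, Inv 5 7, Mul 1 7 3], [3, -4])"
  by (rule box_equivalent) (simp_all add: checks theta_inv_def)

lemma theta_inv_typing:
  "theta_inv \<in> Arr \<C>" "Dom \<C> theta_inv = obj H \<odot> dual D" "Cod \<C> theta_inv = obj H \<odot> dual D"
  using equivalent_typed[OF ThI_diagram] by (simp_all add: typed_node_def in_hom_def H_normal)

lemma antipode_inv_typing:
  "antipode_inv \<in> Arr \<C>" "Dom \<C> antipode_inv = obj H" "Cod \<C> antipode_inv = obj H"
  using equivalent_typed[OF Inv_diagram] by (simp_all add: typed_node_def in_hom_def H_normal)

lemmas D_normal = H_normal antipode_inv_typing hom_layers rep_typing theta_typing theta_inv_typing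

lemma typed_dual_nodes [simp]:
  "p < 0 \<Longrightarrow> 0 < x \<Longrightarrow> 0 < y \<Longrightarrow> typed_node (Act p x y)"
  "p < 0 \<Longrightarrow> q < 0 \<Longrightarrow> r < 0 \<Longrightarrow> typed_node (HMul p q r)"
  "r < 0 \<Longrightarrow> typed_node (HUnit r)"
  "p < 0 \<Longrightarrow> q < 0 \<Longrightarrow> r < 0 \<Longrightarrow> typed_node (HCom p q r)"
  "0 < x \<Longrightarrow> p < 0 \<Longrightarrow> 0 < y \<Longrightarrow> 0 < z \<Longrightarrow> typed_node (Rep x p y z)"
  "0 < x \<Longrightarrow> p < 0 \<Longrightarrow> 0 < y \<Longrightarrow> q < 0 \<Longrightarrow> typed_node (Th x p y q)"
  "0 < x \<Longrightarrow> p < 0 \<Longrightarrow> 0 < y \<Longrightarrow> q < 0 \<Longrightarrow> typed_node (ThI x p y q)"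
  by (simp_all add: typed_node_def in_hom_def D_normal)

lemma Act_diagram: "([-1, 2], [Act (-1) 2 3], [3]) \<simeq> ([-1, 2], [Com 2 3 4, Ev (-1) 4], [3])"
proof -
  have "([-1, 2], nodes [At 0 (Act (-1) 2 3)], [3])
      \<simeq> ([-1, 2], nodes [At 1 (Com 2 3 4), Cross 0, At 1 (Ev (-1) 4)], [3])"
    by (rule equivalent_layersI, simp_all add: checks D_normal) (simp add: D_normal act_layers)
  then show ?thesis by simp
qed

lemma HMul_diagram: "([-1, -2], [HMul (-1) (-2) (-3)], [-3]) \<simeq>
    ([-1, -2], [Coev 3 (-3), Com 3 4 5, Ev (-1) 4, Ev (-2) 5], [-3])"
proof -
  have "([-1, -2], nodes [At 0 (HMul (-1) (-2) (-3))], [-3])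
      \<simeq> ([-1, -2], nodes [Cross 0, At 2 (Coev 3 (-3)), At 2 (Com 3 4 5), At 1 (Ev (-1) 4),
          At 0 (Ev (-2) 5)], [-3])"
    by (rule equivalent_layersI, simp_all add: checks D_normal) (simp add: D_normal hmul_layers)
  then show ?thesis by simp
qed

lemma HUnit_diagram: "([], [HUnit (-1)], [-1]) \<simeq> ([], [Coev 1 (-1), Cou 1], [-1])"
proof -
  have "([], nodes [At 0 (HUnit (-1))], [-1])
      \<simeq> ([], nodes [At 0 (Coev 1 (-1)), At 0 (Cou 1)], [-1])"
    by (rule equivalent_layersI, simp_all add: checks D_normal) (simp add: D_normal hunit_layers)
  then show ?thesis by simp
qed

lemma HCom_diagram: "([-1], [HCom (-1) (-2) (-3)], [-2, -3]) \<simeq>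
    ([-1], [Coev 2 (-2), Coev 3 (-3), Mul 2 3 4, Ev (-1) 4], [-2, -3])"
proof -
  have "([-1], nodes [At 0 (HCom (-1) (-2) (-3))], [-2, -3])
      \<simeq> ([-1], nodes [At 1 (Coev 2 (-2)), At 2 (Coev 3 (-3)), At 1 (Mul 2 3 4), At 0 (Ev (-1) 4),
          Cross 0], [-2, -3])"
    by (rule equivalent_layersI, simp_all add: checks D_normal) (simp add: D_normal hcom_layers)
  then show ?thesis by simp
qed

lemma Rep_diagram: "([1, -2, 3], [Rep 1 (-2) 3 4], [4]) \<simeq>
    ([1, -2, 3], [Act (-2) 3 5, Mul 1 5 4], [4])"
proof -
  have "([1, -2, 3], nodes [At 0 (Rep 1 (-2) 3 4)], [4])
      \<simeq> ([1, -2, 3], nodes [At 1 (Act (-2) 3 5), At 0 (Mul 1 5 4)], [4])"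
    by (rule equivalent_layersI, simp_all add: checks D_normal) (simp add: D_normal rep_def)
  then show ?thesis by simp
qed

lemma Th_diagram: "([1, -2], [Th 1 (-2) 3 (-4)], [3, -4]) \<simeq>
    ([1, -2], [Coev 4 (-4), Rep 1 (-2) 4 3], [3, -4])"
proof -
  have "([1, -2], nodes [At 0 (Th 1 (-2) 3 (-4))], [3, -4])
      \<simeq> ([1, -2], nodes [At 2 (Coev 4 (-4)), At 0 (Rep 1 (-2) 4 3)], [3, -4])"
    by (rule equivalent_layersI, simp_all add: checks D_normal) (simp add: D_normal theta_def)
  then show ?thesis by simp
qed

text \<open>
  Both sides are \<open>\<Sum> h k\<^sub>1 x\<^sub>1 \<phi>(k\<^sub>2 x\<^sub>2) \<psi>(x\<^sub>3)\<close> for the elements \<open>h # \<phi>\<close>, \<open>k # \<psi>\<close> of the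
  double; the dual strands of the structure maps of \<open>H\<^sup>*\<close> straighten out.
\<close>

lemma Rep_module:
  "([1, -2, 3, -4, 5], [HCom (-2) (-5) (-6), Act (-5) 3 7, Mul 1 7 8, HMul (-6) (-4) (-9),
   Rep 8 (-9) 5 10], [10]) \<simeq>
    ([1, -2, 3, -4, 5], [Rep 3 (-4) 5 9, Rep 1 (-2) 9 10], [10])"
proof -
  have "([1, -2, 3, -4, 5], [HCom (-2) (-5) (-6), Act (-5) 3 7, Mul 1 7 8, HMul (-6) (-4) (-9),
        Rep 8 (-9) 5 10], [10]) \<simeq>
      ([1, -2, 3, -4, 5], [Coev 12 (-6), HMul (-6) (-4) (-9), Coev 11 (-5), Mul 11 12 13,
      Ev (-2) 13, Act (-5) 3 7, Mul 1 7 8, Rep 8 (-9) 5 10], [10])"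
    by (rule rewrite[OF HCom_diagram,
        where n = 0 and new = "[(2, 11), (3, 12), (4, 13)]"]) (simp_all add: checks)
  also have "\<dots> \<simeq> ([1, -2, 3, -4, 5], [Coev 14 (-9), Coev 11 (-5), Act (-5) 3 7, Mul 1 7 8,
      Rep 8 (-9) 5 10, Coev 12 (-6), Com 14 15 16, Ev (-6) 15, Ev (-4) 16, Mul 11 12 13,
      Ev (-2) 13], [10])"
    by (rule rewrite[OF HMul_diagram,
        where n = 1 and new = "[(3, 14), (4, 15), (5, 16)]"]) (simp_all add: checks)
  also have "\<dots> \<simeq> ([1, -2, 3, -4, 5], [Coev 11 (-5), Act (-5) 3 7, Coev 14 (-9), Mul 1 7 8,
      Act (-9) 5 17, Mul 8 17 10, Coev 12 (-6), Com 14 15 16, Ev (-6) 15, Ev (-4) 16,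
      Mul 11 12 13, Ev (-2) 13], [10])"
    by (rule rewrite[OF Rep_diagram, where n = 4 and new = "[(5, 17)]"]) (simp_all add: checks)
  also have "\<dots> \<simeq> ([1, -2, 3, -4, 5], [Coev 14 (-9), Act (-9) 5 17, Coev 11 (-5), Com 3 7 18,
      Ev (-5) 18, Mul 1 7 8, Mul 8 17 10, Coev 12 (-6), Com 14 15 16, Ev (-6) 15, Ev (-4) 16,
      Mul 11 12 13, Ev (-2) 13], [10])"
    by (rule rewrite[OF Act_diagram, where n = 1 and new = "[(4, 18)]"]) (simp_all add: checks)
  also have "\<dots> \<simeq> ([1, -2, 3, -4, 5], [Com 5 17 19, Coev 14 (-9), Ev (-9) 19, Coev 11 (-5),
      Com 3 7 18, Ev (-5) 18, Mul 1 7 8, Mul 8 17 10, Coev 12 (-6), Com 14 15 16, Ev (-6) 15,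
      Ev (-4) 16, Mul 11 12 13, Ev (-2) 13], [10])"
    by (rule rewrite[OF Act_diagram, where n = 1 and new = "[(4, 19)]"]) (simp_all add: checks)
  also have "\<dots> \<simeq> ([1, -2, 3, -4, 5], [Com 3 7 18, Coev 11 (-5), Ev (-5) 18, Com 5 17 19,
      Mul 1 7 8, Mul 8 17 10, Coev 12 (-6), Com 19 15 16, Ev (-6) 15, Ev (-4) 16, Mul 11 12 13,
      Ev (-2) 13], [10])"
    by (rule rewrite[OF Zig, where n = 1 and new = "[]"]) (simp_all add: checks)
  also have "\<dots> \<simeq> ([1, -2, 3, -4, 5], [Com 5 17 19, Com 19 15 16, Coev 12 (-6), Ev (-6) 15,
      Com 3 7 18, Mul 1 7 8, Mul 8 17 10, Ev (-4) 16, Mul 18 12 13, Ev (-2) 13], [10])"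
    by (rule rewrite[OF Zig, where n = 1 and new = "[]"]) (simp_all add: checks)
  also have "\<dots> \<simeq> ([1, -2, 3, -4, 5], [Com 5 17 19, Com 19 15 16, Com 3 7 18, Mul 1 7 8,
      Mul 8 17 10, Ev (-4) 16, Mul 18 15 13, Ev (-2) 13], [10])"
    by (rule rewrite[OF Zig, where n = 2 and new = "[]"]) (simp_all add: checks)
  also have "\<dots> \<simeq> ([1, -2, 3, -4, 5], [Com 5 6 16, Com 6 17 15, Com 3 7 18, Mul 1 7 8, Mul 8 17 10,
      Ev (-4) 16, Mul 18 15 13, Ev (-2) 13], [10])"
    by (rule rewrite_back[OF Com_assoc, where n = 0 and new = "[(2, 6)]"]) (simp_all add: checks)
  also have "\<dots> \<simeq> ([1, -2, 3, -4, 5], [Com 5 6 16, Com 3 7 18, Com 6 17 15, Mul 7 17 8,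
      Mul 18 15 13, Mul 1 8 10, Ev (-4) 16, Ev (-2) 13], [10])"
    by (rule rewrite[OF Mul_assoc, where n = 3 and new = "[]"]) (simp_all add: checks)
  also have "\<dots> \<simeq> ([1, -2, 3, -4, 5], [Com 5 6 16, Mul 3 6 9, Com 9 8 13, Ev (-2) 13, Mul 1 8 10,
      Ev (-4) 16], [10])"
    by (rule rewrite_back[OF Com_Mul, where n = 1 and new = "[(3, 9)]"]) (simp_all add: checks)
  also have "\<dots> \<simeq> ([1, -2, 3, -4, 5], [Com 5 6 16, Ev (-4) 16, Mul 3 6 9, Act (-2) 9 8,
      Mul 1 8 10], [10])"
    by (rule rewrite_back[OF Act_diagram, where n = 2 and new = "[]"]) (simp_all add: checks)
  also have "\<dots> \<simeq> ([1, -2, 3, -4, 5], [Act (-4) 5 6, Mul 3 6 9, Act (-2) 9 8, Mul 1 8 10], [10])"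
    by (rule rewrite_back[OF Act_diagram, where n = 0 and new = "[]"]) (simp_all add: checks)
  also have "\<dots> \<simeq> ([1, -2, 3, -4, 5], [Rep 3 (-4) 5 9, Act (-2) 9 8, Mul 1 8 10], [10])"
    by (rule rewrite_back[OF Rep_diagram, where n = 0 and new = "[]"]) (simp_all add: checks)
  also have "\<dots> \<simeq> ([1, -2, 3, -4, 5], [Rep 3 (-4) 5 9, Rep 1 (-2) 9 10], [10])"
    by (rule rewrite_back[OF Rep_diagram, where n = 1 and new = "[]"]) (simp_all add: checks)
  finally show ?thesis .
qed

lemma Rep_unit:
  "([1], [HUnit (-3), Unit 2, Rep 2 (-3) 1 4], [4]) \<simeq>
    ([1], [], [1])"
proof -
  have "([1], [HUnit (-3), Unit 2, Rep 2 (-3) 1 4], [4]) \<simeq>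
      ([1], [Coev 5 (-3), Unit 2, Rep 2 (-3) 1 4, Cou 5], [4])"
    by (rule rewrite[OF HUnit_diagram, where n = 0 and new = "[(1, 5)]"]) (simp_all add: checks)
  also have "\<dots> \<simeq> ([1], [Coev 5 (-3), Act (-3) 1 6, Unit 2, Mul 2 6 4, Cou 5], [4])"
    by (rule rewrite[OF Rep_diagram, where n = 2 and new = "[(5, 6)]"]) (simp_all add: checks)
  also have "\<dots> \<simeq> ([1], [Com 1 6 7, Coev 5 (-3), Ev (-3) 7, Unit 2, Mul 2 6 4, Cou 5], [4])"
    by (rule rewrite[OF Act_diagram, where n = 1 and new = "[(4, 7)]"]) (simp_all add: checks)
  also have "\<dots> \<simeq> ([1], [Com 1 6 7, Cou 7, Unit 2, Mul 2 6 4], [4])"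
    by (rule rewrite[OF Zig, where n = 1 and new = "[]"]) (simp_all add: checks)
  also have "\<dots> \<simeq> ([1], [Unit 2, Mul 2 1 4], [4])"
    by (rule rewrite[OF Cou_right, where n = 0 and new = "[]"]) (simp_all add: checks)
  also have "\<dots> \<simeq> ([1], [], [1])"
    by (rule rewrite[OF Unit_left, where n = 0 and new = "[]"]) (simp_all add: checks)
  finally show ?thesis .
qed

text \<open>
  The action of \<open>H\<^sup>*\<close> only touches the right leg of the coproduct.
\<close>

lemma Rep_Com:
  "([1, -2, 3], [Rep 1 (-2) 3 4, Com 4 5 6], [5, 6]) \<simeq>
    ([1, -2, 3], [Com 3 11 4, Com 1 9 10, Rep 10 (-2) 4 6, Mul 9 11 5], [5, 6])"
proof -
  have "([1, -2, 3], [Rep 1 (-2) 3 4, Com 4 5 6], [5, 6]) \<simeq>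
      ([1, -2, 3], [Act (-2) 3 7, Mul 1 7 4, Com 4 5 6], [5, 6])"
    by (rule rewrite[OF Rep_diagram, where n = 0 and new = "[(5, 7)]"]) (simp_all add: checks)
  also have "\<dots> \<simeq> ([1, -2, 3], [Com 3 7 8, Mul 1 7 4, Com 4 5 6, Ev (-2) 8], [5, 6])"
    by (rule rewrite[OF Act_diagram, where n = 0 and new = "[(4, 8)]"]) (simp_all add: checks)
  also have "\<dots> \<simeq> ([1, -2, 3], [Com 3 7 8, Com 7 11 12, Com 1 9 10, Mul 9 11 5, Mul 10 12 6,
      Ev (-2) 8], [5, 6])"
    by (rule rewrite[OF Com_Mul,
        where n = 1 and new = "[(6, 9), (7, 10), (8, 11), (9, 12)]"]) (simp_all add: checks)
  also have "\<dots> \<simeq> ([1, -2, 3], [Com 3 11 4, Com 4 12 8, Ev (-2) 8, Com 1 9 10, Mul 9 11 5,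
      Mul 10 12 6], [5, 6])"
    by (rule rewrite[OF Com_assoc, where n = 0 and new = "[(6, 4)]"]) (simp_all add: checks)
  also have "\<dots> \<simeq> ([1, -2, 3], [Com 3 11 4, Com 1 9 10, Act (-2) 4 12, Mul 10 12 6, Mul 9 11 5],
      [5, 6])"
    by (rule rewrite_back[OF Act_diagram, where n = 1 and new = "[]"]) (simp_all add: checks)
  also have "\<dots> \<simeq> ([1, -2, 3], [Com 3 11 4, Com 1 9 10, Rep 10 (-2) 4 6, Mul 9 11 5], [5, 6])"
    by (rule rewrite_back[OF Rep_diagram, where n = 2 and new = "[]"]) (simp_all add: checks)
  finally show ?thesis .
qed

lemma ThI_Th:
  "([1, -2], [ThI 1 (-2) 3 (-4), Th 3 (-4) 5 (-6)], [5, -6]) \<simeq>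
    ([1, -2], [], [1, -2])"
proof -
  have "([1, -2], [ThI 1 (-2) 3 (-4), Th 3 (-4) 5 (-6)], [5, -6]) \<simeq>
      ([1, -2], [Coev 7 (-4), Com 7 8 9, Inv 8 10, Mul 1 10 3, Th 3 (-4) 5 (-6), Ev (-2) 9], [5,
      -6])"
    by (rule rewrite[OF ThI_diagram,
        where n = 0 and new = "[(4, 7), (5, 8), (6, 9), (7, 10)]"]) (simp_all add: checks)
  also have "\<dots> \<simeq> ([1, -2], [Coev 7 (-4), Com 7 8 9, Inv 8 10, Mul 1 10 3, Coev 11 (-6),
      Rep 3 (-4) 11 5, Ev (-2) 9], [5, -6])"
    by (rule rewrite[OF Th_diagram, where n = 4 and new = "[(4, 11)]"]) (simp_all add: checks)
  also have "\<dots> \<simeq> ([1, -2], [Coev 7 (-4), Coev 11 (-6), Act (-4) 11 12, Com 7 8 9, Inv 8 10,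
      Mul 1 10 3, Mul 3 12 5, Ev (-2) 9], [5, -6])"
    by (rule rewrite[OF Rep_diagram, where n = 5 and new = "[(5, 12)]"]) (simp_all add: checks)
  also have "\<dots> \<simeq> ([1, -2], [Coev 11 (-6), Com 11 12 13, Coev 7 (-4), Ev (-4) 13, Com 7 8 9,
      Inv 8 10, Mul 1 10 3, Mul 3 12 5, Ev (-2) 9], [5, -6])"
    by (rule rewrite[OF Act_diagram, where n = 2 and new = "[(4, 13)]"]) (simp_all add: checks)
  also have "\<dots> \<simeq> ([1, -2], [Coev 11 (-6), Com 11 12 13, Com 13 8 9, Inv 8 10, Mul 1 10 3,
      Mul 3 12 5, Ev (-2) 9], [5, -6])"
    by (rule rewrite[OF Zig, where n = 2 and new = "[]"]) (simp_all add: checks)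
  also have "\<dots> \<simeq> ([1, -2], [Coev 11 (-6), Com 11 12 13, Com 13 8 9, Inv 8 10, Mul 10 12 3,
      Mul 1 3 5, Ev (-2) 9], [5, -6])"
    by (rule rewrite[OF Mul_assoc, where n = 4 and new = "[]"]) (simp_all add: checks)
  also have "\<dots> \<simeq> ([1, -2], [Coev 11 (-6), Com 11 4 9, Com 4 12 8, Inv 8 10, Mul 10 12 3,
      Mul 1 3 5, Ev (-2) 9], [5, -6])"
    by (rule rewrite_back[OF Com_assoc, where n = 1 and new = "[(2, 4)]"]) (simp_all add: checks)
  also have "\<dots> \<simeq> ([1, -2], [Unit 8, Mul 1 8 5, Coev 11 (-6), Com 11 4 9, Cou 4, Ev (-2) 9],
      [5, -6])"
    by (rule rewrite[OF Inv_left, where n = 2 and new = "[]"]) (simp_all add: checks)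
  also have "\<dots> \<simeq> ([1, -2], [Coev 11 (-6), Com 11 4 9, Cou 4, Ev (-2) 9], [1, -6])"
    by (rule rewrite[OF Unit_right, where n = 0 and new = "[]"]) (simp_all add: checks)
  also have "\<dots> \<simeq> ([1, -2], [Coev 11 (-6), Ev (-2) 11], [1, -6])"
    by (rule rewrite[OF Cou_left, where n = 1 and new = "[]"]) (simp_all add: checks)
  also have "\<dots> \<simeq> ([1, -2], [], [1, -2])"
    by (rule rewrite[OF Zag, where n = 0 and new = "[]"]) (simp_all add: checks)
  finally show ?thesis .
qed

lemma Th_ThI:
  "([1, -2], [Th 1 (-2) 3 (-4), ThI 3 (-4) 5 (-6)], [5, -6]) \<simeq>
    ([1, -2], [], [1, -2])"
proof -
  have "([1, -2], [Th 1 (-2) 3 (-4), ThI 3 (-4) 5 (-6)], [5, -6]) \<simeq>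
      ([1, -2], [Th 1 (-2) 3 (-4), Coev 7 (-6), Com 7 8 9, Ev (-4) 9, Inv 8 10, Mul 3 10 5], [5,
      -6])"
    by (rule rewrite[OF ThI_diagram,
        where n = 1 and new = "[(4, 7), (5, 8), (6, 9), (7, 10)]"]) (simp_all add: checks)
  also have "\<dots> \<simeq> ([1, -2], [Coev 11 (-4), Rep 1 (-2) 11 3, Coev 7 (-6), Com 7 8 9, Ev (-4) 9,
      Inv 8 10, Mul 3 10 5], [5, -6])"
    by (rule rewrite[OF Th_diagram, where n = 0 and new = "[(4, 11)]"]) (simp_all add: checks)
  also have "\<dots> \<simeq> ([1, -2], [Coev 11 (-4), Act (-2) 11 12, Mul 1 12 3, Coev 7 (-6), Com 7 8 9,
      Ev (-4) 9, Inv 8 10, Mul 3 10 5], [5, -6])"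
    by (rule rewrite[OF Rep_diagram, where n = 1 and new = "[(5, 12)]"]) (simp_all add: checks)
  also have "\<dots> \<simeq> ([1, -2], [Coev 7 (-6), Com 7 8 9, Coev 11 (-4), Ev (-4) 9, Com 11 12 13,
      Ev (-2) 13, Mul 1 12 3, Inv 8 10, Mul 3 10 5], [5, -6])"
    by (rule rewrite[OF Act_diagram, where n = 1 and new = "[(4, 13)]"]) (simp_all add: checks)
  also have "\<dots> \<simeq> ([1, -2], [Coev 7 (-6), Com 7 8 9, Com 9 12 13, Inv 8 10, Mul 1 12 3, Mul 3 10 5,
      Ev (-2) 13], [5, -6])"
    by (rule rewrite[OF Zig, where n = 2 and new = "[]"]) (simp_all add: checks)
  also have "\<dots> \<simeq> ([1, -2], [Coev 7 (-6), Com 7 8 9, Com 9 12 13, Inv 8 10, Mul 12 10 3, Mul 1 3 5,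
      Ev (-2) 13], [5, -6])"
    by (rule rewrite[OF Mul_assoc, where n = 4 and new = "[]"]) (simp_all add: checks)
  also have "\<dots> \<simeq> ([1, -2], [Coev 7 (-6), Com 7 4 13, Com 4 8 12, Inv 8 10, Mul 12 10 3, Mul 1 3 5,
      Ev (-2) 13], [5, -6])"
    by (rule rewrite_back[OF Com_assoc, where n = 1 and new = "[(2, 4)]"]) (simp_all add: checks)
  also have "\<dots> \<simeq> ([1, -2], [Unit 8, Mul 1 8 5, Coev 7 (-6), Com 7 4 13, Cou 4, Ev (-2) 13],
      [5, -6])"
    by (rule rewrite[OF Inv_right, where n = 2 and new = "[]"]) (simp_all add: checks)
  also have "\<dots> \<simeq> ([1, -2], [Coev 7 (-6), Com 7 4 13, Cou 4, Ev (-2) 13], [1, -6])"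
    by (rule rewrite[OF Unit_right, where n = 0 and new = "[]"]) (simp_all add: checks)
  also have "\<dots> \<simeq> ([1, -2], [Coev 7 (-6), Ev (-2) 7], [1, -6])"
    by (rule rewrite[OF Cou_left, where n = 1 and new = "[]"]) (simp_all add: checks)
  also have "\<dots> \<simeq> ([1, -2], [], [1, -2])"
    by (rule rewrite[OF Zag, where n = 0 and new = "[]"]) (simp_all add: checks)
  finally show ?thesis .
qed

lemma Inv_left_coaction:
  "([1], [Com 1 2 3, Com 3 4 5, Inv 4 6, Mul 6 2 7], [5, 7]) \<simeq>
    ([1], [Unit 4], [1, 4])"
proof -
  have "([1], [Com 1 2 3, Com 3 4 5, Inv 4 6, Mul 6 2 7], [5, 7]) \<simeq>
      ([1], [Com 1 8 5, Com 8 2 4, Inv 4 6, Mul 6 2 7], [5, 7])"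
    by (rule rewrite_back[OF Com_assoc, where n = 0 and new = "[(2, 8)]"]) (simp_all add: checks)
  also have "\<dots> \<simeq> ([1], [Com 1 8 5, Cou 8, Unit 4], [5, 4])"
    by (rule rewrite[OF Inv_left, where n = 1 and new = "[]"]) (simp_all add: checks)
  also have "\<dots> \<simeq> ([1], [Unit 4], [1, 4])"
    by (rule rewrite[OF Cou_left, where n = 0 and new = "[]"]) (simp_all add: checks)
  finally show ?thesis .
qed

lemma Inv_right_coaction:
  "([1], [Com 1 2 3, Com 3 4 5, Inv 2 6, Mul 4 6 7], [5, 7]) \<simeq>
    ([1], [Unit 2], [1, 2])"
proof -
  have "([1], [Com 1 2 3, Com 3 4 5, Inv 2 6, Mul 4 6 7], [5, 7]) \<simeq>
      ([1], [Com 1 8 5, Com 8 2 4, Inv 2 6, Mul 4 6 7], [5, 7])"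
    by (rule rewrite_back[OF Com_assoc, where n = 0 and new = "[(2, 8)]"]) (simp_all add: checks)
  also have "\<dots> \<simeq> ([1], [Com 1 8 5, Cou 8, Unit 2], [5, 2])"
    by (rule rewrite[OF Inv_right, where n = 1 and new = "[]"]) (simp_all add: checks)
  also have "\<dots> \<simeq> ([1], [Unit 2], [1, 2])"
    by (rule rewrite[OF Cou_left, where n = 0 and new = "[]"]) (simp_all add: checks)
  finally show ?thesis .
qed

text \<open>
  The large factor on the left is the product of the Heisenberg double \<open>H # H\<^sup>*\<close>.
\<close>

lemma rep_mult: "rep \<cdot> ((((mult H \<otimes> hmul) \<cdot> ((\<one> (obj H) \<otimes> act \<otimes> \<one> (dual D \<odot> dual D)) \<cdot>
    ((\<one> (obj H \<odot> dual D) \<otimes> \<beta> (dual D) (obj H) \<otimes> \<one> (dual D)) \<cdot> ((\<one> (obj H) \<otimes> hcom \<otimes> \<one> (obj H \<odot> dual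
        D)))))) \<otimes> \<one> (obj H))) = rep \<cdot> (\<one> (obj H \<odot> dual D) \<otimes> rep)"
proof -
  have "mult H \<otimes> hmul = (\<one> (obj H) \<otimes> hmul) \<cdot> (mult H \<otimes> \<one> (dual D \<odot> dual D))"
    by (simp add: D_normal interchange)
  note split_mult = this
  have "layered [1, -2, 3, -4, 5] [At 1 (HCom (-2) (-5) (-6)), Cross 2, At 1 (Act (-5) 3 7),
      At 0 (Mul 1 7 8), At 1 (HMul (-6) (-4) (-9)), At 0 (Rep 8 (-9) 5 10)]
      = layered [1, -2, 3, -4, 5] [At 2 (Rep 3 (-4) 5 9), At 0 (Rep 1 (-2) 9 10)]"
    by (rule layered_eq[OF Rep_module]) (simp_all add: checks)
  then show ?thesis by (simp add: D_normal split split_mult merge)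
qed

lemma rep_unit: "rep \<cdot> ((eta H \<otimes> hunit \<otimes> \<one> (obj H))) = \<one> (obj H)"
proof -
  have "eta H \<otimes> hunit \<otimes> \<one> (obj H) = (\<one> (obj H) \<otimes> hunit \<otimes> \<one> (obj H)) \<cdot> (eta H \<otimes> \<one> (obj H))"
    using interchange[of "eta H" "\<one> (obj H)" "\<one> (obj H)" "hunit \<otimes> \<one> (obj H)"] by (simp add: D_normal)
  note split_unit = this
  have "layered [1] [At 0 (Unit 2), At 1 (HUnit (-3)), At 0 (Rep 2 (-3) 1 4)]
      = layered [1] []"
    by (rule layered_eq[OF Rep_unit]) (simp_all add: checks)
  then show ?thesis by (simp add: D_normal split_unit merge)
qed

lemma comult_rep: "comult H \<cdot> rep = (\<one> (obj H) \<otimes> rep) \<cdot> ((mult H \<otimes> \<one> (obj H \<odot> dual D \<odot> obj H)) \<cdot>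
    ((\<one> (obj H) \<otimes> \<beta> (obj H \<odot> dual D) (obj H) \<otimes> \<one> (obj H)) \<cdot> ((comult H \<otimes> \<one> (dual D) \<otimes> comult H))))"
proof -
  have "comult H \<otimes> \<one> (dual D) \<otimes> comult H = (\<one> (obj H \<odot> obj H \<odot> dual D) \<otimes> comult H) \<cdot>
      (comult H \<otimes> \<one> (dual D \<odot> obj H))"
    using interchange[of "comult H" "\<one> (obj H \<odot> obj H)" "\<one> (dual D \<odot> obj H)" "\<one> (dual D) \<otimes> comult H"]
    by (simp add: D_normal flip: Tensor_Ident) (simp add: D_normal Tensor_Ident)
  note split_comult = this
  have "layered [1, -2, 3] [At 0 (Rep 1 (-2) 3 4), At 0 (Com 4 5 6)]
      = layered [1, -2, 3] [At 0 (Com 1 9 10), At 3 (Com 3 11 4), Cross 2, Cross 1, At 0 (Mul 9 11 5),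
          At 1 (Rep 10 (-2) 4 6)]"
    by (rule layered_eq[OF Rep_Com]) (simp_all add: checks)
  then show ?thesis by (simp add: D_normal split split_comult Braid_tensor_left merge)
qed

lemma theta_inv_theta: "theta_inv \<cdot> theta = \<one> (obj H \<odot> dual D)"
proof -
  have "layered [1, -2] [At 0 (Th 1 (-2) 3 (-4)), At 0 (ThI 3 (-4) 5 (-6))]
      = layered [1, -2] []"
    by (rule layered_eq[OF Th_ThI]) (simp_all add: checks)
  then show ?thesis by (simp add: D_normal merge)
qed

lemma theta_theta_inv: "theta \<cdot> theta_inv = \<one> (obj H \<odot> dual D)"
proof -
  have "layered [1, -2] [At 0 (ThI 1 (-2) 3 (-4)), At 0 (Th 3 (-4) 5 (-6))]
      = layered [1, -2] []"
    by (rule layered_eq[OF ThI_Th]) (simp_all add: checks)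
  then show ?thesis by (simp add: D_normal merge)
qed

text \<open>
  This identity and the next are those that make \<open>x \<otimes> s \<mapsto> \<Sum> x\<^sub>2 \<otimes> S\<^sup>-\<^sup>1(x\<^sub>1) \<cdot> s\<close> inverse to
  \<open>x \<otimes> s \<mapsto> \<Sum> x\<^sub>2 \<otimes> x\<^sub>1 \<cdot> s\<close>.
\<close>

lemma antipode_inv_left_cop: "(\<one> (obj H) \<otimes> mult H) \<cdot> ((((\<one> (obj H) \<otimes> antipode_inv) \<cdot>
    ((\<beta> (obj H) (obj H) \<cdot> comult H))) \<otimes> \<one> (obj H)) \<cdot> ((\<beta> (obj H) (obj H) \<cdot> comult H)))
        = (\<one> (obj H) \<otimes> eta H)"
proof -
  have "layered [1] [At 0 (Com 1 2 3), Cross 0, At 0 (Com 3 4 5), Cross 0, At 1 (Inv 4 6),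
      At 1 (Mul 6 2 7)]
      = layered [1] [At 1 (Unit 4)]"
    by (rule layered_eq[OF Inv_left_coaction]) (simp_all add: checks)
  then show ?thesis by (simp add: D_normal split merge)
qed

lemma antipode_inv_right_cop: "(\<one> (obj H) \<otimes> mult H) \<cdot> (((\<beta> (obj H) (obj H) \<cdot> comult H) \<otimes> \<one> (obj H)) \<cdot>
    ((\<one> (obj H) \<otimes> antipode_inv) \<cdot> ((\<beta> (obj H) (obj H) \<cdot> comult H)))) = (\<one> (obj H) \<otimes> eta H)"
proof -
  have "layered [1] [At 0 (Com 1 2 3), Cross 0, At 1 (Inv 2 6), At 0 (Com 3 4 5), Cross 0,
      At 1 (Mul 4 6 7)]
      = layered [1] [At 1 (Unit 2)]"
    by (rule layered_eq[OF Inv_right_coaction]) (simp_all add: checks)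
  then show ?thesis by (simp add: D_normal split merge)
qed

end

section \<open>Module algebras: passing the base algebra\<close>

locale smash_duality = finite_hopf \<C> H D
  for \<C> :: "('o, 'm) braided_category" (structure) and H :: "('o, 'm) hopf_data"
      and D :: "('o, 'm) dual_data" +
  fixes R :: "('o, 'm) algebra_data" and \<alpha> :: 'm
  assumes module_alg: "module_algebra \<C> H R \<alpha>"
begin

abbreviation "A \<equiv> obj R"
abbreviation "V \<equiv> obj H"
abbreviation "W \<equiv> dual D"

lemma R_typing:
  "A \<in> Obj \<C>"
  "mult R \<in> Arr \<C>" "Dom \<C> (mult R) = A \<odot> A" "Cod \<C> (mult R) = A"
  "eta R \<in> Arr \<C>" "Dom \<C> (eta R) = \<I>" "Cod \<C> (eta R) = A"
  "\<alpha> \<in> Arr \<C>" "Dom \<C> \<alpha> = V \<odot> A" "Cod \<C> \<alpha> = A"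
  using module_alg by (simp_all add: module_algebra_def left_module_def algebra_def in_hom_def)

lemmas R_normal = D_normal R_typing
lemmas NF = R_normal split merge

lemma R_axioms:
  "mult R \<cdot> (mult R \<otimes> \<one> A) = mult R \<cdot> (\<one> A \<otimes> mult R)"
  "mult R \<cdot> (eta R \<otimes> \<one> A) = \<one> A"
  "mult R \<cdot> (\<one> A \<otimes> eta R) = \<one> A"
  "\<alpha> \<cdot> (\<one> V \<otimes> \<alpha>) = \<alpha> \<cdot> (mult H \<otimes> \<one> A)"
  "\<alpha> \<cdot> (eta H \<otimes> \<one> A) = \<one> A"
  "\<alpha> \<cdot> (\<one> V \<otimes> eta R) = eta R \<cdot> counit H"
  using module_alg by (simp_all add: module_algebra_def left_module_def algebra_def)

lemma action_mult: "\<alpha> \<cdot> (\<one> V \<otimes> mult R) = mult R \<cdot> ((\<alpha> \<otimes> \<one> A) \<cdot> ((\<one> (V \<odot> A) \<otimes> \<alpha>) \<cdot>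
    ((\<one> V \<otimes> \<beta> V A \<otimes> \<one> A) \<cdot> (comult H \<otimes> \<one> (A \<odot> A)))))"
proof -
  have "\<alpha> \<otimes> \<alpha> = (\<alpha> \<otimes> \<one> A) \<cdot> (\<one> (V \<odot> A) \<otimes> \<alpha>)" by (simp add: R_normal interchange)
  then show ?thesis using module_alg by (simp add: module_algebra_def R_normal merge)
qed

text \<open>
  Moves \<open>R\<close> to the left past the word \<open>Y\<close> after letting the factor \<open>H\<close> of the output \<open>V \<odot> Y\<close>
  of \<open>f\<close> act on it. All maps below that move \<open>R\<close> are of this form: the crossing inside a smash
  product is the case of the coproduct, and a plain braiding is the case of the unit.
\<close>

definition cross_via :: "'o \<Rightarrow> 'm \<Rightarrow> 'm" where
  "cross_via Y f = (\<alpha> \<otimes> \<one> Y) \<cdot> ((\<one> V \<otimes> \<beta> Y A) \<cdot> (f \<otimes> \<one> A))"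

lemma cross_via_typing:
  assumes "f \<in> Arr \<C>" "Cod \<C> f = V \<odot> Y" "Y \<in> Obj \<C>"
  shows "cross_via Y f \<in> Arr \<C>" "Dom \<C> (cross_via Y f) = Dom \<C> f \<odot> A" "Cod \<C> (cross_via Y f) = A \<odot> Y"
  using assms by (simp_all add: cross_via_def R_normal)

lemma cross_via_pre:
  assumes "f \<in> Arr \<C>" "Cod \<C> f = V \<odot> Y" "Y \<in> Obj \<C>" "k \<in> Arr \<C>" "Cod \<C> k = Dom \<C> f"
  shows "cross_via Y f \<cdot> (k \<otimes> \<one> A) = cross_via Y (f \<cdot> k)"
  using assms by (simp add: cross_via_def R_normal interchange)

lemma cross_via_post:
  assumes "f \<in> Arr \<C>" "Cod \<C> f = V \<odot> Y" "Y \<in> Obj \<C>" "k \<in> Arr \<C>" "Dom \<C> k = Y" "Cod \<C> k = Y'"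
      "Y' \<in> Obj \<C>"
  shows "(\<one> A \<otimes> k) \<cdot> cross_via Y f = cross_via Y' ((\<one> V \<otimes> k) \<cdot> f)"
proof -
  have 1: "(\<one> A \<otimes> k) \<cdot> (\<alpha> \<otimes> \<one> Y) = (\<alpha> \<otimes> \<one> Y') \<cdot> (\<one> (V \<odot> A) \<otimes> k)"
    using exchange[of \<alpha> k "V \<odot> A" A Y Y'] assms by (simp add: R_normal)
  have "(\<one> A \<otimes> k) \<cdot> \<beta> Y A = \<beta> Y' A \<cdot> (k \<otimes> \<one> A)"
    using Braid_natural'[of k "\<one> A"] assms by (simp add: R_normal)
  then have "\<one> V \<otimes> ((\<one> A \<otimes> k) \<cdot> \<beta> Y A) = \<one> V \<otimes> (\<beta> Y' A \<cdot> (k \<otimes> \<one> A))" by simp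
  then have 2: "(\<one> (V \<odot> A) \<otimes> k) \<cdot> (\<one> V \<otimes> \<beta> Y A) = (\<one> V \<otimes> \<beta> Y' A) \<cdot> (\<one> V \<otimes> k \<otimes> \<one> A)"
    using assms by (simp add: NF)
  show ?thesis
    using assms by (simp add: cross_via_def NF 1 tail[OF 1] 2 tail[OF 2])
qed

text \<open>
  Two successive moves amount to one, with the acting elements multiplied. The braiding
  \<open>\<beta> Y V\<close> appears because the second acting element has to pass the word \<open>Y\<close>, which is
  naturality of the braiding with respect to \<open>\<alpha>\<close>.
\<close>

lemma cross_via_comp:
  assumes f: "f \<in> Arr \<C>" "Dom \<C> f = Z" "Cod \<C> f = V \<odot> Y" and g: "g \<in> Arr \<C>" "Cod \<C> g = V \<odot> Y'"
    and O: "Y \<in> Obj \<C>" "Y' \<in> Obj \<C>" "Z \<in> Obj \<C>"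
  shows "(cross_via Y f \<otimes> \<one> Y') \<cdot> (\<one> Z \<otimes> cross_via Y' g) =
    cross_via (Y \<odot> Y') ((mult H \<otimes> \<one> (Y \<odot> Y')) \<cdot> ((\<one> V \<otimes> \<beta> Y V \<otimes> \<one> Y') \<cdot> (f \<otimes> g)))"
proof -
  note h = f g O
  have 1: "(f \<otimes> \<one> (A \<odot> Y')) \<cdot> (\<one> Z \<otimes> \<alpha> \<otimes> \<one> Y') = (\<one> (V \<odot> Y) \<otimes> \<alpha> \<otimes> \<one> Y') \<cdot> (f \<otimes> \<one> (V \<odot> A \<odot> Y'))"
    using exchange[of f "\<alpha> \<otimes> \<one> Y'" Z "V \<odot> Y" "V \<odot> A \<odot> Y'" "A \<odot> Y'"] h by (simp add: R_normal)
  have "\<beta> Y A \<cdot> (\<one> Y \<otimes> \<alpha>) = (\<alpha> \<otimes> \<one> Y) \<cdot> ((\<one> V \<otimes> \<beta> Y A) \<cdot> (\<beta> Y V \<otimes> \<one> A))"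
    using Braid_natural'[of "\<one> Y" \<alpha>] h by (simp add: R_normal Braid_tensor_right)
  then have "\<one> V \<otimes> (\<beta> Y A \<cdot> (\<one> Y \<otimes> \<alpha>)) \<otimes> \<one> Y' = \<one> V \<otimes> ((\<alpha> \<otimes> \<one> Y) \<cdot> ((\<one> V \<otimes> \<beta> Y A) \<cdot>
      (\<beta> Y V \<otimes> \<one> A))) \<otimes> \<one> Y'"
    by simp
  then have 2: "(\<one> V \<otimes> \<beta> Y A \<otimes> \<one> Y') \<cdot> (\<one> (V \<odot> Y) \<otimes> \<alpha> \<otimes> \<one> Y')
      = (\<one> V \<otimes> \<alpha> \<otimes> \<one> (Y \<odot> Y')) \<cdot> ((\<one> (V \<odot> V) \<otimes> \<beta> Y A \<otimes> \<one> Y') \<cdot> (\<one> V \<otimes> \<beta> Y V \<otimes> \<one> (A \<odot> Y')))"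
    using h by (simp add: NF)
  have "(\<alpha> \<cdot> (\<one> V \<otimes> \<alpha>)) \<otimes> \<one> (Y \<odot> Y') = (\<alpha> \<cdot> (mult H \<otimes> \<one> A)) \<otimes> \<one> (Y \<odot> Y')"
    by (simp add: R_axioms)
  then have 3: "(\<alpha> \<otimes> \<one> (Y \<odot> Y')) \<cdot> (\<one> V \<otimes> \<alpha> \<otimes> \<one> (Y \<odot> Y')) = (\<alpha> \<otimes> \<one> (Y \<odot> Y')) \<cdot>
      (mult H \<otimes> \<one> (A \<odot> Y \<odot> Y'))"
    using h by (simp add: NF)
  have 4: "(f \<otimes> \<one> (V \<odot> A \<odot> Y')) \<cdot> (\<one> (Z \<odot> V) \<otimes> \<beta> Y' A) = (\<one> (V \<odot> Y \<odot> V) \<otimes> \<beta> Y' A) \<cdot>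
      (f \<otimes> \<one> (V \<odot> Y' \<odot> A))"
    using exchange[of f "\<one> V \<otimes> \<beta> Y' A" Z "V \<odot> Y" "V \<odot> Y' \<odot> A" "V \<odot> A \<odot> Y'"] h by (simp add: NF)
  have 5: "(\<one> V \<otimes> \<beta> Y V \<otimes> \<one> (A \<odot> Y')) \<cdot> (\<one> (V \<odot> Y \<odot> V) \<otimes> \<beta> Y' A)
      = (\<one> (V \<odot> V \<odot> Y) \<otimes> \<beta> Y' A) \<cdot> (\<one> V \<otimes> \<beta> Y V \<otimes> \<one> (Y' \<odot> A))"
    using exchange[of "\<one> V \<otimes> \<beta> Y V" "\<beta> Y' A" "V \<odot> Y \<odot> V" "V \<odot> V \<odot> Y" "Y' \<odot> A" "A \<odot> Y'"] h
    by (simp add: NF)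
  have 6: "(mult H \<otimes> \<one> (A \<odot> Y \<odot> Y')) \<cdot> (\<one> (V \<odot> V) \<otimes> \<beta> Y A \<otimes> \<one> Y')
      = (\<one> V \<otimes> \<beta> Y A \<otimes> \<one> Y') \<cdot> (mult H \<otimes> \<one> (Y \<odot> A \<odot> Y'))"
    using exchange[of "mult H" "\<beta> Y A \<otimes> \<one> Y'" "V \<odot> V" V "Y \<odot> A \<odot> Y'" "A \<odot> Y \<odot> Y'"] h
    by (simp add: NF)
  have 7: "(mult H \<otimes> \<one> (Y \<odot> A \<odot> Y')) \<cdot> (\<one> (V \<odot> V \<odot> Y) \<otimes> \<beta> Y' A)
      = (\<one> (V \<odot> Y) \<otimes> \<beta> Y' A) \<cdot> (mult H \<otimes> \<one> (Y \<odot> Y' \<odot> A))"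
    using exchange[of "mult H" "\<one> Y \<otimes> \<beta> Y' A" "V \<odot> V" V "Y \<odot> Y' \<odot> A" "Y \<odot> A \<odot> Y'"] h
    by (simp add: NF)
  have 8: "f \<otimes> g = (f \<otimes> \<one> (V \<odot> Y')) \<cdot> (\<one> Z \<otimes> g)"
    using h by (simp add: R_normal interchange)
  show ?thesis
    unfolding 8 using h
    by (simp add: cross_via_def NF Braid_tensor_left 1 tail[OF 1] 2 tail[OF 2] 3 tail[OF 3] 4
        tail[OF 4]
        5 tail[OF 5] 6 tail[OF 6] 7 tail[OF 7])
qed

text \<open>
  The map \<open>x \<otimes> s \<mapsto> x s = \<Sum> (x\<^sub>1 \<cdot> s) # x\<^sub>2\<close>, the right multiplication of \<open>R\<close> on \<open>H \<subseteq> R # H\<close>.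
\<close>

definition cross :: 'm where "cross = cross_via V (comult H)"

lemma cross_typing: "cross \<in> Arr \<C>" "Dom \<C> cross = V \<odot> A" "Cod \<C> cross = A \<odot> V"
  by (simp_all add: cross_def cross_via_typing R_normal)

text \<open>
  Right multiplication in \<open>R # H\<close> is associative on \<open>R\<close>: \<open>x (s s') = (x s) s'\<close>. This is the
  module algebra axiom together with coassociativity.
\<close>

lemma cross_mult: "cross \<cdot> (\<one> V \<otimes> mult R) = (mult R \<otimes> \<one> V) \<cdot> ((\<one> A \<otimes> cross) \<cdot> (cross \<otimes> \<one> A))"
proof -
  have 1: "(comult H \<otimes> \<one> A) \<cdot> (\<one> V \<otimes> mult R) = (\<one> (V \<odot> V) \<otimes> mult R) \<cdot> (comult H \<otimes> \<one> (A \<odot> A))"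
    by (rule exchange) (simp_all add: R_normal)
  have "\<beta> V A \<cdot> (\<one> V \<otimes> mult R) = (mult R \<otimes> \<one> V) \<cdot> ((\<one> A \<otimes> \<beta> V A) \<cdot> (\<beta> V A \<otimes> \<one> A))"
    using Braid_natural'[of "\<one> V" "mult R"] by (simp add: R_normal Braid_tensor_right)
  then have "\<one> V \<otimes> (\<beta> V A \<cdot> (\<one> V \<otimes> mult R)) = \<one> V \<otimes> ((mult R \<otimes> \<one> V) \<cdot> ((\<one> A \<otimes> \<beta> V A) \<cdot>
      (\<beta> V A \<otimes> \<one> A)))"
    by simp
  then have 2: "(\<one> V \<otimes> \<beta> V A) \<cdot> (\<one> (V \<odot> V) \<otimes> mult R)
      = (\<one> V \<otimes> mult R \<otimes> \<one> V) \<cdot> ((\<one> (V \<odot> A) \<otimes> \<beta> V A) \<cdot> (\<one> V \<otimes> \<beta> V A \<otimes> \<one> A))"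
    by (simp add: NF)
  have "(\<alpha> \<cdot> (\<one> V \<otimes> mult R)) \<otimes> \<one> V = (mult R \<cdot> ((\<alpha> \<otimes> \<one> A) \<cdot> ((\<one> (V \<odot> A) \<otimes> \<alpha>) \<cdot>
    ((\<one> V \<otimes> \<beta> V A \<otimes> \<one> A) \<cdot> (comult H \<otimes> \<one> (A \<odot> A)))))) \<otimes> \<one> V"
    unfolding action_mult ..
  then have 3: "(\<alpha> \<otimes> \<one> V) \<cdot> (\<one> V \<otimes> mult R \<otimes> \<one> V) = (mult R \<otimes> \<one> V) \<cdot> ((\<alpha> \<otimes> \<one> (A \<odot> V)) \<cdot>
      ((\<one> (V \<odot> A) \<otimes> \<alpha> \<otimes> \<one> V) \<cdot>
    ((\<one> V \<otimes> \<beta> V A \<otimes> \<one> (A \<odot> V)) \<cdot> (comult H \<otimes> \<one> (A \<odot> A \<odot> V)))))"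
    by (simp add: NF)
  have 4: "(\<one> A \<otimes> comult H \<otimes> \<one> A) \<cdot> (\<alpha> \<otimes> \<one> (V \<odot> A)) = (\<alpha> \<otimes> \<one> (V \<odot> V \<odot> A)) \<cdot>
      (\<one> (V \<odot> A) \<otimes> comult H \<otimes> \<one> A)"
    using exchange[of \<alpha> "comult H \<otimes> \<one> A" "V \<odot> A" A "V \<odot> A" "V \<odot> V \<odot> A"] by (simp add: NF)
  have 5: "(\<one> (A \<odot> V) \<otimes> \<beta> V A) \<cdot> (\<alpha> \<otimes> \<one> (V \<odot> V \<odot> A)) = (\<alpha> \<otimes> \<one> (V \<odot> A \<odot> V)) \<cdot> (\<one> (V \<odot> A \<odot> V) \<otimes> \<beta> V A)"
    using exchange[of \<alpha> "\<one> V \<otimes> \<beta> V A" "V \<odot> A" A "V \<odot> V \<odot> A" "V \<odot> A \<odot> V"] by (simp add: NF)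
  have 6: "(\<one> A \<otimes> \<alpha> \<otimes> \<one> V) \<cdot> (\<alpha> \<otimes> \<one> (V \<odot> A \<odot> V)) = (\<alpha> \<otimes> \<one> (A \<odot> V)) \<cdot> (\<one> (V \<odot> A) \<otimes> \<alpha> \<otimes> \<one> V)"
    using exchange[of \<alpha> "\<alpha> \<otimes> \<one> V" "V \<odot> A" A "V \<odot> A \<odot> V" "A \<odot> V"] by (simp add: NF)
  have "(\<one> A \<otimes> comult H) \<cdot> \<beta> V A = (\<beta> V A \<otimes> \<one> V) \<cdot> ((\<one> V \<otimes> \<beta> V A) \<cdot> (comult H \<otimes> \<one> A))"
    using Braid_natural'[of "comult H" "\<one> A"] by (simp add: R_normal Braid_tensor_left)
  then have "\<one> V \<otimes> ((\<one> A \<otimes> comult H) \<cdot> \<beta> V A) \<otimes> \<one> A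
      = \<one> V \<otimes> ((\<beta> V A \<otimes> \<one> V) \<cdot> ((\<one> V \<otimes> \<beta> V A) \<cdot> (comult H \<otimes> \<one> A))) \<otimes> \<one> A" by simp
  then have 7: "(\<one> (V \<odot> A) \<otimes> comult H \<otimes> \<one> A) \<cdot> (\<one> V \<otimes> \<beta> V A \<otimes> \<one> A)
      = (\<one> V \<otimes> \<beta> V A \<otimes> \<one> (V \<odot> A)) \<cdot> ((\<one> (V \<odot> V) \<otimes> \<beta> V A \<otimes> \<one> A) \<cdot> (\<one> V \<otimes> comult H \<otimes> \<one> (A \<odot> A)))"
    by (simp add: NF)
  have "((\<one> V \<otimes> comult H) \<cdot> comult H) \<otimes> \<one> (A \<odot> A) = ((comult H \<otimes> \<one> V) \<cdot> comult H) \<otimes> \<one> (A \<odot> A)"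
    by (simp add: hopf_axioms)
  then have 8: "(\<one> V \<otimes> comult H \<otimes> \<one> (A \<odot> A)) \<cdot> (comult H \<otimes> \<one> (A \<odot> A))
      = (comult H \<otimes> \<one> (V \<odot> A \<odot> A)) \<cdot> (comult H \<otimes> \<one> (A \<odot> A))"
    by (simp add: NF)
  have 9: "(\<one> (V \<odot> V) \<otimes> \<beta> V A \<otimes> \<one> A) \<cdot> (comult H \<otimes> \<one> (V \<odot> A \<odot> A)) = (comult H \<otimes> \<one> (A \<odot> V \<odot> A)) \<cdot>
      (\<one> V \<otimes> \<beta> V A \<otimes> \<one> A)"
    using exchange[of "comult H" "\<beta> V A \<otimes> \<one> A" V "V \<odot> V" "V \<odot> A \<odot> A" "A \<odot> V \<odot> A"] by (simp add: NF)
  have 10: "(comult H \<otimes> \<one> (A \<odot> A \<odot> V)) \<cdot> (\<one> (V \<odot> A) \<otimes> \<beta> V A) = (\<one> (V \<odot> V \<odot> A) \<otimes> \<beta> V A) \<cdot>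
      (comult H \<otimes> \<one> (A \<odot> V \<odot> A))"
    using exchange[of "comult H" "\<one> A \<otimes> \<beta> V A" V "V \<odot> V" "A \<odot> V \<odot> A" "A \<odot> A \<odot> V"] by (simp add: NF)
  have 11: "(\<one> V \<otimes> \<beta> V A \<otimes> \<one> (A \<odot> V)) \<cdot> (\<one> (V \<odot> V \<odot> A) \<otimes> \<beta> V A)
      = (\<one> (V \<odot> A \<odot> V) \<otimes> \<beta> V A) \<cdot> (\<one> V \<otimes> \<beta> V A \<otimes> \<one> (V \<odot> A))"
    using exchange[of "\<one> V \<otimes> \<beta> V A" "\<beta> V A" "V \<odot> V \<odot> A" "V \<odot> A \<odot> V" "V \<odot> A" "A \<odot> V"] by (simp add: NF)
  have L: "cross \<cdot> (\<one> V \<otimes> mult R) = (mult R \<otimes> \<one> V) \<cdot> ((\<alpha> \<otimes> \<one> (A \<odot> V)) \<cdot> ((\<one> (V \<odot> A) \<otimes> \<alpha> \<otimes> \<one> V) \<cdot>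
    ((\<one> (V \<odot> A \<odot> V) \<otimes> \<beta> V A) \<cdot> ((\<one> V \<otimes> \<beta> V A \<otimes> \<one> (V \<odot> A)) \<cdot>
      ((comult H \<otimes> \<one> (A \<odot> V \<odot> A)) \<cdot> ((\<one> V \<otimes> \<beta> V A \<otimes> \<one> A) \<cdot> (comult H \<otimes> \<one> (A \<odot> A))))))))"
    by (simp add: cross_def cross_via_def NF 1 2 tail[OF 2] tail[OF 3] tail[OF 10] tail[OF 11])
  have M: "(\<one> A \<otimes> cross) \<cdot> (cross \<otimes> \<one> A) = (\<alpha> \<otimes> \<one> (A \<odot> V)) \<cdot> ((\<one> (V \<odot> A) \<otimes> \<alpha> \<otimes> \<one> V) \<cdot>
    ((\<one> (V \<odot> A \<odot> V) \<otimes> \<beta> V A) \<cdot> ((\<one> V \<otimes> \<beta> V A \<otimes> \<one> (V \<odot> A)) \<cdot>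
      ((comult H \<otimes> \<one> (A \<odot> V \<odot> A)) \<cdot> ((\<one> V \<otimes> \<beta> V A \<otimes> \<one> A) \<cdot> (comult H \<otimes> \<one> (A \<odot> A)))))))"
    by (simp add: cross_def cross_via_def NF tail[OF 4] tail[OF 5] tail[OF 6] tail[OF 7] 8 tail[OF 9])
  show ?thesis unfolding L M ..
qed

definition act_after :: "'m \<Rightarrow> 'm" where
  "act_after f = (\<one> V \<otimes> \<alpha>) \<cdot> (f \<otimes> \<one> A)"

lemma act_after_typing:
  assumes "f \<in> Arr \<C>" "Dom \<C> f = V" "Cod \<C> f = V \<odot> V"
  shows "act_after f \<in> Arr \<C>" "Dom \<C> (act_after f) = V \<odot> A" "Cod \<C> (act_after f) = V \<odot> A"
  using assms by (simp_all add: act_after_def R_normal)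

lemma act_after_comp:
  assumes f: "f \<in> Arr \<C>" "Dom \<C> f = V" "Cod \<C> f = V \<odot> V"
    and g: "g \<in> Arr \<C>" "Dom \<C> g = V" "Cod \<C> g = V \<odot> V"
  shows "act_after f \<cdot> act_after g = act_after ((\<one> V \<otimes> mult H) \<cdot> ((f \<otimes> \<one> V) \<cdot> g))"
proof -
  have 1: "(f \<otimes> \<one> A) \<cdot> (\<one> V \<otimes> \<alpha>) = (\<one> (V \<odot> V) \<otimes> \<alpha>) \<cdot> (f \<otimes> \<one> (V \<odot> A))"
    by (rule exchange) (simp_all add: R_normal f)
  have "\<one> V \<otimes> (\<alpha> \<cdot> (\<one> V \<otimes> \<alpha>)) = \<one> V \<otimes> (\<alpha> \<cdot> (mult H \<otimes> \<one> A))" by (simp add: R_axioms)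
  then have 2: "(\<one> V \<otimes> \<alpha>) \<cdot> (\<one> (V \<odot> V) \<otimes> \<alpha>) = (\<one> V \<otimes> \<alpha>) \<cdot> (\<one> V \<otimes> mult H \<otimes> \<one> A)"
    by (simp add: NF)
  show ?thesis using f g by (simp add: act_after_def NF tail[OF 1] tail[OF 2])
qed

lemma act_after_unit: "act_after (\<one> V \<otimes> eta H) = \<one> (V \<odot> A)"
proof -
  have "\<one> V \<otimes> (\<alpha> \<cdot> (eta H \<otimes> \<one> A)) = \<one> V \<otimes> \<one> A" by (simp add: R_axioms)
  then show ?thesis by (simp add: act_after_def NF)
qed

definition comult_cop :: 'm where "comult_cop = \<beta> V V \<cdot> comult H"

lemma comult_cop_typing: "comult_cop \<in> Arr \<C>" "Dom \<C> comult_cop = V" "Cod \<C> comult_cop = V \<odot> V"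
  by (simp_all add: comult_cop_def R_normal)

text \<open>
  Pulling the action through the braiding exchanges the two legs of the coproduct. The
  resulting form involves \<open>R\<close> only through the action, which makes it easy to invert.
\<close>

lemma cross_act_after: "cross = \<beta> V A \<cdot> act_after comult_cop"
proof -
  have 1: "\<beta> V A \<cdot> (\<one> V \<otimes> \<alpha>) = (\<alpha> \<otimes> \<one> V) \<cdot> ((\<one> V \<otimes> \<beta> V A) \<cdot> (\<beta> V V \<otimes> \<one> A))"
    using Braid_natural'[of "\<one> V" \<alpha>] by (simp add: R_normal Braid_tensor_right)
  have "(\<beta> V V \<cdot> \<beta> V V) \<otimes> \<one> A = \<one> (V \<odot> V) \<otimes> \<one> A" by (simp add: involutive)
  then have 2: "(\<beta> V V \<otimes> \<one> A) \<cdot> (\<beta> V V \<otimes> \<one> A) = \<one> (V \<odot> V \<odot> A)" by (simp add: NF)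
  show ?thesis by (simp add: cross_def cross_via_def act_after_def comult_cop_def NF tail[OF 1]
      tail[OF 2])
qed

text \<open>
  The inverse is \<open>r \<otimes> y \<mapsto> \<Sum> y\<^sub>2 \<otimes> S\<^sup>-\<^sup>1(y\<^sub>1) \<cdot> r\<close> after the inverse braiding.
\<close>

lemma cross_inverse_exists: "\<exists>K. K \<in> Arr \<C> \<and> Dom \<C> K = A \<odot> V \<and> Cod \<C> K = V \<odot> A \<and>
    K \<cdot> cross = \<one> (V \<odot> A) \<and> cross \<cdot> K = \<one> (A \<odot> V)"
proof -
  obtain braid_inv
      where braid_inv: "braid_inv \<in> Arr \<C>" "Dom \<C> braid_inv = A \<odot> V" "Cod \<C> braid_inv = V \<odot> A"
    "braid_inv \<cdot> \<beta> V A = \<one> (V \<odot> A)" "\<beta> V A \<cdot> braid_inv = \<one> (A \<odot> V)"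
    using Braid_iso[of V A] by (auto simp: inverse_arrows_def in_hom_def R_normal)
  let ?T = "(\<one> V \<otimes> antipode_inv) \<cdot> comult_cop"
  have T: "?T \<in> Arr \<C>" "Dom \<C> ?T = V" "Cod \<C> ?T = V \<odot> V" by (simp_all add: R_normal comult_cop_typing)
  have l: "act_after ?T \<cdot> act_after comult_cop = \<one> (V \<odot> A)"
    unfolding act_after_comp[OF T comult_cop_typing] using antipode_inv_left_cop
    by (simp add: comult_cop_def act_after_unit)
  have r: "act_after comult_cop \<cdot> act_after ?T = \<one> (V \<odot> A)"
    unfolding act_after_comp[OF comult_cop_typing T] using antipode_inv_right_cop
    by (simp add: comult_cop_def act_after_unit)
  note t = act_after_typing[OF T] act_after_typing[OF comult_cop_typing] braid_inv
  have "(act_after ?T \<cdot> braid_inv) \<cdot> cross = act_after ?T \<cdot> ((braid_inv \<cdot> \<beta> V A) \<cdot>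
      act_after comult_cop)"
    unfolding cross_act_after using t(1-9) by (simp add: R_normal)
  then have 1: "(act_after ?T \<cdot> braid_inv) \<cdot> cross = \<one> (V \<odot> A)"
    unfolding braid_inv(4) using t l by (simp add: R_normal)
  have "cross \<cdot> (act_after ?T \<cdot> braid_inv) = \<beta> V A \<cdot> ((act_after comult_cop \<cdot> act_after ?T) \<cdot>
      braid_inv)"
    unfolding cross_act_after using t by (simp add: R_normal)
  then have 2: "cross \<cdot> (act_after ?T \<cdot> braid_inv) = \<one> (A \<odot> V)"
    unfolding r using t by (simp add: R_normal)
  show ?thesis using 1 2 t by (intro exI[of _ "act_after ?T \<cdot> braid_inv"]) (simp add: R_normal)
qed

definition cross_inv :: 'm where
  "cross_inv = (SOME K. K \<in> Arr \<C> \<and> Dom \<C> K = A \<odot> V \<and> Cod \<C> K = V \<odot> A \<and>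
    K \<cdot> cross = \<one> (V \<odot> A) \<and> cross \<cdot> K = \<one> (A \<odot> V))"

lemma cross_inv: "cross_inv \<in> Arr \<C>" "Dom \<C> cross_inv = A \<odot> V" "Cod \<C> cross_inv = V \<odot> A"
    "cross_inv \<cdot> cross = \<one> (V \<odot> A)" "cross \<cdot> cross_inv = \<one> (A \<odot> V)"
  using someI_ex[OF cross_inverse_exists] unfolding cross_inv_def by auto

lemma cross_eta: "cross \<cdot> (\<one> V \<otimes> eta R) = eta R \<otimes> \<one> V"
proof -
  have 1: "(comult H \<otimes> \<one> A) \<cdot> (\<one> V \<otimes> eta R) = (\<one> (V \<odot> V) \<otimes> eta R) \<cdot> comult H"
    using exchange[of "comult H" "eta R" V "V \<odot> V" \<I> A] by (simp add: R_normal)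
  have "\<beta> V A \<cdot> (\<one> V \<otimes> eta R) = eta R \<otimes> \<one> V"
    using Braid_natural'[of "\<one> V" "eta R"] by (simp add: R_normal Braid_unit_right)
  then have "\<one> V \<otimes> (\<beta> V A \<cdot> (\<one> V \<otimes> eta R)) = \<one> V \<otimes> eta R \<otimes> \<one> V" by simp
  then have 2: "(\<one> V \<otimes> \<beta> V A) \<cdot> (\<one> (V \<odot> V) \<otimes> eta R) = \<one> V \<otimes> eta R \<otimes> \<one> V"
    by (simp add: NF)
  have "(\<alpha> \<cdot> (\<one> V \<otimes> eta R)) \<otimes> \<one> V = (eta R \<cdot> counit H) \<otimes> \<one> V" by (simp add: R_axioms)
  then have 3: "(\<alpha> \<otimes> \<one> V) \<cdot> (\<one> V \<otimes> eta R \<otimes> \<one> V) = (eta R \<otimes> \<one> V) \<cdot> (counit H \<otimes> \<one> V)"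
    by (simp add: NF)
  show ?thesis
    by (simp add: cross_def cross_via_def NF 1 tail[OF 2] tail[OF 3] hopf_axioms)
qed

text \<open>
  The element \<open>h # \<phi>\<close> passes \<open>R\<close>: \<open>\<phi>\<close> acts trivially on \<open>R\<close> and is merely braided past it.
\<close>

definition cross_double :: 'm where "cross_double = (cross \<otimes> \<one> W) \<cdot> (\<one> V \<otimes> \<beta> W A)"

lemma cross_double_typing: "cross_double \<in> Arr \<C>" "Dom \<C> cross_double = V \<odot> W \<odot> A"
    "Cod \<C> cross_double = A \<odot> V \<odot> W"
  by (simp_all add: cross_double_def R_normal cross_typing)

lemma cross_double_cross_via: "cross_double = cross_via (V \<odot> W) (comult H \<otimes> \<one> W)"
proof -
  have 1: "(comult H \<otimes> \<one> (A \<odot> W)) \<cdot> (\<one> V \<otimes> \<beta> W A) = (\<one> (V \<odot> V) \<otimes> \<beta> W A) \<cdot> (comult H \<otimes> \<one> (W \<odot> A))"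
    by (rule exchange) (simp_all add: R_normal)
  show ?thesis
    by (simp add: cross_double_def cross_def cross_via_def NF 1 Braid_tensor_left)
qed

text \<open>
  The action of the Heisenberg double on \<open>R # H\<close> commutes with right multiplication by \<open>R\<close>; by
  \<open>cross_via_comp\<close> this is \<open>comult_rep\<close>, an identity in \<open>H\<close> and \<open>H\<^sup>*\<close> alone.
\<close>

lemma cross_rep: "cross \<cdot> (rep \<otimes> \<one> A) = (\<one> A \<otimes> rep) \<cdot> ((cross_double \<otimes> \<one> V) \<cdot> (\<one> (V \<odot> W) \<otimes> cross))"
proof -
  let ?f = "comult H \<otimes> \<one> W"
  have "(cross_double \<otimes> \<one> V) \<cdot> (\<one> (V \<odot> W) \<otimes> cross) = cross_via ((V \<odot> W) \<odot> V)
      ((mult H \<otimes> \<one> ((V \<odot> W) \<odot> V)) \<cdot> ((\<one> V \<otimes> \<beta> (V \<odot> W) V \<otimes> \<one> V) \<cdot> (?f \<otimes> comult H)))"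
    unfolding cross_double_cross_via cross_def by (rule cross_via_comp) (simp_all add: R_normal)
  then have "(\<one> A \<otimes> rep) \<cdot> ((cross_double \<otimes> \<one> V) \<cdot> (\<one> (V \<odot> W) \<otimes> cross)) = cross_via V ((\<one> V \<otimes> rep) \<cdot>
      ((mult H \<otimes> \<one> ((V \<odot> W) \<odot> V)) \<cdot> ((\<one> V \<otimes> \<beta> (V \<odot> W) V \<otimes> \<one> V) \<cdot> (?f \<otimes> comult H))))"
    using cross_via_post[of "(mult H \<otimes> \<one> ((V \<odot> W) \<odot> V)) \<cdot> ((\<one> V \<otimes> \<beta> (V \<odot> W) V \<otimes> \<one> V) \<cdot>
        (?f \<otimes> comult H))"
      "(V \<odot> W) \<odot> V" rep V] by (simp add: R_normal)
  also have "\<dots> = cross_via V (comult H \<cdot> rep)"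
    unfolding comult_rep by (simp add: R_normal)
  also have "\<dots> = cross \<cdot> (rep \<otimes> \<one> A)"
    unfolding cross_def using cross_via_pre[of "comult H" V rep] by (simp add: R_normal)
  finally show ?thesis by simp
qed

definition heis_mult :: 'm where
  "heis_mult = (mult H \<otimes> hmul) \<cdot> ((\<one> V \<otimes> act \<otimes> \<one> (W \<odot> W)) \<cdot>
    ((\<one> (V \<odot> W) \<otimes> \<beta> W V \<otimes> \<one> W) \<cdot> (\<one> V \<otimes> hcom \<otimes> \<one> (V \<odot> W))))"

lemma heis_mult_typing: "heis_mult \<in> Arr \<C>" "Dom \<C> heis_mult = V \<odot> W \<odot> V \<odot> W"
    "Cod \<C> heis_mult = V \<odot> W"
  by (simp_all add: heis_mult_def R_normal)

section \<open>The double smash product\<close>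

definition double_smash :: "('o, 'm) algebra_data" where
  "double_smash = smash \<C> (smash \<C> R H \<alpha>) (hat_dual \<C> H D) (dual_action_smash \<C> R H D)"

lemma mult_smash: "mult (smash \<C> R H \<alpha>) = (mult R \<otimes> mult H) \<cdot> (\<one> A \<otimes> cross \<otimes> \<one> V)"
  by (simp add: smash_def cross_def cross_via_def NF)

lemma hat_obj: "obj (hat_dual \<C> H D) = W"
  by (simp add: hat_dual_def cop_hopf_def op_hopf_def dual_hopf_def Let_def)

text \<open>
  The iterated smash product as a twisted tensor product of \<open>R\<close> with the Heisenberg double.
  The coproduct of \<open>H\<^sup>*\<close> is taken after \<open>R\<close> has been passed rather than before, and \<open>R\<close> is
  multiplied independently of what happens in the double.
\<close>

lemma mult_double_smash:
  "mult double_smash = (mult R \<otimes> heis_mult) \<cdot> (\<one> A \<otimes> cross_double \<otimes> \<one> (V \<odot> W))"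
proof -
  have as: "dual_action_smash \<C> R H D = (\<one> A \<otimes> act) \<cdot> (\<beta> W A \<otimes> \<one> V)"
    by (simp add: dual_action_smash_def act_def)
  have mh: "mult (smash \<C> R H \<alpha>) \<otimes> hmul
      = (mult R \<otimes> mult H \<otimes> hmul) \<cdot> (\<one> A \<otimes> cross \<otimes> \<one> (V \<odot> W \<odot> W))"
    unfolding mult_smash using interchange[of "\<one> A \<otimes> cross \<otimes> \<one> V" "mult R \<otimes> mult H" "\<one> (W \<odot> W)" hmul]
    by (simp add: R_normal cross_typing merge)
  have 1: "(\<one> (A \<odot> V) \<otimes> \<beta> W A \<otimes> \<one> (V \<odot> W \<odot> W)) \<cdot> (\<one> (A \<odot> V \<odot> W \<odot> A) \<otimes> \<beta> W V \<otimes> \<one> W)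
      = (\<one> (A \<odot> V \<odot> A \<odot> W) \<otimes> \<beta> W V \<otimes> \<one> W) \<cdot> (\<one> (A \<odot> V) \<otimes> \<beta> W A \<otimes> \<one> (W \<odot> V \<odot> W))"
    using exchange[of "\<one> (A \<odot> V) \<otimes> \<beta> W A" "\<beta> W V \<otimes> \<one> W" "A \<odot> V \<odot> W \<odot> A" "A \<odot> V \<odot> A \<odot> W"
      "W \<odot> V \<odot> W" "V \<odot> W \<odot> W"] by (simp add: NF)
  have "(\<beta> W A \<otimes> \<one> W) \<cdot> ((\<one> W \<otimes> \<beta> W A) \<cdot> (hcom \<otimes> \<one> A)) = (\<one> A \<otimes> hcom) \<cdot> \<beta> W A"
    using Braid_natural'[of hcom "\<one> A"] by (simp add: R_normal Braid_tensor_left)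
  then have "\<one> (A \<odot> V) \<otimes> ((\<beta> W A \<otimes> \<one> W) \<cdot> ((\<one> W \<otimes> \<beta> W A) \<cdot> (hcom \<otimes> \<one> A))) \<otimes> \<one> (V \<odot> W)
      = \<one> (A \<odot> V) \<otimes> ((\<one> A \<otimes> hcom) \<cdot> \<beta> W A) \<otimes> \<one> (V \<odot> W)" by simp
  then have 2: "(\<one> (A \<odot> V) \<otimes> \<beta> W A \<otimes> \<one> (W \<odot> V \<odot> W)) \<cdot> ((\<one> (A \<odot> V \<odot> W) \<otimes> \<beta> W A \<otimes> \<one> (V \<odot> W))
        \<cdot> (\<one> (A \<odot> V) \<otimes> hcom \<otimes> \<one> (A \<odot> V \<odot> W)))
      = (\<one> (A \<odot> V \<odot> A) \<otimes> hcom \<otimes> \<one> (V \<odot> W)) \<cdot> (\<one> (A \<odot> V) \<otimes> \<beta> W A \<otimes> \<one> (V \<odot> W))"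
    by (simp add: NF)
  have 3: "(\<one> A \<otimes> cross \<otimes> \<one> (V \<odot> W \<odot> W)) \<cdot> (\<one> (A \<odot> V \<odot> A) \<otimes> act \<otimes> \<one> (W \<odot> W))
      = (\<one> (A \<odot> A \<odot> V) \<otimes> act \<otimes> \<one> (W \<odot> W)) \<cdot> (\<one> A \<otimes> cross \<otimes> \<one> (W \<odot> V \<odot> W \<odot> W))"
    using exchange[of "\<one> A \<otimes> cross" "act \<otimes> \<one> (W \<odot> W)" "A \<odot> V \<odot> A" "A \<odot> A \<odot> V" "W \<odot> V \<odot> W \<odot> W"
        "V \<odot> W \<odot> W"]
    by (simp add: NF cross_typing)
  have 4: "(\<one> A \<otimes> cross \<otimes> \<one> (W \<odot> V \<odot> W \<odot> W)) \<cdot> (\<one> (A \<odot> V \<odot> A \<odot> W) \<otimes> \<beta> W V \<otimes> \<one> W)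
      = (\<one> (A \<odot> A \<odot> V \<odot> W) \<otimes> \<beta> W V \<otimes> \<one> W) \<cdot> (\<one> A \<otimes> cross \<otimes> \<one> (W \<odot> W \<odot> V \<odot> W))"
    using exchange[of "\<one> A \<otimes> cross" "\<one> W \<otimes> \<beta> W V \<otimes> \<one> W" "A \<odot> V \<odot> A" "A \<odot> A \<odot> V" "W \<odot> W \<odot> V \<odot> W"
        "W \<odot> V \<odot> W \<odot> W"]
    by (simp add: NF cross_typing)
  have 5: "(\<one> A \<otimes> cross \<otimes> \<one> (W \<odot> W \<odot> V \<odot> W)) \<cdot> (\<one> (A \<odot> V \<odot> A) \<otimes> hcom \<otimes> \<one> (V \<odot> W))
      = (\<one> (A \<odot> A \<odot> V) \<otimes> hcom \<otimes> \<one> (V \<odot> W)) \<cdot> (\<one> A \<otimes> cross \<otimes> \<one> (W \<odot> V \<odot> W))"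
    using exchange[of "\<one> A \<otimes> cross" "hcom \<otimes> \<one> (V \<odot> W)" "A \<odot> V \<odot> A" "A \<odot> A \<odot> V" "W \<odot> V \<odot> W"
        "W \<odot> W \<odot> V \<odot> W"]
    by (simp add: NF cross_typing)
  have 6: "mult R \<otimes> heis_mult = (mult R \<otimes> mult H \<otimes> hmul) \<cdot> (\<one> (A \<odot> A) \<otimes> ((\<one> V \<otimes> act \<otimes> \<one> (W \<odot> W)) \<cdot>
    ((\<one> (V \<odot> W) \<otimes> \<beta> W V \<otimes> \<one> W) \<cdot> (\<one> V \<otimes> hcom \<otimes> \<one> (V \<odot> W)))))"
    unfolding heis_mult_def by (simp add: R_normal interchange)
  have "mult double_smash = (mult (smash \<C> R H \<alpha>) \<otimes> hmul)
       \<cdot> ((\<one> (A \<odot> V) \<otimes> ((\<one> A \<otimes> act) \<cdot> (\<beta> W A \<otimes> \<one> V)) \<otimes> \<one> (W \<odot> W))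
       \<cdot> ((\<one> (A \<odot> V \<odot> W) \<otimes> \<beta> W (A \<odot> V) \<otimes> \<one> W)
       \<cdot> (\<one> (A \<odot> V) \<otimes> hcom \<otimes> \<one> (A \<odot> V \<odot> W))))"
    using mult_smash
    by (simp add: double_smash_def smash_def[of \<C> _ "hat_dual \<C> H D"] hat_obj as R_normal cross_typing
        merge
        flip: hmul_def hcom_def) (simp add: smash_def R_normal merge cross_typing)
  also have "\<dots> = (mult R \<otimes> heis_mult) \<cdot> (\<one> A \<otimes> cross_double \<otimes> \<one> (V \<odot> W))"
    unfolding mh 6
    by (simp add: NF cross_typing cross_double_def Braid_tensor_right 1 tail[OF 1] 2 tail[OF 2] 3
        tail[OF 3] 4 tail[OF 4] 5 tail[OF 5])
  finally show ?thesis .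
qed

section \<open>The algebra of maps of free right modules\<close>

text \<open>
  The endomorphisms of the free right \<open>R\<close>-module \<open>H \<otimes> R\<close>. As \<open>R\<close> stands between \<open>H\<close> and \<open>H\<^sup>*\<close>,
  its product needs no braiding.
\<close>

definition matrix_alg :: "('o, 'm) algebra_data" where
  "matrix_alg = \<lparr>obj = V \<odot> A \<odot> W,
     mult = (\<one> V \<otimes> mult R \<otimes> \<one> W) \<cdot> (\<one> (V \<odot> A) \<otimes> ev D \<otimes> \<one> (A \<odot> W)),
     eta = (\<one> V \<otimes> eta R \<otimes> \<one> W) \<cdot> coev D\<rparr>"

lemma matrix_alg_simps:
  "obj matrix_alg = V \<odot> A \<odot> W"
  "mult matrix_alg = (\<one> V \<otimes> mult R \<otimes> \<one> W) \<cdot> (\<one> (V \<odot> A) \<otimes> ev D \<otimes> \<one> (A \<odot> W))"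
  "eta matrix_alg = (\<one> V \<otimes> eta R \<otimes> \<one> W) \<cdot> coev D"
  by (simp_all add: matrix_alg_def)

lemma snake: "X \<in> Obj \<C> \<Longrightarrow> Y \<in> Obj \<C> \<Longrightarrow>
    (\<one> (X \<odot> V) \<otimes> ev D \<otimes> \<one> Y) \<cdot> (\<one> X \<otimes> coev D \<otimes> \<one> (V \<odot> Y)) = \<one> (X \<odot> V \<odot> Y)"
proof -
  assume X: "X \<in> Obj \<C>" "Y \<in> Obj \<C>"
  have "\<one> X \<otimes> ((\<one> V \<otimes> ev D) \<cdot> (coev D \<otimes> \<one> V)) \<otimes> \<one> Y = \<one> X \<otimes> \<one> V \<otimes> \<one> Y"
    using left_dualD(10)[OF dual] by simp
  then show ?thesis using X by (simp add: NF)
qed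

lemma snake': "X \<in> Obj \<C> \<Longrightarrow> Y \<in> Obj \<C> \<Longrightarrow>
    (\<one> X \<otimes> ev D \<otimes> \<one> (W \<odot> Y)) \<cdot> (\<one> (X \<odot> W) \<otimes> coev D \<otimes> \<one> Y) = \<one> (X \<odot> W \<odot> Y)"
proof -
  assume X: "X \<in> Obj \<C>" "Y \<in> Obj \<C>"
  have "\<one> X \<otimes> ((ev D \<otimes> \<one> W) \<cdot> (\<one> W \<otimes> coev D)) \<otimes> \<one> Y = \<one> X \<otimes> \<one> W \<otimes> \<one> Y"
    using left_dualD(9)[OF dual] by simp
  then show ?thesis using X by (simp add: NF)
qed

lemma matrix_algebra: "algebra \<C> matrix_alg"
proof -
  have 1: "(\<one> (V \<odot> A) \<otimes> ev D \<otimes> \<one> (A \<odot> W)) \<cdot> (\<one> V \<otimes> mult R \<otimes> \<one> (W \<odot> V \<odot> A \<odot> W))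
      = (\<one> V \<otimes> mult R \<otimes> \<one> (A \<odot> W)) \<cdot> (\<one> (V \<odot> A \<odot> A) \<otimes> ev D \<otimes> \<one> (A \<odot> W))"
    using exchange[of "\<one> V \<otimes> mult R" "ev D \<otimes> \<one> (A \<odot> W)" "V \<odot> A \<odot> A" "V \<odot> A" "W \<odot> V \<odot> A \<odot> W" "A \<odot> W"]
    by (simp add: NF)
  have 2: "(\<one> (V \<odot> A) \<otimes> ev D \<otimes> \<one> (A \<odot> W)) \<cdot> (\<one> (V \<odot> A \<odot> W \<odot> V) \<otimes> mult R \<otimes> \<one> W)
      = (\<one> (V \<odot> A) \<otimes> mult R \<otimes> \<one> W) \<cdot> (\<one> (V \<odot> A) \<otimes> ev D \<otimes> \<one> (A \<odot> A \<odot> W))"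
    using exchange[of "\<one> (V \<odot> A) \<otimes> ev D" "mult R \<otimes> \<one> W" "V \<odot> A \<odot> W \<odot> V" "V \<odot> A" "A \<odot> A \<odot> W" "A \<odot> W"]
    by (simp add: NF)
  have 3: "(\<one> (V \<odot> A) \<otimes> ev D \<otimes> \<one> (A \<odot> A \<odot> W)) \<cdot> (\<one> (V \<odot> A \<odot> W \<odot> V \<odot> A) \<otimes> ev D \<otimes> \<one> (A \<odot> W))
      = (\<one> (V \<odot> A \<odot> A) \<otimes> ev D \<otimes> \<one> (A \<odot> W)) \<cdot> (\<one> (V \<odot> A) \<otimes> ev D \<otimes> \<one> (A \<odot> W \<odot> V \<odot> A \<odot> W))"
    using exchange[of "\<one> (V \<odot> A) \<otimes> ev D" "\<one> A \<otimes> ev D \<otimes> \<one> (A \<odot> W)" "V \<odot> A \<odot> W \<odot> V" "V \<odot> A"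
       "A \<odot> W \<odot> V \<odot> A \<odot> W" "A \<odot> A \<odot> W"]
    by (simp add: NF)
  have "\<one> V \<otimes> (mult R \<cdot> (mult R \<otimes> \<one> A)) \<otimes> \<one> W = \<one> V \<otimes> (mult R \<cdot> (\<one> A \<otimes> mult R)) \<otimes> \<one> W"
    by (simp add: R_axioms)
  then have 4: "(\<one> V \<otimes> mult R \<otimes> \<one> W) \<cdot> (\<one> V \<otimes> mult R \<otimes> \<one> (A \<odot> W)) = (\<one> V \<otimes> mult R \<otimes> \<one> W) \<cdot>
      (\<one> (V \<odot> A) \<otimes> mult R \<otimes> \<one> W)"
    by (simp add: NF)
  have a: "mult matrix_alg \<cdot> (mult matrix_alg \<otimes> \<one> (obj matrix_alg)) = mult matrix_alg \<cdot>
      (\<one> (obj matrix_alg) \<otimes> mult matrix_alg)"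
    by (simp add: matrix_alg_simps NF 1 tail[OF 1] 2 tail[OF 2] 3 tail[OF 3] 4 tail[OF 4])
  have 5: "(\<one> (V \<odot> A) \<otimes> ev D \<otimes> \<one> (A \<odot> W)) \<cdot> (\<one> V \<otimes> eta R \<otimes> \<one> (W \<odot> V \<odot> A \<odot> W))
      = (\<one> V \<otimes> eta R \<otimes> \<one> (A \<odot> W)) \<cdot> (\<one> V \<otimes> ev D \<otimes> \<one> (A \<odot> W))"
    using exchange[of "\<one> V \<otimes> eta R" "ev D \<otimes> \<one> (A \<odot> W)" V "V \<odot> A" "W \<odot> V \<odot> A \<odot> W" "A \<odot> W"]
    by (simp add: NF)
  have "\<one> V \<otimes> (mult R \<cdot> (eta R \<otimes> \<one> A)) \<otimes> \<one> W = \<one> V \<otimes> \<one> A \<otimes> \<one> W" by (simp add: R_axioms)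
  then have 6: "(\<one> V \<otimes> mult R \<otimes> \<one> W) \<cdot> (\<one> V \<otimes> eta R \<otimes> \<one> (A \<odot> W)) = \<one> (V \<odot> A \<odot> W)" by (simp add: NF)
  have b: "mult matrix_alg \<cdot> (eta matrix_alg \<otimes> \<one> (obj matrix_alg)) = \<one> (obj matrix_alg)"
    using snake[of \<I> "A \<odot> W"] by (simp add: matrix_alg_simps NF tail[OF 5] 6 tail[OF 6])
  have 7: "(\<one> (V \<odot> A) \<otimes> ev D \<otimes> \<one> (A \<odot> W)) \<cdot> (\<one> (V \<odot> A \<odot> W \<odot> V) \<otimes> eta R \<otimes> \<one> W)
      = (\<one> (V \<odot> A) \<otimes> eta R \<otimes> \<one> W) \<cdot> (\<one> (V \<odot> A) \<otimes> ev D \<otimes> \<one> W)"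
    using exchange[of "\<one> (V \<odot> A) \<otimes> ev D" "eta R \<otimes> \<one> W" "V \<odot> A \<odot> W \<odot> V" "V \<odot> A" W "A \<odot> W"]
    by (simp add: NF)
  have "\<one> V \<otimes> (mult R \<cdot> (\<one> A \<otimes> eta R)) \<otimes> \<one> W = \<one> V \<otimes> \<one> A \<otimes> \<one> W" by (simp add: R_axioms)
  then have 8: "(\<one> V \<otimes> mult R \<otimes> \<one> W) \<cdot> (\<one> (V \<odot> A) \<otimes> eta R \<otimes> \<one> W) = \<one> (V \<odot> A \<odot> W)" by (simp add: NF)
  have c: "mult matrix_alg \<cdot> (\<one> (obj matrix_alg) \<otimes> eta matrix_alg) = \<one> (obj matrix_alg)"
    using snake'[of "V \<odot> A" \<I>] by (simp add: matrix_alg_simps NF tail[OF 7] 8 tail[OF 8])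
  show ?thesis using a b c by (simp add: algebra_def in_hom_def matrix_alg_simps R_normal)
qed

text \<open>
  A map \<open>X \<otimes> H \<rightarrow> H \<otimes> R\<close>, a family of maps of right \<open>R\<close>-modules parametrised by \<open>X\<close>, as a map
  into the algebra of such maps.
\<close>

definition bend :: "'o \<Rightarrow> 'm \<Rightarrow> 'm" where
  "bend X f = (f \<otimes> \<one> W) \<cdot> (\<one> X \<otimes> coev D)"

lemma bend_pre:
  assumes "X \<in> Obj \<C>" "f \<in> Arr \<C>" "Dom \<C> f = X \<odot> V" "k \<in> Arr \<C>" "Dom \<C> k = Z" "Cod \<C> k = X"
  shows "bend X f \<cdot> k = bend Z (f \<cdot> (k \<otimes> \<one> V))"
proof -
  have Z: "Z \<in> Obj \<C>" using assms Dom_Obj by blast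
  have 1: "(\<one> X \<otimes> coev D) \<cdot> k = (k \<otimes> \<one> (V \<odot> W)) \<cdot> (\<one> Z \<otimes> coev D)"
    using exchange[of k "coev D" Z X \<I> "V \<odot> W"] assms Z by (simp add: R_normal)
  show ?thesis using assms Z by (simp add: bend_def NF 1)
qed

text \<open>
  The product of the algebra is composition of the bent maps, extended to \<open>H \<otimes> R\<close> by
  multiplication from the right.
\<close>

lemma bend_mult:
  assumes X: "X \<in> Obj \<C>" "Y \<in> Obj \<C>"
    and f: "f \<in> Arr \<C>" "Dom \<C> f = X \<odot> V" "Cod \<C> f = V \<odot> A"
    and g: "g \<in> Arr \<C>" "Dom \<C> g = Y \<odot> V" "Cod \<C> g = V \<odot> A"
  shows "mult matrix_alg \<cdot> (bend X f \<otimes> bend Y g)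
      = bend (X \<odot> Y) ((\<one> V \<otimes> mult R) \<cdot> ((f \<otimes> \<one> A) \<cdot> (\<one> X \<otimes> g)))"
proof -
  note h = X f g
  have b: "bend Y g \<in> Arr \<C>" "Dom \<C> (bend Y g) = Y" "Cod \<C> (bend Y g) = V \<odot> A \<odot> W"
    using h by (simp_all add: bend_def R_normal)
  have b': "bend X f \<in> Arr \<C>" "Dom \<C> (bend X f) = X" "Cod \<C> (bend X f) = V \<odot> A \<odot> W"
    using h by (simp_all add: bend_def R_normal)
  have 1: "bend X f \<otimes> bend Y g = (bend X f \<otimes> \<one> (V \<odot> A \<odot> W)) \<cdot> (\<one> X \<otimes> bend Y g)"
    using b b' h by (simp add: R_normal interchange)
  have 2: "(\<one> (V \<odot> A) \<otimes> ev D \<otimes> \<one> (A \<odot> W)) \<cdot> (f \<otimes> \<one> (W \<odot> V \<odot> A \<odot> W))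
      = (f \<otimes> \<one> (A \<odot> W)) \<cdot> (\<one> (X \<odot> V) \<otimes> ev D \<otimes> \<one> (A \<odot> W))"
    using exchange[of f "ev D \<otimes> \<one> (A \<odot> W)" "X \<odot> V" "V \<odot> A" "W \<odot> V \<odot> A \<odot> W"
        "A \<odot> W"] h by (simp add: NF)
  have 3: "(\<one> (X \<odot> V) \<otimes> ev D \<otimes> \<one> (A \<odot> W)) \<cdot> (\<one> X \<otimes> coev D \<otimes> \<one> (V \<odot> A \<odot> W)) = \<one> (X \<odot> V \<odot> A \<odot> W)"
    using snake[of X "A \<odot> W"] h by (simp add: R_normal)
  show ?thesis
    unfolding 1 matrix_alg_simps using h
    by (simp add: bend_def[of X f] bend_def[of Y g] bend_def[of "X \<odot> Y"] NF tail[OF 2] tail[OF 3])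
qed

section \<open>The isomorphism\<close>

text \<open>
  The action of \<open>(R # H) # H\<^sup>*\<close> on \<open>x \<in> H \<subseteq> R # H\<close>, which is \<open>r # h # \<phi> \<otimes> x \<mapsto> r # h (\<phi> \<rightharpoonup> x)\<close>,
  read in \<open>H \<otimes> R\<close>.
\<close>

definition rep_kernel :: 'm where "rep_kernel = cross_inv \<cdot> (\<one> A \<otimes> rep)"

lemma rep_kernel_typing: "rep_kernel \<in> Arr \<C>" "Dom \<C> rep_kernel = A \<odot> V \<odot> W \<odot> V"
    "Cod \<C> rep_kernel = V \<odot> A"
  by (simp_all add: rep_kernel_def R_normal cross_inv)

lemma cross_cancel:
  assumes "cross \<cdot> x = cross \<cdot> y" "x \<in> Arr \<C>" "y \<in> Arr \<C>" "Cod \<C> x = V \<odot> A" "Cod \<C> y = V \<odot> A"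
  shows "x = y"
proof -
  have "(cross_inv \<cdot> cross) \<cdot> x = (cross_inv \<cdot> cross) \<cdot> y" using assms
      by (simp add: R_normal cross_inv(1-3) cross_typing)
  then show ?thesis using assms by (simp add: cross_inv R_normal)
qed

lemma mult_double_smash_typing:
  "mult double_smash \<in> Arr \<C>" "Dom \<C> (mult double_smash) = A \<odot> V \<odot> W \<odot> A \<odot> V \<odot> W"
  "Cod \<C> (mult double_smash) = A \<odot> V \<odot> W"
  by (simp_all add: mult_double_smash R_normal heis_mult_typing cross_double_typing)

lemma cross_rep_kernel: "cross \<cdot> rep_kernel = \<one> A \<otimes> rep"
proof -
  have "cross \<cdot> rep_kernel = (cross \<cdot> cross_inv) \<cdot> (\<one> A \<otimes> rep)"
    unfolding rep_kernel_def by (simp add: R_normal cross_inv(1-3) cross_typing)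
  then show ?thesis by (simp add: cross_inv R_normal)
qed

text \<open>
  Read in \<open>R # H\<close>, that is after composing with \<open>cross\<close>, both sides are the action of a
  product on \<open>x\<close>: on the left the action is extended to \<open>R # H\<close> by right multiplication, which
  is the actual action by \<open>cross_rep\<close>, and \<open>rep_mult\<close> concludes.
\<close>

lemma rep_kernel_mult: "(\<one> V \<otimes> mult R) \<cdot> ((rep_kernel \<otimes> \<one> A) \<cdot> (\<one> (A \<odot> V \<odot> W) \<otimes> rep_kernel))
    = rep_kernel \<cdot> (mult double_smash \<otimes> \<one> V)"
proof (rule cross_cancel)
  note t = R_normal rep_kernel_typing cross_typing mult_double_smash_typing cross_double_typing
      heis_mult_typing
  have "(cross \<cdot> rep_kernel) \<otimes> \<one> A = \<one> A \<otimes> rep \<otimes> \<one> A" unfolding cross_rep_kernel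
      by (simp add: R_normal)
  then have 1: "(cross \<otimes> \<one> A) \<cdot> (rep_kernel \<otimes> \<one> A) = \<one> A \<otimes> rep \<otimes> \<one> A" by (simp add: t split)
  have "\<one> (A \<odot> V \<odot> W) \<otimes> (cross \<cdot> rep_kernel) = \<one> (A \<odot> V \<odot> W) \<otimes> \<one> A \<otimes> rep" unfolding cross_rep_kernel
      ..
  then have 2: "(\<one> (A \<odot> V \<odot> W) \<otimes> cross) \<cdot> (\<one> (A \<odot> V \<odot> W) \<otimes> rep_kernel) = \<one> (A \<odot> V \<odot> W \<odot> A) \<otimes> rep"
    by (simp add: t split merge)
  have "\<one> A \<otimes> (cross \<cdot> (rep \<otimes> \<one> A)) = \<one> A \<otimes> ((\<one> A \<otimes> rep) \<cdot> ((cross_double \<otimes> \<one> V) \<cdot>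
      (\<one> (V \<odot> W) \<otimes> cross)))"
    unfolding cross_rep ..
  then have 3: "(\<one> A \<otimes> cross) \<cdot> (\<one> A \<otimes> rep \<otimes> \<one> A)
      = (\<one> (A \<odot> A) \<otimes> rep) \<cdot> ((\<one> A \<otimes> cross_double \<otimes> \<one> V) \<cdot> (\<one> (A \<odot> V \<odot> W) \<otimes> cross))"
    by (simp add: t split merge)
  have 4: "(\<one> A \<otimes> cross_double \<otimes> \<one> V) \<cdot> (\<one> (A \<odot> V \<odot> W \<odot> A) \<otimes> rep)
      = (\<one> (A \<odot> A \<odot> V \<odot> W) \<otimes> rep) \<cdot> (\<one> A \<otimes> cross_double \<otimes> \<one> (V \<odot> W \<odot> V))"
    using exchange[of "\<one> A \<otimes> cross_double" rep "A \<odot> V \<odot> W \<odot> A" "A \<odot> A \<odot> V \<odot> W" "V \<odot> W \<odot> V" V]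
    by (simp add: t merge)
  have "rep \<cdot> (heis_mult \<otimes> \<one> V) = rep \<cdot> (\<one> (V \<odot> W) \<otimes> rep)"
    using rep_mult by (simp add: heis_mult_def)
  then have "\<one> (A \<odot> A) \<otimes> (rep \<cdot> (heis_mult \<otimes> \<one> V)) = \<one> (A \<odot> A) \<otimes> (rep \<cdot> (\<one> (V \<odot> W) \<otimes> rep))" by simp
  then have 5: "(\<one> (A \<odot> A) \<otimes> rep) \<cdot> (\<one> (A \<odot> A \<odot> V \<odot> W) \<otimes> rep) = (\<one> (A \<odot> A) \<otimes> rep) \<cdot>
      (\<one> (A \<odot> A) \<otimes> heis_mult \<otimes> \<one> V)"
    by (simp add: t split merge)
  have 6: "(mult R \<otimes> \<one> V) \<cdot> (\<one> (A \<odot> A) \<otimes> rep) = (\<one> A \<otimes> rep) \<cdot> (mult R \<otimes> \<one> (V \<odot> W \<odot> V))"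
    by (rule exchange) (simp_all add: t)
  have 7: "mult R \<otimes> heis_mult = (mult R \<otimes> \<one> (V \<odot> W)) \<cdot> (\<one> (A \<odot> A) \<otimes> heis_mult)"
    by (simp add: t interchange)
  have "cross \<cdot> ((\<one> V \<otimes> mult R) \<cdot> ((rep_kernel \<otimes> \<one> A) \<cdot> (\<one> (A \<odot> V \<odot> W) \<otimes> rep_kernel)))
      = (\<one> A \<otimes> rep) \<cdot> (mult double_smash \<otimes> \<one> V)"
    unfolding mult_double_smash 7
    by (simp add: t split merge tail[OF cross_mult] tail[OF 1] 3 tail[OF 3] 2 tail[OF 2] 4
        tail[OF 4] 5 tail[OF 5] 6 tail[OF 6])
  also have "\<dots> = cross \<cdot> (rep_kernel \<cdot> (mult double_smash \<otimes> \<one> V))"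
    by (simp add: t tail[OF cross_rep_kernel])
  finally show "cross \<cdot> ((\<one> V \<otimes> mult R) \<cdot> ((rep_kernel \<otimes> \<one> A) \<cdot> (\<one> (A \<odot> V \<odot> W) \<otimes> rep_kernel)))
      = cross \<cdot> (rep_kernel \<cdot> (mult double_smash \<otimes> \<one> V))" .
qed (simp_all add: R_normal rep_kernel_typing mult_double_smash_typing)

definition duality_iso :: 'm where "duality_iso = (cross_inv \<otimes> \<one> W) \<cdot> (\<one> A \<otimes> theta)"

lemma duality_iso_bend: "duality_iso = bend (A \<odot> V \<odot> W) rep_kernel"
  by (simp add: duality_iso_def bend_def rep_kernel_def theta_def NF cross_inv(1-3))

lemma duality_iso_typing: "duality_iso \<in> Arr \<C>" "Dom \<C> duality_iso = A \<odot> V \<odot> W"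
    "Cod \<C> duality_iso = V \<odot> A \<odot> W"
  by (simp_all add: duality_iso_def R_normal cross_inv)

lemma duality_iso_inverse: "inverse_arrows \<C> duality_iso ((\<one> A \<otimes> theta_inv) \<cdot> (cross \<otimes> \<one> W))"
proof -
  have "(cross_inv \<cdot> cross) \<otimes> \<one> W = \<one> (V \<odot> A) \<otimes> \<one> W" "(cross \<cdot> cross_inv) \<otimes> \<one> W = \<one> (A \<odot> V) \<otimes> \<one> W"
    by (simp_all add: cross_inv)
  then have g: "(cross_inv \<otimes> \<one> W) \<cdot> (cross \<otimes> \<one> W) = \<one> (V \<odot> A \<odot> W)"
      "(cross \<otimes> \<one> W) \<cdot> (cross_inv \<otimes> \<one> W) = \<one> (A \<odot> V \<odot> W)"
    by (simp_all add: NF cross_inv(1-3) cross_typing)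
  have "\<one> A \<otimes> (theta \<cdot> theta_inv) = \<one> A \<otimes> \<one> (V \<odot> W)" "\<one> A \<otimes> (theta_inv \<cdot> theta) = \<one> A \<otimes> \<one> (V \<odot> W)"
    by (simp_all add: theta_theta_inv theta_inv_theta)
  then have h: "(\<one> A \<otimes> theta) \<cdot> (\<one> A \<otimes> theta_inv) = \<one> (A \<odot> V \<odot> W)"
      "(\<one> A \<otimes> theta_inv) \<cdot> (\<one> A \<otimes> theta) = \<one> (A \<odot> V \<odot> W)"
    by (simp_all add: NF)
  show ?thesis
    by (simp add: inverse_arrows_def in_hom_def duality_iso_typing)
      (simp add: duality_iso_def R_normal cross_inv(1-3) cross_typing g h tail[OF g(1)] tail[OF g(2)]
          tail[OF h(1)] tail[OF h(2)])
qed

lemma double_smash_simps: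
  "obj double_smash = A \<odot> V \<odot> W" "eta double_smash = eta R \<otimes> eta H \<otimes> hunit"
  by (simp_all add: double_smash_def smash_def hat_obj R_normal flip: hunit_def)

lemma duality_iso_hom: "algebra_hom \<C> duality_iso double_smash matrix_alg"
proof -
  have m: "duality_iso \<cdot> mult double_smash = mult matrix_alg \<cdot> (duality_iso \<otimes> duality_iso)"
    unfolding duality_iso_bend
    using bend_mult[of "A \<odot> V \<odot> W" "A \<odot> V \<odot> W" rep_kernel rep_kernel]
      bend_pre[of "A \<odot> V \<odot> W" rep_kernel "mult double_smash" "A \<odot> V \<odot> W \<odot> A \<odot> V \<odot> W"]
    by (simp add: R_normal rep_kernel_typing mult_double_smash_typing rep_kernel_mult)
  have 1: "rep_kernel \<cdot> (eta double_smash \<otimes> \<one> V) = \<one> V \<otimes> eta R"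
  proof (rule cross_cancel)
    have "(\<one> A \<otimes> rep) \<cdot> (eta double_smash \<otimes> \<one> V) = eta R \<otimes> (rep \<cdot> (eta H \<otimes> hunit \<otimes> \<one> V))"
      using interchange[of "eta R" "\<one> A"
          "eta H \<otimes> hunit \<otimes> \<one> V" rep] by (simp add: double_smash_simps R_normal)
    then show "cross \<cdot> (rep_kernel \<cdot> (eta double_smash \<otimes> \<one> V)) = cross \<cdot> (\<one> V \<otimes> eta R)"
      unfolding rep_unit cross_eta
      by (simp add: tail[OF cross_rep_kernel] double_smash_simps R_normal rep_kernel_typing
          cross_typing)
  qed (simp_all add: double_smash_simps R_normal rep_kernel_typing)
  have "duality_iso \<cdot> eta double_smash = bend \<I> (rep_kernel \<cdot> (eta double_smash \<otimes> \<one> V))"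
    unfolding duality_iso_bend by (rule bend_pre) (simp_all add: double_smash_simps R_normal
        rep_kernel_typing)
  then have u: "duality_iso \<cdot> eta double_smash = eta matrix_alg"
    unfolding 1 by (simp add: bend_def matrix_alg_simps R_normal)
  show ?thesis using m u duality_iso_typing
    by (simp add: algebra_hom_def in_hom_def double_smash_simps matrix_alg_simps)
qed

definition tensor_target :: "('o, 'm) algebra_data" where
  "tensor_target = tensor_algebra \<C> R (contraction_algebra \<C> V D)"

lemma tensor_target_simps:
  "obj tensor_target = A \<odot> V \<odot> W"
  "mult tensor_target = (mult R \<otimes> \<one> V \<otimes> ev D \<otimes> \<one> W) \<cdot> (\<one> A \<otimes> \<beta> (V \<odot> W) A \<otimes> \<one> (V \<odot> W))"
  "eta tensor_target = eta R \<otimes> coev D"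
  by (simp_all add: tensor_target_def tensor_algebra_def contraction_algebra_def)

text \<open>
  On both sides the second factor \<open>H \<otimes> R\<close> is contracted with \<open>H\<^sup>*\<close> and its \<open>R\<close> ends up to the
  right of the first one; sliding the evaluation past \<open>R\<close> is naturality of the braiding.
\<close>

lemma braid_hom: "algebra_hom \<C> (\<beta> V A \<otimes> \<one> W) matrix_alg tensor_target"
proof -
  let ?t = "\<beta> V A \<otimes> \<one> W"
  have "\<beta> V A \<cdot> (\<one> V \<otimes> ev D \<otimes> \<one> A) = (\<one> (A \<odot> V) \<otimes> ev D) \<cdot> \<beta> (V \<odot> W \<odot> V) A"
    using Braid_natural'[of "\<one> V \<otimes> ev D" "\<one> A"] by (simp add: R_normal merge)
  also have "\<beta> (V \<odot> W \<odot> V) A = (\<beta> (V \<odot> W) A \<otimes> \<one> V) \<cdot> (\<one> (V \<odot> W) \<otimes> \<beta> V A)"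
    using Braid_tensor_left[of "V \<odot> W" V A] by (simp add: R_normal)
  finally have "\<one> A \<otimes> (\<beta> V A \<cdot> (\<one> V \<otimes> ev D \<otimes> \<one> A)) \<otimes> \<one> W
     = \<one> A \<otimes> ((\<one> (A \<odot> V) \<otimes> ev D) \<cdot> ((\<beta> (V \<odot> W) A \<otimes> \<one> V) \<cdot> (\<one> (V \<odot> W) \<otimes> \<beta> V A))) \<otimes> \<one> W"
    by simp
  then have 1: "(\<one> (A \<odot> A \<odot> V) \<otimes> ev D \<otimes> \<one> W) \<cdot> ((\<one> A \<otimes> \<beta> (V \<odot> W) A \<otimes> \<one> (V \<odot> W)) \<cdot>
      (\<one> (A \<odot> V \<odot> W) \<otimes> \<beta> V A \<otimes> \<one> W))
     = (\<one> A \<otimes> \<beta> V A \<otimes> \<one> W) \<cdot> (\<one> (A \<odot> V) \<otimes> ev D \<otimes> \<one> (A \<odot> W))"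
    by (simp add: NF)
  have 2: "?t \<otimes> ?t = (\<one> (A \<odot> V \<odot> W) \<otimes> \<beta> V A \<otimes> \<one> W) \<cdot> (\<beta> V A \<otimes> \<one> (W \<odot> V \<odot> A \<odot> W))"
    using interchange[of ?t "\<one> (A \<odot> V \<odot> W)" "\<one> (V \<odot> A \<odot> W)" ?t] by (simp add: R_normal merge)
  have 3: "(\<one> (A \<odot> V) \<otimes> ev D \<otimes> \<one> (A \<odot> W)) \<cdot> (\<beta> V A \<otimes> \<one> (W \<odot> V \<odot> A \<odot> W))
      = (\<beta> V A \<otimes> \<one> (A \<odot> W)) \<cdot> (\<one> (V \<odot> A) \<otimes> ev D \<otimes> \<one> (A \<odot> W))"
    using exchange[of "\<beta> V A" "ev D \<otimes> \<one> (A \<odot> W)" "V \<odot> A" "A \<odot> V" "W \<odot> V \<odot> A \<odot> W" "A \<odot> W"]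
    by (simp add: R_normal)
  have "\<beta> V A \<cdot> (\<one> V \<otimes> mult R) = (mult R \<otimes> \<one> V) \<cdot> ((\<one> A \<otimes> \<beta> V A) \<cdot> (\<beta> V A \<otimes> \<one> A))"
    using Braid_natural'[of "\<one> V" "mult R"] by (simp add: R_normal Braid_tensor_right)
  then have "(\<beta> V A \<cdot> (\<one> V \<otimes> mult R)) \<otimes> \<one> W = ((mult R \<otimes> \<one> V) \<cdot> ((\<one> A \<otimes> \<beta> V A) \<cdot>
      (\<beta> V A \<otimes> \<one> A))) \<otimes> \<one> W"
    by simp
  then have 4: "(\<beta> V A \<otimes> \<one> W) \<cdot> (\<one> V \<otimes> mult R \<otimes> \<one> W)
      = (mult R \<otimes> \<one> (V \<odot> W)) \<cdot> ((\<one> A \<otimes> \<beta> V A \<otimes> \<one> W) \<cdot> (\<beta> V A \<otimes> \<one> (A \<odot> W)))"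
    by (simp add: NF)
  have 5: "mult R \<otimes> \<one> V \<otimes> ev D \<otimes> \<one> W = (mult R \<otimes> \<one> (V \<odot> W)) \<cdot> (\<one> (A \<odot> A \<odot> V) \<otimes> ev D \<otimes> \<one> W)"
    using exchange[of "mult R" "\<one> V \<otimes> ev D \<otimes> \<one> W" "A \<odot> A" A "V \<odot> W \<odot> V \<odot> W" "V \<odot> W"]
      interchange[of "\<one> (A \<odot> A)" "mult R" "\<one> V \<otimes> ev D \<otimes> \<one> W" "\<one> (V \<odot> W)"]
    by (simp add: R_normal merge)
  have m: "?t \<cdot> mult matrix_alg = mult tensor_target \<cdot> (?t \<otimes> ?t)"
    unfolding tensor_target_simps matrix_alg_simps 2 5
    by (simp add: R_normal merge tail3[OF 1] 3 tail[OF 3] tail[OF 4])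
  have "\<beta> V A \<cdot> (\<one> V \<otimes> eta R) = eta R \<otimes> \<one> V"
    using Braid_natural'[of "\<one> V" "eta R"] by (simp add: R_normal Braid_unit_right)
  then have "(\<beta> V A \<cdot> (\<one> V \<otimes> eta R)) \<otimes> \<one> W = eta R \<otimes> \<one> (V \<odot> W)" by (simp add: R_normal merge)
  then have 6: "(\<beta> V A \<otimes> \<one> W) \<cdot> (\<one> V \<otimes> eta R \<otimes> \<one> W) = eta R \<otimes> \<one> (V \<odot> W)"
    by (simp add: NF)
  have u: "?t \<cdot> eta matrix_alg = eta tensor_target"
    unfolding tensor_target_simps matrix_alg_simps
    using interchange[of "\<one> \<I>" "eta R" "coev D" "\<one> (V \<odot> W)"]
    by (simp add: R_normal tail[OF 6])
  show ?thesis using m u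
    by (simp add: algebra_hom_def in_hom_def tensor_target_simps(1) matrix_alg_simps(1) R_normal)
qed

theorem duality: "isomorphic_algebras \<C> double_smash tensor_target"
proof -
  let ?t = "\<beta> V A \<otimes> \<one> W"
  obtain braid_inv
      where braid_inv: "braid_inv \<in> Arr \<C>" "Dom \<C> braid_inv = A \<odot> V" "Cod \<C> braid_inv = V \<odot> A"
    "braid_inv \<cdot> \<beta> V A = \<one> (V \<odot> A)" "\<beta> V A \<cdot> braid_inv = \<one> (A \<odot> V)"
    using Braid_iso[of V A] by (auto simp: inverse_arrows_def in_hom_def R_normal)
  have t: "inverse_arrows \<C> ?t (braid_inv \<otimes> \<one> W)" "inverse_arrows \<C> (braid_inv \<otimes> \<one> W) ?t"
    using braid_inv by (simp_all add: inverse_arrows_def in_hom_def R_normal interchange merge)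
  note M = matrix_algebra[unfolded algebra_def]
  have ty: "obj double_smash \<in> Obj \<C>"
      "\<guillemotleft>mult double_smash : obj double_smash \<odot> obj double_smash \<rightarrow> obj double_smash\<guillemotright>"
    "\<guillemotleft>eta double_smash : \<I> \<rightarrow> obj double_smash\<guillemotright>" "obj tensor_target \<in> Obj \<C>"
    "\<guillemotleft>mult tensor_target : obj tensor_target \<odot> obj tensor_target \<rightarrow> obj tensor_target\<guillemotright>"
        "\<guillemotleft>eta tensor_target : \<I> \<rightarrow> obj tensor_target\<guillemotright>"
    by (simp_all add: in_hom_def double_smash_simps tensor_target_simps mult_double_smash_typing
        R_normal)
  have braid_inv_hom: "algebra_hom \<C> (braid_inv \<otimes> \<one> W) tensor_target matrix_alg"
    by (rule algebra_hom_inverse[OF t(1) braid_hom]) (use M ty in auto)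
  have T: "algebra \<C> tensor_target"
    by (rule algebra_transport[OF t(2) braid_inv_hom matrix_algebra]) (use ty in auto)
  have hom: "algebra_hom \<C> (?t \<cdot> duality_iso) double_smash tensor_target"
    by (rule algebra_hom_comp[OF duality_iso_hom braid_hom T]) (use M ty in auto)
  let ?g = "(\<one> A \<otimes> theta_inv) \<cdot> (cross \<otimes> \<one> W)"
  have g: "?g \<in> Arr \<C>" "Dom \<C> ?g = V \<odot> A \<odot> W" "Cod \<C> ?g = A \<odot> V \<odot> W"
    "?g \<cdot> duality_iso = \<one> (A \<odot> V \<odot> W)" "duality_iso \<cdot> ?g = \<one> (V \<odot> A \<odot> W)"
    using duality_iso_inverse by (simp_all add: inverse_arrows_def in_hom_def duality_iso_typing)
  define g where "g = ?g"
  have g': "g \<in> Arr \<C>" "Dom \<C> g = V \<odot> A \<odot> W" "Cod \<C> g = A \<odot> V \<odot> W"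
    "g \<cdot> duality_iso = \<one> (A \<odot> V \<odot> W)" "duality_iso \<cdot> g = \<one> (V \<odot> A \<odot> W)"
    using g unfolding g_def by auto
  have t': "(braid_inv \<otimes> \<one> W) \<cdot> ?t = \<one> (V \<odot> A \<odot> W)" "?t \<cdot> (braid_inv \<otimes> \<one> W) = \<one> (A \<odot> V \<odot> W)"
    using braid_inv by (simp_all add: R_normal interchange merge)
  have inv: "inverse_arrows \<C> (?t \<cdot> duality_iso) (g \<cdot> (braid_inv \<otimes> \<one> W))"
    using braid_inv g'(1-3)
    by (simp add: inverse_arrows_def in_hom_def R_normal duality_iso_typing tail[OF t'(1)]
        tail[OF g'(5)] g'(4) t'(2))
  have S: "algebra \<C> double_smash"
    by (rule algebra_transport[OF inv hom T]) (use ty in auto)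
  have "algebra_hom \<C> (g \<cdot> (braid_inv \<otimes> \<one> W)) tensor_target double_smash"
    by (rule algebra_hom_inverse[OF inv hom]) (use ty in auto)
  then show ?thesis using S T inv hom unfolding isomorphic_algebras_def by blast
qed

end

theorem theorem2p8:
  fixes \<C> :: "('o, 'm) braided_category"
    and H :: "('o, 'm) hopf_data"
    and D :: "('o, 'm) dual_data"
    and R :: "('o, 'm) algebra_data"
    and \<alpha> :: 'm
  assumes "strict_braided_tensor_category \<C>"
    and "hopf_algebra \<C> H"
    and "left_dual \<C> (obj H) D"
    and "inverse_arrows \<C> (Braid \<C> (obj H) (obj H)) (Braid \<C> (obj H) (obj H))"
    and "module_algebra \<C> H R \<alpha>"
  shows "isomorphic_algebras \<C>
    (smash \<C> (smash \<C> R H \<alpha>) (hat_dual \<C> H D) (dual_action_smash \<C> R H D))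
    (tensor_algebra \<C> R (contraction_algebra \<C> (obj H) D))"
proof -
  interpret strict_braided_tensor_category \<C> by (rule assms(1))
  have "obj H \<in> Obj \<C>" using assms(3) by (simp add: left_dual_def)
  then have "\<beta>\<^bsub>\<C>\<^esub> (obj H) (obj H) \<cdot>\<^bsub>\<C>\<^esub> \<beta>\<^bsub>\<C>\<^esub> (obj H) (obj H) = \<one>\<^bsub>\<C>\<^esub> (obj H \<odot>\<^bsub>\<C>\<^esub> obj H)"
    using assms(4) by (simp add: inverse_arrows_def Braid_typing)
  then interpret smash_duality \<C> H D R \<alpha>
    using assms by unfold_locales
  show ?thesis using duality by (simp add: double_smash_def tensor_target_def)
qed

end
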